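(* Let $G$ and $G'$ be two Abelian cyclically ordered groups. Then $G$ and $G'$ satisfy the same universal sentences (in the language $\{+,R,0,-\}$) if and only if their torsion subgroups $T(G)$ and $T(G')$ are isomorphic and either $K(G)$ and $K(G')$ are both finite and isomorphic, or $K(G)$ and $K(G')$ are both infinite.
   Context: A cyclically ordered group (c.o.g.) is a group with a ternary relation $R$ that is strict, total (pairwise distinct $x,y,z$ satisfy $R(x,y,z)$ or $R(x,z,y)$), cyclic ($R(x,y,z)\Rightarrow R(y,z,x)$), transitive ($R(x,y,z)\wedge R(y,u,z)\Rightarrow R(x,u,z)$) and compatible with the group law. $\mathbb{K}$ is the multiplicative group of complex numbers of modulus $1$, cyclically ordered by $R(x,y,z)$ iff $\theta(x)<\theta(y)<\theta(z)$ or $\theta(y)<\theta(z)<\theta(x)$ or $\theta(z)<\theta(x)<\theta(y)$, where $\theta(x)\in[0,2\pi)$ is the argument. For a c.o.g. $(C,R)$ and a totally ordered group $L$, the lexicographic product $C\overrightarrow{\times}L$ is $C\times L$ with $R'((c,r),(c',r'),(c'',r''))$ iff $R(c,c',c'')$, or ($c=c'\neq c''$ and $r<r'$), or ($c\neq c'=c''$ and $r'<r''$), or ($c=c''\neq c'$ and $r''<r$), or ($c=c'=c''$ and ($r<r'<r''$ or $r'<r''<r$ or $r''<r<r'$)). Every c.o.g. $G$ embeds into $\mathbb{K}\overrightarrow{\times}L$ for some totally ordered group $L$, and the image of $G$ under the first projection does not depend on the embedding; it is denoted $K(G)$ (the winding part of $G$). $T(G)$ is the subgroup of torsion elements.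
   Formalization: The formal theorem additionally assumes that G and G' are both finite or both infinite; without this the claim fails, e.g. for Z/n and the lexicographic product of Z/n with Z, which have the same T and K but differ on the universal sentence "nx = 0 for all x". *)

theory Defs
  imports "HOL-Algebra.Group" "HOL-Analysis.Complex_Transcendental"
begin

section \<open>Cyclically ordered groups\<close>

record 'a cog = "'a monoid" +
  cyc :: "'a \<Rightarrow> 'a \<Rightarrow> 'a \<Rightarrow> bool"

locale cyclically_ordered_group = group G for G :: "'a cog" (structure) +
  assumes cyc_strict:
      "\<lbrakk>x \<in> carrier G; y \<in> carrier G; z \<in> carrier G; cyc G x y z\<rbrakk> \<Longrightarrow> x \<noteq> y \<and> y \<noteq> z \<and> z \<noteq> x"
    and cyc_total:
      "\<lbrakk>x \<in> carrier G; y \<in> carrier G; z \<in> carrier G; x \<noteq> y; y \<noteq> z; z \<noteq> x\<rbrakk>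
        \<Longrightarrow> cyc G x y z \<or> cyc G x z y"
    and cyc_cyclic:
      "\<lbrakk>x \<in> carrier G; y \<in> carrier G; z \<in> carrier G; cyc G x y z\<rbrakk> \<Longrightarrow> cyc G y z x"
    and cyc_trans:
      "\<lbrakk>x \<in> carrier G; y \<in> carrier G; z \<in> carrier G; u \<in> carrier G; cyc G x y z; cyc G y u z\<rbrakk>
        \<Longrightarrow> cyc G x u z"
    and cyc_compat:
      "\<lbrakk>x \<in> carrier G; y \<in> carrier G; z \<in> carrier G; u \<in> carrier G; v \<in> carrier G; cyc G x y z\<rbrakk>
        \<Longrightarrow> cyc G (u \<otimes> x \<otimes> v) (u \<otimes> y \<otimes> v) (u \<otimes> z \<otimes> v)"

definition cog_embeddings :: "'a cog \<Rightarrow> 'b cog \<Rightarrow> ('a \<Rightarrow> 'b) set" where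
  "cog_embeddings G H = {f \<in> hom G H. inj_on f (carrier G) \<and>
     (\<forall>x\<in>carrier G. \<forall>y\<in>carrier G. \<forall>z\<in>carrier G. cyc H (f x) (f y) (f z) \<longleftrightarrow> cyc G x y z)}"

definition cog_isomorphic :: "'a cog \<Rightarrow> 'b cog \<Rightarrow> bool" where
  "cog_isomorphic G H \<longleftrightarrow> (\<exists>f \<in> cog_embeddings G H. f ` carrier G = carrier H)"

definition torsion_part :: "'a cog \<Rightarrow> 'a cog" where
  "torsion_part G = G\<lparr>carrier := {x \<in> carrier G. \<exists>n::nat. n > 0 \<and> x [^]\<^bsub>G\<^esub> n = \<one>\<^bsub>G\<^esub>}\<rparr>"


section \<open>The winding part\<close>

text \<open>\<^const>\<open>Arg2pi\<close> is the argument taken in the interval from 0 (included) to 2 pi (excluded).\<close>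

definition circle :: "complex cog" where
  "circle = \<lparr>carrier = {z. cmod z = 1}, monoid.mult = (*), one = 1,
     cyc = (\<lambda>x y z. Arg2pi x < Arg2pi y \<and> Arg2pi y < Arg2pi z
                  \<or> Arg2pi y < Arg2pi z \<and> Arg2pi z < Arg2pi x
                  \<or> Arg2pi z < Arg2pi x \<and> Arg2pi x < Arg2pi y)\<rparr>"

record 'a tog = "'a monoid" +
  lt :: "'a \<Rightarrow> 'a \<Rightarrow> bool"

locale totally_ordered_group = group L for L :: "'a tog" (structure) +
  assumes lt_irrefl: "x \<in> carrier L \<Longrightarrow> \<not> lt L x x"
    and lt_trans:
      "\<lbrakk>x \<in> carrier L; y \<in> carrier L; z \<in> carrier L; lt L x y; lt L y z\<rbrakk> \<Longrightarrow> lt L x z"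
    and lt_total: "\<lbrakk>x \<in> carrier L; y \<in> carrier L; x \<noteq> y\<rbrakk> \<Longrightarrow> lt L x y \<or> lt L y x"
    and lt_compat:
      "\<lbrakk>x \<in> carrier L; y \<in> carrier L; u \<in> carrier L; v \<in> carrier L; lt L x y\<rbrakk>
        \<Longrightarrow> lt L (u \<otimes> x \<otimes> v) (u \<otimes> y \<otimes> v)"

definition lex_product :: "'a cog \<Rightarrow> 'b tog \<Rightarrow> ('a \<times> 'b) cog" where
  "lex_product C L =
    \<lparr>carrier = carrier (C \<times>\<times> L), monoid.mult = monoid.mult (C \<times>\<times> L), one = one (C \<times>\<times> L),
     cyc = (\<lambda>(c, r) (c', r') (c'', r'').
         cyc C c c' c''
       \<or> (c = c' \<and> c' \<noteq> c'' \<and> lt L r r')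
       \<or> (c \<noteq> c' \<and> c' = c'' \<and> lt L r' r'')
       \<or> (c = c'' \<and> c'' \<noteq> c' \<and> lt L r'' r)
       \<or> (c = c' \<and> c' = c'' \<and>
           (lt L r r' \<and> lt L r' r'' \<or> lt L r' r'' \<and> lt L r'' r \<or> lt L r'' r \<and> lt L r r')))\<rparr>"

text \<open>
  The group \<open>L\<close> is taken with carrier in the element type of \<open>G\<close>.  This loses no embedding: one may
  always shrink \<open>L\<close> to the second projection of the image of \<open>G\<close>, which is a quotient of \<open>G\<close> and hence
  has a copy carried by a set of representatives in \<open>G\<close>, and this does not change the first
  projection of the image.  Such an embedding always exists and the first projection of its image
  does not depend on it, so the choice operator selects the only possible value.
\<close>

definition winding_part :: "'a cog \<Rightarrow> complex cog" where
  "winding_part G = circle\<lparr>carrier :=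
     (SOME W. \<exists>(L :: 'a tog) f. totally_ordered_group L
        \<and> f \<in> cog_embeddings G (lex_product circle L) \<and> W = fst ` f ` carrier G)\<rparr>"


section \<open>First-order formulas over the language of addition, R, 0 and minus\<close>

datatype trm = Var nat | Zero | Add trm trm | Minus trm

datatype fm =
    Eq trm trm
  | Rel trm trm trm
  | Not fm
  | And fm fm
  | Or fm fm
  | All nat fm
  | Ex nat fm

fun eval_trm :: "'a cog \<Rightarrow> (nat \<Rightarrow> 'a) \<Rightarrow> trm \<Rightarrow> 'a" where
  "eval_trm G e (Var n) = e n"
| "eval_trm G e Zero = \<one>\<^bsub>G\<^esub>"
| "eval_trm G e (Add s t) = eval_trm G e s \<otimes>\<^bsub>G\<^esub> eval_trm G e t"
| "eval_trm G e (Minus t) = inv\<^bsub>G\<^esub> (eval_trm G e t)"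

fun sat :: "'a cog \<Rightarrow> (nat \<Rightarrow> 'a) \<Rightarrow> fm \<Rightarrow> bool" where
  "sat G e (Eq s t) \<longleftrightarrow> eval_trm G e s = eval_trm G e t"
| "sat G e (Rel s t u) \<longleftrightarrow> cyc G (eval_trm G e s) (eval_trm G e t) (eval_trm G e u)"
| "sat G e (Not p) \<longleftrightarrow> \<not> sat G e p"
| "sat G e (And p q) \<longleftrightarrow> sat G e p \<and> sat G e q"
| "sat G e (Or p q) \<longleftrightarrow> sat G e p \<or> sat G e q"
| "sat G e (All n p) \<longleftrightarrow> (\<forall>a\<in>carrier G. sat G (e(n := a)) p)"
| "sat G e (Ex n p) \<longleftrightarrow> (\<exists>a\<in>carrier G. sat G (e(n := a)) p)"

fun trm_vars :: "trm \<Rightarrow> nat set" where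
  "trm_vars (Var n) = {n}"
| "trm_vars Zero = {}"
| "trm_vars (Add s t) = trm_vars s \<union> trm_vars t"
| "trm_vars (Minus t) = trm_vars t"

fun free_vars :: "fm \<Rightarrow> nat set" where
  "free_vars (Eq s t) = trm_vars s \<union> trm_vars t"
| "free_vars (Rel s t u) = trm_vars s \<union> trm_vars t \<union> trm_vars u"
| "free_vars (Not p) = free_vars p"
| "free_vars (And p q) = free_vars p \<union> free_vars q"
| "free_vars (Or p q) = free_vars p \<union> free_vars q"
| "free_vars (All n p) = free_vars p - {n}"
| "free_vars (Ex n p) = free_vars p - {n}"

fun quantifier_free :: "fm \<Rightarrow> bool" where
  "quantifier_free (Eq s t) \<longleftrightarrow> True"
| "quantifier_free (Rel s t u) \<longleftrightarrow> True"
| "quantifier_free (Not p) \<longleftrightarrow> quantifier_free p"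
| "quantifier_free (And p q) \<longleftrightarrow> quantifier_free p \<and> quantifier_free q"
| "quantifier_free (Or p q) \<longleftrightarrow> quantifier_free p \<and> quantifier_free q"
| "quantifier_free (All n p) \<longleftrightarrow> False"
| "quantifier_free (Ex n p) \<longleftrightarrow> False"

inductive universal_fm :: "fm \<Rightarrow> bool" where
  "quantifier_free p \<Longrightarrow> universal_fm p"
| "universal_fm p \<Longrightarrow> universal_fm (All n p)"

definition universal_sentence :: "fm \<Rightarrow> bool" where
  "universal_sentence p \<longleftrightarrow> universal_fm p \<and> free_vars p = {}"

text \<open>The value of a sentence does not depend on the assignment.\<close>

definition models :: "'a cog \<Rightarrow> fm \<Rightarrow> bool" where
  "models G p \<longleftrightarrow> (\<forall>e. range e \<subseteq> carrier G \<longrightarrow> sat G e p)"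

text \<open>
  Universal sentences distinguish finite from infinite groups in a way that torsion and winding
  parts do not: the finite cyclic group of order \<open>n\<close> and its lexicographic product with the ordered
  group of integers have isomorphic torsion parts and isomorphic winding parts, but only the former
  satisfies \<open>\<forall>x. n x = 0\<close>.  A comparison of two groups through these parts therefore has to assume
  that both are finite or both are infinite.
\<close>

definition same_universal_sentences :: "'a cog \<Rightarrow> 'b cog \<Rightarrow> bool" where
  "same_universal_sentences G H \<longleftrightarrow> (\<forall>p. universal_sentence p \<longrightarrow> (models G p \<longleftrightarrow> models H p))"

end

(*
  Cutting the cyclic order at 0 and counting how often the multiples of an element pass 0 gives every
  element an angle, hence a homomorphism w to the circle; the elements of angle 0 extend to a total
  cone by Zorn's lemma.  An Abelian cyclically ordered group is thus described by w and a total cone,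
  as in a lexicographic product of the circle with an ordered group, and R(x,y,z) holds iff the three
  differences have nonnegative lifts (in the lexicographic sense) with angles summing to 2 pi.

  A finite system of atomic formulas with parameters in G then amounts to sign conditions on integer
  combinations of independent generators, modulo torsion.  Fourier-Motzkin elimination realises these
  signs by an integer linear functional.  If the winding part of G' is infinite, hence dense, nearby
  angles are realised in G'; if it is cyclic of order n, the generators are sent to suitable multiples
  of one positive element of angle 2 pi / n.  Conversely, the existence of elements of order n
  determines the torsion part, and the existence of x with x, 2x, ..., Nx in one turn and (N+1)x beyond
  it determines the order of the winding part when it is finite and G is infinite.
*)
theory Submission
  imports Defs "HOL-Algebra.FiniteProduct"
begin

section \<open>The circle and lexicographic products\<close>

text \<open>The ordered factor of an embedding is not canonical and the winding part is picked by a
  choice operator, so all later arguments speak of an arbitrary pair \<open>w\<close>,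
  \<open>nn\<close> satisfying \<open>wound_group\<close>. The cone \<open>nn\<close> lives on the
  whole group and may have units. It is closed under division by positive integers, so every torsion
  element is a unit and \<open>w\<close> is injective on torsion. This is why torsion can be split
  off as exact angles, leaving integer vectors to be handled by linear inequalities. The obstacle in
  the transfer is that an angle and a cone sign must be reproduced together, although the two groups
  may have unrelated ordered parts. An infinite winding part leaves room for perturbation: the
  lexicographic pair is flattened into angles alone, and independence of the generators keeps the
  relevant lifts away from 0. A finite winding part leaves no room: angles are copied exactly, and
  the cone signs come from large multiples of one element of strictly positive class. Such an
  element exists only in an infinite group, so finite groups, being all torsion, are treated
  apart.\<close>

lemma Arg2pi_cis: "0 \<le> t \<Longrightarrow> t < 2 * pi \<Longrightarrow> Arg2pi (cis t) = t"
  by (rule Arg2pi_unique[of 1]) (auto simp: cis_conv_exp)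

lemma cis_Arg2pi: "cmod x = 1 \<Longrightarrow> cis (Arg2pi x) = x"
  by (simp add: cis_conv_exp complex_norm_eq_1_exp)

lemma cis_eq_iff: "cis a = cis b \<longleftrightarrow> (\<exists>n::int. a = b + 2 * pi * of_int n)"
proof -
  have "cis a = cis b \<longleftrightarrow> (\<exists>n::int. \<i> * of_real a = \<i> * of_real (b + 2 * pi * of_int n))"
    unfolding cis_conv_exp exp_eq by (simp add: algebra_simps)
  then show ?thesis by (simp only: mult_cancel_left of_real_eq_iff) simp
qed

lemma cis_eq_one_small: "cis a = 1 \<Longrightarrow> \<bar>a\<bar> < 2 * pi \<Longrightarrow> a = 0"
  using cis_eq_iff[of a 0] by (auto simp: abs_mult)

text \<open>The cut at argument 0 disappears when the order is expressed by gaps that close up after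
  exactly one turn: the gap crossing the cut is the one that receives the extra
  \<open>2 * pi\<close>.\<close>

lemma circle_cyc_iff:
  assumes "cmod x = 1" "cmod y = 1" "cmod z = 1"
  shows "cyc circle x y z \<longleftrightarrow>
    (\<exists>d1 d2 d3. d1 > 0 \<and> d2 > 0 \<and> d3 > 0 \<and> d1 + d2 + d3 = 2 * pi \<and> y = x * cis d1 \<and> z = y * cis d2)"
    (is "_ = ?R")
proof
  define a b c where "a = Arg2pi x" and "b = Arg2pi y" and "c = Arg2pi z"
  have x: "x = cis a" and y: "y = cis b" and z: "z = cis c"
    using assms by (simp_all add: a_def b_def c_def cis_Arg2pi)
  have bd: "0 \<le> a" "a < 2 * pi" "0 \<le> b" "b < 2 * pi" "0 \<le> c" "c < 2 * pi"
    using Arg2pi by (auto simp: a_def b_def c_def)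
  have per: "cis (t + 2 * pi) = cis t" for t
    using cis_eq_iff[of "t + 2 * pi" t] by (metis mult.right_neutral of_int_1)
  have yx: "y = x * cis (b - a)" "y = x * cis (b - a + 2 * pi)"
    and zy: "z = y * cis (c - b)" "z = y * cis (c - b + 2 * pi)"
    by (simp_all add: x y z cis_mult per del: cis_2pi)
  {
    assume "cyc circle x y z"
    then consider "a < b" "b < c" | "b < c" "c < a" | "c < a" "a < b"
      by (auto simp: circle_def a_def b_def c_def)
    then show ?R
    proof cases
      case 1 then show ?thesis using yx zy bd
        by (intro exI[of _ "b - a"] exI[of _ "c - b"] exI[of _ "2 * pi + a - c"]) auto
    next
      case 2 then show ?thesis using yx zy bd
        by (intro exI[of _ "b - a + 2 * pi"] exI[of _ "c - b"] exI[of _ "a - c"]) auto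
    next
      case 3 then show ?thesis using yx zy bd
        by (intro exI[of _ "b - a"] exI[of _ "c - b + 2 * pi"] exI[of _ "a - c"]) auto
    qed
  }
  {
    assume ?R
    then obtain d1 d2 d3 where d: "d1 > 0" "d2 > 0" "d3 > 0" "d1 + d2 + d3 = 2 * pi"
      and y': "y = cis (a + d1)" and z': "z = cis (a + d1 + d2)"
      by (auto simp: x cis_mult)
    \<comment> \<open>The arguments occurring are below \<open>4 * pi\<close>, since
      \<open>a\<close> and \<open>d1 + d2\<close> are both below one turn, so at most one
      subtraction reduces them.\<close>
    have A: "Arg2pi (cis t) = (if t < 2 * pi then t else t - 2 * pi)" if "0 \<le> t" "t < 4 * pi" for t
      using that Arg2pi_cis[of t] Arg2pi_cis[of "t - 2 * pi"] per[of "t - 2 * pi"] by auto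
    have "b = (if a + d1 < 2 * pi then a + d1 else a + d1 - 2 * pi)"
      unfolding b_def y' by (rule A) (use d bd in auto)
    moreover have "c = (if a + d1 + d2 < 2 * pi then a + d1 + d2 else a + d1 + d2 - 2 * pi)"
      unfolding c_def z' by (rule A) (use d bd in auto)
    ultimately show "cyc circle x y z"
      using d bd unfolding circle_def a_def[symmetric] b_def[symmetric] c_def[symmetric]
      by (auto simp flip: a_def b_def c_def split: if_splits)
  }
qed

text \<open>Lexicographic positivity of lifts absorbs the five clauses of \<open>lex_product\<close>
  into one. A repeated circle coordinate gives a lift 0 that is decided in \<open>L\<close>; when
  all three coordinates agree, two lifts are 0 and the third is the full turn.\<close>

lemma lex_cyc_iff:
  assumes "totally_ordered_group L"
    and u: "cmod x = 1" "cmod y = 1" "cmod z = 1"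
    and c: "p \<in> carrier L" "q \<in> carrier L" "r \<in> carrier L"
  shows "cyc (lex_product circle L) (x, p) (y, q) (z, r) \<longleftrightarrow>
    (\<exists>d1 d2 d3. d1 + d2 + d3 = 2 * pi
      \<and> y = x * cis d1 \<and> (d1 > 0 \<or> d1 = 0 \<and> lt L p q)
      \<and> z = y * cis d2 \<and> (d2 > 0 \<or> d2 = 0 \<and> lt L q r)
      \<and> x = z * cis d3 \<and> (d3 > 0 \<or> d3 = 0 \<and> lt L r p))"
    (is "?L = ?R")
proof
  interpret totally_ordered_group L by fact
  have nz: "x \<noteq> 0" "y \<noteq> 0" "z \<noteq> 0" using u by auto
  have quot: "\<exists>d. 0 < d \<and> d < 2 * pi \<and> t = s * cis d"
    if "cmod s = 1" "cmod t = 1" "s \<noteq> t" for s t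
  proof -
    have "cmod (t / s) = 1" using that by (simp add: norm_divide)
    then have e: "t / s = cis (Arg2pi (t / s))" by (simp add: cis_Arg2pi)
    have "Arg2pi (t / s) \<noteq> 0"
    proof
      assume "Arg2pi (t / s) = 0"
      then have "t / s = 1" using e by simp
      then show False using that by (auto simp: field_simps)
    qed
    then have "0 < Arg2pi (t / s)" "Arg2pi (t / s) < 2 * pi"
      using Arg2pi[of "t / s"] by auto
    moreover have "t = s * cis (Arg2pi (t / s))"
      using e that by (metis nonzero_mult_div_cancel_left norm_zero times_divide_eq_right zero_neq_one)
    ultimately show ?thesis by blast
  qed
  have bk: "s = t * cis (2 * pi - d)" if "t = s * cis d" for s t d
    using that by (simp add: cis_mult mult.assoc)
  {
    assume ?L
    then consider "cyc circle x y z" | "x = y" "y \<noteq> z" "lt L p q" | "x \<noteq> y" "y = z" "lt L q r"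
      | "x = z" "z \<noteq> y" "lt L r p"
      | "x = y" "y = z" "lt L p q" "lt L q r" | "x = y" "y = z" "lt L q r" "lt L r p"
      | "x = y" "y = z" "lt L r p" "lt L p q"
      by (auto simp: lex_product_def)
    then show ?R
    proof cases
      case 1
      then obtain d1 d2 d3 where d: "d1 > 0" "d2 > 0" "d3 > 0" "d1 + d2 + d3 = 2 * pi"
        and yz: "y = x * cis d1" "z = y * cis d2"
        using circle_cyc_iff[OF u] by auto
      have "d3 = 2 * pi - (d1 + d2)" using d by linarith
      moreover have "z = x * cis (d1 + d2)" using yz by (simp add: cis_mult mult.assoc)
      ultimately have "x = z * cis d3" using bk by blast
      then show ?thesis using d yz by blast
    next
      case 2
      then obtain d where "0 < d" "d < 2 * pi" "z = y * cis d" using quot u by blast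
      then show ?thesis using 2 bk[of z y d]
        by (intro exI[of _ 0] exI[of _ d] exI[of _ "2 * pi - d"]) auto
    next
      case 3
      then obtain d where "0 < d" "d < 2 * pi" "y = x * cis d" using quot u by blast
      then show ?thesis using 3 bk[of y x d]
        by (intro exI[of _ d] exI[of _ 0] exI[of _ "2 * pi - d"]) auto
    next
      case 4
      then obtain d where "0 < d" "d < 2 * pi" "y = x * cis d" using quot u by metis
      then show ?thesis using 4 bk[of y x d]
        by (intro exI[of _ d] exI[of _ "2 * pi - d"] exI[of _ 0]) auto
    next
      case 5 then show ?thesis
        by (intro exI[of _ 0] exI[of _ 0] exI[of _ "2 * pi"]) auto
    next
      case 6 then show ?thesis
        by (intro exI[of _ "2 * pi"] exI[of _ 0] exI[of _ 0]) auto
    next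
      case 7 then show ?thesis
        by (intro exI[of _ 0] exI[of _ "2 * pi"] exI[of _ 0]) auto
    qed
  }
  {
    assume ?R
    then obtain d1 d2 d3 where d: "d1 + d2 + d3 = 2 * pi"
      and d1: "y = x * cis d1" "d1 > 0 \<or> d1 = 0 \<and> lt L p q"
      and d2: "z = y * cis d2" "d2 > 0 \<or> d2 = 0 \<and> lt L q r"
      and d3: "x = z * cis d3" "d3 > 0 \<or> d3 = 0 \<and> lt L r p" by blast
    have ne: "s * cis e \<noteq> s" if "s \<noteq> 0" "0 < e" "e < 2 * pi" for s e
      using that cis_eq_one_small[of e] by auto
    consider "d1 > 0" "d2 > 0" "d3 > 0" | "d1 = 0" "d2 > 0" "d3 > 0" | "d1 > 0" "d2 = 0" "d3 > 0"
      | "d1 > 0" "d2 > 0" "d3 = 0" | "d1 = 0" "d2 = 0" | "d1 = 0" "d3 = 0" | "d2 = 0" "d3 = 0"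
      using d1 d2 d3 by linarith
    then show ?L
    proof cases
      case 1
      then have "cyc circle x y z" using circle_cyc_iff[OF u] d d1 d2 by blast
      then show ?thesis by (simp add: lex_product_def)
    next
      case 2
      then have "z \<noteq> y" using ne[of y d2] d d2(1) nz by auto
      then show ?thesis using 2 d1 by (simp add: lex_product_def)
    next
      case 3
      then have "y \<noteq> x" using ne[of x d1] d d1(1) nz by auto
      then show ?thesis using 3 d2 by (auto simp: lex_product_def)
    next
      case 4
      then have "y \<noteq> x" using ne[of x d1] d d1(1) nz by auto
      then show ?thesis using 4 d3 by (auto simp: lex_product_def)
    next
      case 5 then show ?thesis using d1 d2 by (simp add: lex_product_def)
    next
      case 6 then show ?thesis using d d1 d2 d3 by (auto simp: lex_product_def)
    next
      case 7 then show ?thesis using d d1 d2 d3 by (auto simp: lex_product_def)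
    qed
  }
qed

text \<open>Lexicographic positivity of the pair consisting of the lift \<open>d\<close> of the angle of \<open>x\<close> and the class of \<open>x\<close>
  modulo the units of the cone \<open>nn\<close> (the nonnegative elements).\<close>

definition above :: "'a cog \<Rightarrow> ('a \<Rightarrow> complex) \<Rightarrow> ('a \<Rightarrow> bool) \<Rightarrow> real \<Rightarrow> 'a \<Rightarrow> bool" where
  "above G w nn d x \<longleftrightarrow> cis d = w x \<and> (d > 0 \<or> d = 0 \<and> \<not> nn (inv\<^bsub>G\<^esub> x))"

text \<open>An embedding pulled back to \<open>G\<close>: \<open>w\<close> is the circle coordinate
  and \<open>nn\<close> says that the ordered coordinate is nonnegative. The second projection need
  not be injective, so \<open>nn\<close> may have nontrivial units; only \<open>w\<close> and
  \<open>nn\<close> together separate elements (\<open>w_nn_inj\<close>).\<close>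

locale wound_group = comm_group G for G :: "'a cog" (structure) +
  fixes w :: "'a \<Rightarrow> complex" and nn :: "'a \<Rightarrow> bool"
  assumes w_norm: "x \<in> carrier G \<Longrightarrow> cmod (w x) = 1"
    and w_mult: "\<lbrakk>x \<in> carrier G; y \<in> carrier G\<rbrakk> \<Longrightarrow> w (x \<otimes> y) = w x * w y"
    and nn_mult: "\<lbrakk>x \<in> carrier G; y \<in> carrier G; nn x; nn y\<rbrakk> \<Longrightarrow> nn (x \<otimes> y)"
    and nn_total: "x \<in> carrier G \<Longrightarrow> nn x \<or> nn (inv x)"
    and w_nn_inj: "\<lbrakk>x \<in> carrier G; w x = 1; nn x; nn (inv x)\<rbrakk> \<Longrightarrow> x = \<one>"
    and cyc_iff: "\<lbrakk>x \<in> carrier G; y \<in> carrier G; z \<in> carrier G\<rbrakk> \<Longrightarrow> cyc G x y z \<longleftrightarrow>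
      (\<exists>d1 d2 d3. d1 + d2 + d3 = 2 * pi \<and> above G w nn d1 (inv x \<otimes> y)
        \<and> above G w nn d2 (inv y \<otimes> z) \<and> above G w nn d3 (inv z \<otimes> x))"

lemma wound_group_of_embedding:
  fixes G :: "'a cog" and L :: "'b tog"
  assumes L: "totally_ordered_group L" and G: "comm_group G"
    and f: "f \<in> cog_embeddings G (lex_product circle L)"
  shows "wound_group G (fst \<circ> f) (\<lambda>x. \<not> lt L (snd (f x)) \<one>\<^bsub>L\<^esub>)"
proof -
  interpret G: comm_group G by fact
  interpret L: totally_ordered_group L by fact
  note [simp] = L.is_group
  define w where "w = fst \<circ> f"
  define p where "p = snd \<circ> f"
  have car: "carrier (lex_product circle L) = {z. cmod z = 1} \<times> carrier L"
    by (simp add: lex_product_def DirProd_def circle_def)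
  have fm: "f (x \<otimes>\<^bsub>G\<^esub> y) = (w x * w y, p x \<otimes>\<^bsub>L\<^esub> p y)" if "x \<in> carrier G" "y \<in> carrier G" for x y
    using f that unfolding cog_embeddings_def hom_def w_def p_def
    by (auto simp: lex_product_def DirProd_def circle_def split: prod.splits)
  have fx: "f x = (w x, p x)" for x by (simp add: w_def p_def)
  have wc: "cmod (w x) = 1" and pc: "p x \<in> carrier L" if "x \<in> carrier G" for x
    using f that unfolding cog_embeddings_def hom_def Pi_def car w_def p_def
    by (auto simp: mem_Times_iff)
  have wm: "w (x \<otimes>\<^bsub>G\<^esub> y) = w x * w y" and pm: "p (x \<otimes>\<^bsub>G\<^esub> y) = p x \<otimes>\<^bsub>L\<^esub> p y"
    if "x \<in> carrier G" "y \<in> carrier G" for x y using fm[OF that] by (simp_all add: w_def p_def)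
  have "p \<in> hom G L" using pm pc by (auto simp: hom_def)
  then interpret p: group_hom G L p by unfold_locales
  have w1: "w \<one>\<^bsub>G\<^esub> = 1"
    using wm[of "\<one>\<^bsub>G\<^esub>" "\<one>\<^bsub>G\<^esub>"] wc[of "\<one>\<^bsub>G\<^esub>"] by auto
  have wi: "w (inv\<^bsub>G\<^esub> x) * w x = 1" if "x \<in> carrier G" for x
    using wm[of "inv\<^bsub>G\<^esub> x" x] that w1 by simp
  have lt_shift: "lt L a b \<longleftrightarrow> lt L (inv\<^bsub>L\<^esub> b \<otimes>\<^bsub>L\<^esub> a) \<one>\<^bsub>L\<^esub>"
    if "a \<in> carrier L" "b \<in> carrier L" for a b
    using L.lt_compat[of a b "inv\<^bsub>L\<^esub> b" "\<one>\<^bsub>L\<^esub>"] that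
      L.lt_compat[of "inv\<^bsub>L\<^esub> b \<otimes>\<^bsub>L\<^esub> a" "\<one>\<^bsub>L\<^esub>" b "\<one>\<^bsub>L\<^esub>"]
    by (auto simp: L.m_assoc[symmetric])
  have neg: "lt L a \<one>\<^bsub>L\<^esub> \<longleftrightarrow> lt L \<one>\<^bsub>L\<^esub> (inv\<^bsub>L\<^esub> a)" if "a \<in> carrier L" for a
    using lt_shift[of "\<one>\<^bsub>L\<^esub>" "inv\<^bsub>L\<^esub> a"] that by simp
  have asym: "\<not> (lt L a b \<and> lt L b a)" if "a \<in> carrier L" "b \<in> carrier L" for a b
    using L.lt_trans[of a b a] L.lt_irrefl[of a] that by blast
  have ab: "above G w (\<lambda>x. \<not> lt L (p x) \<one>\<^bsub>L\<^esub>) d (inv\<^bsub>G\<^esub> x \<otimes>\<^bsub>G\<^esub> y)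
      \<longleftrightarrow> w y = w x * cis d \<and> (d > 0 \<or> d = 0 \<and> lt L (p x) (p y))"
    if "x \<in> carrier G" "y \<in> carrier G" for d x y
  proof -
    have "w (inv\<^bsub>G\<^esub> x \<otimes>\<^bsub>G\<^esub> y) = w (inv\<^bsub>G\<^esub> x) * w y" using that wm by simp
    then have "cis d = w (inv\<^bsub>G\<^esub> x \<otimes>\<^bsub>G\<^esub> y) \<longleftrightarrow> w y = w x * cis d"
      using wi[OF that(1)] wc[OF that(1)]
      by (auto simp: mult.assoc[symmetric] mult.commute[of "w x"])
    moreover have "lt L (p (inv\<^bsub>G\<^esub> (inv\<^bsub>G\<^esub> x \<otimes>\<^bsub>G\<^esub> y))) \<one>\<^bsub>L\<^esub> \<longleftrightarrow> lt L (p x) (p y)"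
      using that lt_shift[OF pc pc, of x y] by (simp add: G.inv_mult_group pm)
    ultimately show ?thesis by (auto simp: above_def)
  qed
  have "wound_group G w (\<lambda>x. \<not> lt L (p x) \<one>\<^bsub>L\<^esub>)"
  proof unfold_locales
    fix x y assume xy: "x \<in> carrier G" "y \<in> carrier G" "\<not> lt L (p x) \<one>\<^bsub>L\<^esub>" "\<not> lt L (p y) \<one>\<^bsub>L\<^esub>"
    show "\<not> lt L (p (x \<otimes>\<^bsub>G\<^esub> y)) \<one>\<^bsub>L\<^esub>"
    proof
      assume "lt L (p (x \<otimes>\<^bsub>G\<^esub> y)) \<one>\<^bsub>L\<^esub>"
      then have "lt L (p y) (inv\<^bsub>L\<^esub> (p x))"
        using lt_shift[of "p y" "inv\<^bsub>L\<^esub> (p x)"] xy pc pm by simp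
      moreover have "p y = \<one>\<^bsub>L\<^esub> \<or> lt L \<one>\<^bsub>L\<^esub> (p y)" using L.lt_total[of "p y" "\<one>\<^bsub>L\<^esub>"] xy pc by auto
      ultimately have "lt L \<one>\<^bsub>L\<^esub> (inv\<^bsub>L\<^esub> (p x))"
        using L.lt_trans[of "\<one>\<^bsub>L\<^esub>" "p y" "inv\<^bsub>L\<^esub> (p x)"] xy pc by auto
      then show False using neg[of "p x"] xy pc by simp
    qed
  next
    fix x assume "x \<in> carrier G"
    then show "\<not> lt L (p x) \<one>\<^bsub>L\<^esub> \<or> \<not> lt L (p (inv\<^bsub>G\<^esub> x)) \<one>\<^bsub>L\<^esub>"
      using asym[of "p x" "\<one>\<^bsub>L\<^esub>"] pc neg[of "inv\<^bsub>L\<^esub> p x"] by auto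
  next
    fix x assume x: "x \<in> carrier G" "w x = 1" "\<not> lt L (p x) \<one>\<^bsub>L\<^esub>" "\<not> lt L (p (inv\<^bsub>G\<^esub> x)) \<one>\<^bsub>L\<^esub>"
    then have "p x = \<one>\<^bsub>L\<^esub>"
      using L.lt_total[of "p x" "\<one>\<^bsub>L\<^esub>"] pc neg[of "inv\<^bsub>L\<^esub> p x"] by auto
    then have "f x = f \<one>\<^bsub>G\<^esub>" using x w1 by (simp add: fx)
    then show "x = \<one>\<^bsub>G\<^esub>" using f x by (auto simp: cog_embeddings_def inj_on_def)
  next
    fix x y z assume xyz: "x \<in> carrier G" "y \<in> carrier G" "z \<in> carrier G"
    have "cyc G x y z \<longleftrightarrow> cyc (lex_product circle L) (f x) (f y) (f z)"
      using f xyz by (auto simp: cog_embeddings_def)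
    then show "cyc G x y z = (\<exists>d1 d2 d3. d1 + d2 + d3 = 2 * pi \<and>
       above G w (\<lambda>x. \<not> lt L (p x) \<one>\<^bsub>L\<^esub>) d1 (inv\<^bsub>G\<^esub> x \<otimes>\<^bsub>G\<^esub> y) \<and>
       above G w (\<lambda>x. \<not> lt L (p x) \<one>\<^bsub>L\<^esub>) d2 (inv\<^bsub>G\<^esub> y \<otimes>\<^bsub>G\<^esub> z) \<and>
       above G w (\<lambda>x. \<not> lt L (p x) \<one>\<^bsub>L\<^esub>) d3 (inv\<^bsub>G\<^esub> z \<otimes>\<^bsub>G\<^esub> x))"
      unfolding fx using xyz
      by (simp add: lex_cyc_iff[OF L wc wc wc pc pc pc] ab conj_assoc)
  qed (use wc wm in auto)
  then show ?thesis by (simp add: w_def p_def o_def)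
qed

section \<open>The angle homomorphism of a cyclically ordered group\<close>

locale comm_cog = cyclically_ordered_group G + comm_group G for G :: "'a cog" (structure)
begin

section \<open>Passages of the identity as a 2-cocycle\<close>

lemma cyc_asym: "\<lbrakk>x \<in> carrier G; y \<in> carrier G; z \<in> carrier G; cyc G x y z\<rbrakk> \<Longrightarrow> \<not> cyc G x z y"
  using cyc_trans[of x y z x] cyc_cyclic[of x z y] cyc_cyclic[of z y x] cyc_strict[of x x z] by blast

lemma cyc_translate: "\<lbrakk>x \<in> carrier G; y \<in> carrier G; z \<in> carrier G; u \<in> carrier G\<rbrakk>
  \<Longrightarrow> cyc G (u \<otimes> x) (u \<otimes> y) (u \<otimes> z) \<longleftrightarrow> cyc G x y z"
  using cyc_compat[of x y z u \<one>] cyc_compat[of "u \<otimes> x" "u \<otimes> y" "u \<otimes> z" "inv u" \<one>]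
  by (auto simp: m_assoc[symmetric])

text \<open>Walking positively from \<open>a\<close> to \<open>b\<close> and on to \<open>c\<close>,
  each leg shorter than a turn, this counts whether \<open>a\<close> is met again; ending exactly at
  \<open>a\<close> counts as a turn.\<close>

definition wraps :: "'a \<Rightarrow> 'a \<Rightarrow> 'a \<Rightarrow> int" where
  "wraps a b c = (if a \<noteq> b \<and> (c = a \<or> cyc G a c b) then 1 else 0)"

lemma wraps_translate: "\<lbrakk>a \<in> carrier G; b \<in> carrier G; c \<in> carrier G; u \<in> carrier G\<rbrakk>
  \<Longrightarrow> wraps (u \<otimes> a) (u \<otimes> b) (u \<otimes> c) = wraps a b c"
  by (simp add: wraps_def cyc_translate)

text \<open>\<open>wraps x y z\<close> is the number of turns lost when the path from
  \<open>x\<close> over \<open>y\<close> to \<open>z\<close> is replaced by the direct leg. Both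
  sides shorten the path \<open>a\<close>, \<open>b\<close>, \<open>c\<close>, \<open>d\<close> to
  the leg from \<open>a\<close> to \<open>d\<close>, dropping \<open>c\<close> before
  \<open>b\<close> or \<open>b\<close> before \<open>c\<close>, and lose the same total.\<close>

lemma wraps_cocycle:
  assumes "a \<in> carrier G" "b \<in> carrier G" "c \<in> carrier G" "d \<in> carrier G"
  shows "wraps b c d + wraps a b d = wraps a c d + wraps a b c"
proof -
  have st: "\<not> cyc G x y y" "\<not> cyc G x x y" "\<not> cyc G x y x" if "x \<in> carrier G" "y \<in> carrier G" for x y
    using that cyc_strict by blast+
  have R: "cyc G x y z \<longleftrightarrow> cyc G y z x" if "x \<in> carrier G" "y \<in> carrier G" "z \<in> carrier G" for x y z
    using that cyc_cyclic by blast
  have N: "cyc G x z y \<longleftrightarrow> \<not> cyc G x y z"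
    if "x \<in> carrier G" "y \<in> carrier G" "z \<in> carrier G" "x \<noteq> y" "y \<noteq> z" "z \<noteq> x" for x y z
    using that cyc_asym cyc_total by blast
  show ?thesis
  proof (cases "a = b \<or> a = c \<or> a = d \<or> b = c \<or> b = d \<or> c = d")
    case True
    then show ?thesis using assms st R N unfolding wraps_def
      by (smt (verit))
  next
    case False
    have T: "cyc G b c d \<Longrightarrow> cyc G c a d \<Longrightarrow> cyc G b a d" "cyc G b d c \<Longrightarrow> cyc G d a c \<Longrightarrow> cyc G b a c"
       "cyc G a b c \<Longrightarrow> cyc G b d c \<Longrightarrow> cyc G a d c" "cyc G a c b \<Longrightarrow> cyc G c d b \<Longrightarrow> cyc G a d b"
       "cyc G a b d \<Longrightarrow> cyc G b c d \<Longrightarrow> cyc G a c d" "cyc G a d b \<Longrightarrow> cyc G d c b \<Longrightarrow> cyc G a c b"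
       "cyc G a c d \<Longrightarrow> cyc G c b d \<Longrightarrow> cyc G a b d" "cyc G a d c \<Longrightarrow> cyc G d b c \<Longrightarrow> cyc G a b c"
       "cyc G b c a \<Longrightarrow> cyc G c d a \<Longrightarrow> cyc G b d a" "cyc G d c a \<Longrightarrow> cyc G c b a \<Longrightarrow> cyc G d b a"
      using assms cyc_trans by blast+
    have rr: "cyc G b d c \<longleftrightarrow> \<not> cyc G b c d" "cyc G a d c \<longleftrightarrow> \<not> cyc G a c d"
      "cyc G a d b \<longleftrightarrow> \<not> cyc G a b d" "cyc G a c b \<longleftrightarrow> \<not> cyc G a b c"
      "cyc G c a d \<longleftrightarrow> \<not> cyc G a c d" "cyc G b a d \<longleftrightarrow> \<not> cyc G a b d"
      "cyc G d a c \<longleftrightarrow> cyc G a c d" "cyc G b a c \<longleftrightarrow> \<not> cyc G a b c"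
      "cyc G c d b \<longleftrightarrow> cyc G b c d" "cyc G d c b \<longleftrightarrow> \<not> cyc G b c d"
      "cyc G b c a \<longleftrightarrow> cyc G a b c" "cyc G c d a \<longleftrightarrow> cyc G a c d" "cyc G b d a \<longleftrightarrow> cyc G a b d"
      "cyc G d c a \<longleftrightarrow> \<not> cyc G a c d" "cyc G c b a \<longleftrightarrow> \<not> cyc G a b c" "cyc G d b a \<longleftrightarrow> \<not> cyc G a b d"
      "cyc G c b d \<longleftrightarrow> \<not> cyc G b c d" "cyc G d b c \<longleftrightarrow> cyc G b c d"
      using False assms N R by metis+
    have "wraps b c d = (if cyc G b c d then 0 else 1)" "wraps a b d = (if cyc G a b d then 0 else 1)"
      "wraps a c d = (if cyc G a c d then 0 else 1)" "wraps a b c = (if cyc G a b c then 0 else 1)"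
      using False by (auto simp: wraps_def rr)
    then show ?thesis using T unfolding rr by (smt (verit))
  qed
qed

definition carry :: "'a \<Rightarrow> 'a \<Rightarrow> int" where
  "carry x y = wraps \<one> x (x \<otimes> y)"

lemma carry_01: "0 \<le> carry x y" "carry x y \<le> 1"
  by (auto simp: carry_def wraps_def)

lemma carry_one [simp]: "x \<in> carrier G \<Longrightarrow> carry x \<one> = 0" "carry \<one> x = 0"
  using cyc_strict[of \<one> x x] by (auto simp: carry_def wraps_def)

lemma carry_cocycle:
  assumes "x \<in> carrier G" "y \<in> carrier G" "z \<in> carrier G"
  shows "carry y z + carry x (y \<otimes> z) = carry (x \<otimes> y) z + carry x y"
  using wraps_cocycle[of \<one> x "x \<otimes> y" "x \<otimes> y \<otimes> z"] wraps_translate[of \<one> y "y \<otimes> z" x] assms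
  by (simp add: carry_def m_assoc)

text \<open>Commutativity of \<open>G\<close> alone does not give symmetry, since wrapping is tested
  against \<open>x\<close> on one side and against \<open>y\<close> on the other. If the two values
  differ, the cyclic order is 0, y, x + y, x. Translating by -y and by -x places -x between 0 and y,
  and -y beyond x; translating these back by x + y yields the order x + y, y, x, a
  contradiction.\<close>

lemma carry_comm_le:
  assumes xy: "x \<in> carrier G" "y \<in> carrier G" and c: "carry x y = 1"
  shows "carry y x = 1"
proof (rule ccontr)
  assume n: "carry y x \<noteq> 1"
  have x1: "x \<noteq> \<one>" and s: "x \<otimes> y = \<one> \<or> cyc G \<one> (x \<otimes> y) x"
    using c by (auto simp: carry_def wraps_def split: if_splits)
  have y1: "y \<noteq> \<one>" using xy x1 s cyc_strict[of \<one> x x] by auto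
  have s1: "x \<otimes> y \<noteq> \<one>" and ns: "\<not> cyc G \<one> (x \<otimes> y) y"
    using n y1 xy by (auto simp: carry_def wraps_def m_comm split: if_splits)
  have xs: "cyc G \<one> (x \<otimes> y) x" using s s1 by blast
  have ny: "x \<otimes> y \<noteq> y" using xy x1 by simp
  have "cyc G \<one> y (x \<otimes> y)"
    using cyc_total[of \<one> y "x \<otimes> y"] ns xy y1 s1 ny by auto
  have ys: "cyc G \<one> y (x \<otimes> y)" by fact
  have A: "cyc G \<one> y x"
    using cyc_trans[of \<one> "x \<otimes> y" x y] cyc_trans cyc_cyclic xs ys xy
    by (meson m_closed one_closed)
  have B: "cyc G (inv y) \<one> x"
    using cyc_translate[of \<one> y "x \<otimes> y" "inv y"] ys xy by (simp add: m_lcomm)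
  have C: "cyc G (inv x) y \<one>"
    using cyc_translate[of \<one> "x \<otimes> y" x "inv x"] xs xy by (simp add: m_assoc[symmetric])
  have "cyc G \<one> (inv x) y" using C cyc_cyclic xy by (meson inv_closed one_closed)
  moreover have "cyc G \<one> x (inv y)" using B cyc_cyclic xy by (meson inv_closed one_closed)
  ultimately have "cyc G \<one> (inv x) (inv y)"
    using A xy cyc_trans cyc_cyclic by (meson inv_closed one_closed)
  then have "cyc G (x \<otimes> y) y x"
    using cyc_translate[of \<one> "inv x" "inv y" "x \<otimes> y"] xy
    by (simp add: m_assoc m_lcomm) (simp add: m_assoc[symmetric] m_comm)
  moreover have "cyc G y (x \<otimes> y) x"
    using xs ys xy cyc_trans cyc_cyclic by (meson m_closed one_closed)
  ultimately show False using xy cyc_asym cyc_cyclic by (meson m_closed)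
qed

lemma carry_comm: "x \<in> carrier G \<Longrightarrow> y \<in> carrier G \<Longrightarrow> carry x y = carry y x"
  using carry_comm_le[of x y] carry_comm_le[of y x] carry_01[of x y] carry_01[of y x] by linarith

text \<open>Rieger's extension of \<open>G\<close> by the integers, with the cocycle \<open>carry\<close>.\<close>

definition unwinding :: "(int \<times> 'a) monoid" where
  "unwinding = \<lparr>carrier = UNIV \<times> carrier G,
     monoid.mult = (\<lambda>(m, x) (n, y). (m + n + carry x y, x \<otimes> y)), one = (0, \<one>)\<rparr>"

lemma comm_monoid_unwinding: "comm_monoid unwinding"
proof (rule comm_monoidI)
  fix x y z assume "x \<in> carrier unwinding" "y \<in> carrier unwinding" "z \<in> carrier unwinding"
  then show "x \<otimes>\<^bsub>unwinding\<^esub> y \<otimes>\<^bsub>unwinding\<^esub> z = x \<otimes>\<^bsub>unwinding\<^esub> (y \<otimes>\<^bsub>unwinding\<^esub> z)"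
    using carry_cocycle[of "snd x" "snd y" "snd z"]
    by (auto simp: unwinding_def m_assoc)
qed (auto simp: unwinding_def carry_comm m_comm)

sublocale U: comm_monoid unwinding
  by (rule comm_monoid_unwinding)

section \<open>Rotation numbers from the turns made by multiples\<close>

definition turns :: "'a \<Rightarrow> nat \<Rightarrow> int" where
  "turns x n = fst ((0, x) [^]\<^bsub>unwinding\<^esub> n)"

lemma unwinding_pow:
  assumes "x \<in> carrier G"
  shows "(c, x) [^]\<^bsub>unwinding\<^esub> n = (int n * c + turns x n, x [^] n)"
proof -
  have *: "(0, x) [^]\<^bsub>unwinding\<^esub> n = (turns x n, x [^] n)" for n
  proof -
    have "snd ((0, x) [^]\<^bsub>unwinding\<^esub> n) = x [^] n"
      by (induction n) (auto simp: unwinding_def split: prod.splits)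
    then show ?thesis by (simp add: turns_def prod_eq_iff)
  qed
  show ?thesis
  proof (induction n)
    case 0 then show ?case using *[of 0] by simp
  next
    case (Suc n)
    then show ?case using *[of "Suc n"] *[of n]
      by (simp add: unwinding_def algebra_simps)
  qed
qed

lemma turns_add:
  assumes "x \<in> carrier G"
  shows "turns x (m + n) = turns x m + turns x n + carry (x [^] m) (x [^] n)"
proof -
  have "(0, x) [^]\<^bsub>unwinding\<^esub> m \<otimes>\<^bsub>unwinding\<^esub> (0, x) [^]\<^bsub>unwinding\<^esub> n = (0, x) [^]\<^bsub>unwinding\<^esub> (m + n)"
    by (rule U.nat_pow_mult) (use assms in \<open>auto simp: unwinding_def\<close>)
  then show ?thesis using assms unfolding unwinding_pow[OF assms]
    by (simp add: unwinding_def)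
qed

lemma turns_0 [simp]: "turns x 0 = 0" and turns_1 [simp]: "x \<in> carrier G \<Longrightarrow> turns x (Suc 0) = 0"
  using carry_one by (auto simp: turns_def unwinding_def)

text \<open>Each of the \<open>n\<close> additions of \<open>x [^] m\<close> carries at most once,
  so \<open>turns\<close> is homogeneous up to an error of \<open>n\<close>. This is the
  almost-additivity on which the rotation number rests.\<close>

lemma turns_mult_bounds:
  assumes "x \<in> carrier G"
  shows "int n * turns x m \<le> turns x (m * n) \<and> turns x (m * n) \<le> int n * turns x m + int n"
proof (induction n)
  case (Suc n)
  have "turns x (m * Suc n) = turns x m + turns x (m * n) + carry (x [^] m) (x [^] (m * n))"
    using turns_add[OF assms, of m "m * n"] by simp
  then show ?case using Suc carry_01[of "x [^] m" "x [^] (m * n)"] by (simp add: algebra_simps)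
qed simp

lemma turns_mult:
  assumes x: "x \<in> carrier G" and y: "y \<in> carrier G"
  shows "turns x n + turns y n + carry (x [^] n) (y [^] n) = int n * carry x y + turns (x \<otimes> y) n"
proof -
  have "((0, x) \<otimes>\<^bsub>unwinding\<^esub> (0, y)) [^]\<^bsub>unwinding\<^esub> n
      = (0, x) [^]\<^bsub>unwinding\<^esub> n \<otimes>\<^bsub>unwinding\<^esub> (0, y) [^]\<^bsub>unwinding\<^esub> n"
    by (rule U.nat_pow_distrib) (use assms in \<open>auto simp: unwinding_def\<close>)
  moreover have "(0, x) \<otimes>\<^bsub>unwinding\<^esub> (0, y) = (carry x y, x \<otimes> y)"
    by (simp add: unwinding_def)
  ultimately show ?thesis using assms by (simp add: unwinding_pow) (simp add: unwinding_def)
qed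

text \<open>The rotation number, as a fraction of a full turn. Its range is closed at both ends:
  nontrivial elements infinitely close to the identity get 0 on the positive side and 1 on the
  negative side.\<close>

definition angle :: "'a \<Rightarrow> real" where
  "angle x = (SUP n. of_int (turns x (Suc n)) / real (Suc n))"

lemma angle_bounds:
  assumes x: "x \<in> carrier G"
  shows "of_int (turns x n) \<le> n * angle x" and "n * angle x \<le> of_int (turns x n) + 1"
proof -
  \<comment> \<open>Both fractions are compared through \<open>turns\<close> at the product of the
    two indices. Each lower approximation then lies below each upper one, which squeezes the
    supremum.\<close>
  have le: "of_int (turns x (Suc m)) / real (Suc m) \<le> (of_int (turns x n) + 1) / real n"
    if "n > 0" for m n
  proof -
    have "int n * turns x (Suc m) \<le> int (Suc m) * turns x n + int (Suc m)"
      using turns_mult_bounds[OF x, of n "Suc m"] turns_mult_bounds[OF x, of "Suc m" n]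
      by (simp add: mult.commute del: of_nat_Suc)
    then have "real_of_int (int n * turns x (Suc m)) \<le> real_of_int (int (Suc m) * turns x n + int (Suc m))"
      by (simp only: of_int_le_iff)
    then have "real n * of_int (turns x (Suc m)) \<le> real (Suc m) * (of_int (turns x n) + 1)"
      by (simp add: algebra_simps)
    then show ?thesis using that by (simp add: field_simps)
  qed
  have bdd: "bdd_above (range (\<lambda>n. of_int (turns x (Suc n)) / real (Suc n)))"
    using le[of 1] by (intro bdd_aboveI[of _ "(of_int (turns x 1) + 1) / real 1"]) auto
  show "of_int (turns x n) \<le> n * angle x"
  proof (cases n)
    case (Suc m)
    have "of_int (turns x (Suc m)) / real (Suc m) \<le> angle x"
      unfolding angle_def by (rule cSUP_upper[OF _ bdd]) simp
    then show ?thesis unfolding Suc by (simp add: field_simps)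
  qed simp
  show "n * angle x \<le> of_int (turns x n) + 1"
  proof (cases "n = 0")
    case False
    then have "angle x \<le> (of_int (turns x n) + 1) / real n"
      unfolding angle_def by (intro cSUP_least) (use le in auto)
    then show ?thesis using False by (simp add: field_simps)
  qed simp
qed

lemma angle_01: "x \<in> carrier G \<Longrightarrow> 0 \<le> angle x" "x \<in> carrier G \<Longrightarrow> angle x \<le> 1"
  using angle_bounds[of x 1] by auto

text \<open>The \<open>n\<close>-fold defect consists of three rounding errors and one carry, hence
  is bounded independently of \<open>n\<close>; the Archimedean property makes it vanish.\<close>

lemma angle_mult:
  assumes x: "x \<in> carrier G" and y: "y \<in> carrier G"
  shows "angle x + angle y = angle (x \<otimes> y) + of_int (carry x y)"
proof -
  define d where "d = angle x + angle y - angle (x \<otimes> y) - of_int (carry x y)"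
  have "real n * \<bar>d\<bar> \<le> 3" for n
  proof -
    have "real_of_int (turns x n + turns y n + carry (x [^] n) (y [^] n))
        = real_of_int (int n * carry x y + turns (x \<otimes> y) n)"
      by (simp only: turns_mult[OF x y])
    then have "real n * of_int (carry x y) = turns x n + turns y n + carry (x [^] n) (y [^] n) - turns (x \<otimes> y) n"
      by simp
    moreover have "real n * d = n * angle x + n * angle y - n * angle (x \<otimes> y) - n * of_int (carry x y)"
      by (simp add: d_def algebra_simps)
    moreover have "0 \<le> real_of_int (carry (x [^] n) (y [^] n))" "real_of_int (carry (x [^] n) (y [^] n)) \<le> 1"
      using carry_01[of "x [^] n" "y [^] n"] by auto
    ultimately have "\<bar>real n * d\<bar> \<le> 3"
      using angle_bounds[OF x, of n] angle_bounds[OF y, of n] angle_bounds[of "x \<otimes> y" n] x y by simp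
    then show ?thesis by (simp add: abs_mult)
  qed
  moreover have "\<exists>n. 3 < real n * \<bar>d\<bar>" if "d \<noteq> 0"
    using that ex_less_of_nat_mult[of "\<bar>d\<bar>" 3] by auto
  ultimately have "d = 0" by (meson not_le)
  then show ?thesis by (simp add: d_def)
qed

lemma angle_one [simp]: "angle \<one> = 0"
  using angle_mult[of \<one> \<one>] by simp

lemma angle_inv: "x \<in> carrier G \<Longrightarrow> x \<noteq> \<one> \<Longrightarrow> angle x + angle (inv x) = 1"
  using angle_mult[of x "inv x"] by (simp add: carry_def wraps_def)

text \<open>The order \<open>x\<close>, \<open>y\<close>, \<open>z\<close> means that adding
  \<open>inv y \<otimes> z\<close> to \<open>inv x \<otimes> y\<close> causes no carry, so these two
  angles add exactly; the third belongs to the inverse of the sum and completes the turn.\<close>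

lemma cyc_angle:
  assumes xyz: "x \<in> carrier G" "y \<in> carrier G" "z \<in> carrier G" and c: "cyc G x y z"
  shows "angle (inv x \<otimes> y) + angle (inv y \<otimes> z) + angle (inv z \<otimes> x) = 1"
proof -
  have "cyc G \<one> (inv x \<otimes> y) (inv x \<otimes> z)"
    using cyc_translate[of x y z "inv x"] xyz c by simp
  moreover have "inv x \<otimes> y \<otimes> (inv y \<otimes> z) = inv x \<otimes> z"
    using xyz by (metis inv_closed inv_solve_left m_assoc m_closed)
  ultimately have "carry (inv x \<otimes> y) (inv y \<otimes> z) = 0" and n: "inv x \<otimes> z \<noteq> \<one>"
    using xyz cyc_asym[of \<one> "inv x \<otimes> y" "inv x \<otimes> z"] cyc_strict[of \<one> "inv x \<otimes> y" "inv x \<otimes> z"]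
    unfolding carry_def wraps_def by (metis inv_closed m_closed one_closed)+
  then have "angle (inv x \<otimes> y) + angle (inv y \<otimes> z) = angle (inv x \<otimes> z)"
    using angle_mult[of "inv x \<otimes> y" "inv y \<otimes> z"] xyz \<open>inv x \<otimes> y \<otimes> (inv y \<otimes> z) = inv x \<otimes> z\<close> by simp
  moreover have "inv (inv x \<otimes> z) = inv z \<otimes> x" using xyz by (simp add: inv_mult_group)
  ultimately show ?thesis using angle_inv[of "inv x \<otimes> z"] n xyz by simp
qed

section \<open>Infinitesimals and their extension to a total cone\<close>

definition infinitesimals :: "'a set" where
  "infinitesimals = {x \<in> carrier G. x \<noteq> \<one> \<and> angle x = 0}"

lemma infinitesimals_mult:
  assumes "x \<in> infinitesimals" "y \<in> infinitesimals"
  shows "x \<otimes> y \<in> infinitesimals"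
proof -
  have xy: "x \<in> carrier G" "x \<noteq> \<one>" "angle x = 0" "y \<in> carrier G" "y \<noteq> \<one>" "angle y = 0"
    using assms by (auto simp: infinitesimals_def)
  have "angle (x \<otimes> y) + of_int (carry x y) = 0" using angle_mult[of x y] xy by simp
  then have "angle (x \<otimes> y) = 0" "carry x y = 0"
    using angle_01[of "x \<otimes> y"] xy carry_01[of x y]
    by (smt (verit) m_closed of_int_0_le_iff of_int_eq_0_iff)+
  then show ?thesis using xy by (auto simp: infinitesimals_def carry_def wraps_def split: if_splits)
qed

lemma infinitesimals_pow: "x \<in> infinitesimals \<Longrightarrow> n > 0 \<Longrightarrow> x [^] n \<in> infinitesimals" for n :: nat
proof (induction n)
  case (Suc n)
  then show ?case using infinitesimals_mult[of "x [^] n" x]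
    by (cases "n = 0") (auto simp: infinitesimals_def)
qed simp

text \<open>The inverse of a nontrivial element of angle 0 has angle 1, so
  \<open>infinitesimals\<close> contains the positive side only.\<close>

lemma infinitesimals_inv: "x \<in> infinitesimals \<Longrightarrow> inv x \<notin> infinitesimals \<union> {\<one>}"
  using angle_inv[of x] inv_eq_1_iff by (auto simp: infinitesimals_def)

text \<open>This resembles extending a partial order on an Abelian group to a total one, except that
  the cone may have units. A cone maximal among those avoiding the inverses of infinitesimals is
  total: if neither \<open>x\<close> nor its inverse could be adjoined, there would be relations
  \<open>c + n x = - h\<close> and \<open>d - m x = - k\<close>, and eliminating \<open>x\<close>
  puts the forbidden \<open>- (m h + n k)\<close> into the cone.\<close>

lemma ex_total_cone:
  "\<exists>C. infinitesimals \<subseteq> C \<and> C \<subseteq> carrier G \<and> \<one> \<in> C \<and> (\<forall>x\<in>C. \<forall>y\<in>C. x \<otimes> y \<in> C) \<and>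
    (\<forall>x\<in>infinitesimals. inv x \<notin> C) \<and> (\<forall>x\<in>carrier G. x \<in> C \<or> inv x \<in> C)"
proof -
  define A where "A = {C. infinitesimals \<subseteq> C \<and> C \<subseteq> carrier G \<and> \<one> \<in> C \<and>
    (\<forall>x\<in>C. \<forall>y\<in>C. x \<otimes> y \<in> C) \<and> (\<forall>x\<in>infinitesimals. inv x \<notin> C)}"
  have "infinitesimals \<union> {\<one>} \<in> A"
    unfolding A_def using infinitesimals_mult infinitesimals_inv
    by (auto simp: infinitesimals_def)
  then have "A \<noteq> {}" by blast
  moreover have "\<Union>\<C> \<in> A" if "\<C> \<noteq> {}" "subset.chain A \<C>" for \<C>
  proof -
    have sub: "C \<in> A" if "C \<in> \<C>" for C using that \<open>subset.chain A \<C>\<close> by (auto simp: subset_chain_def)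
    have "x \<otimes> y \<in> \<Union>\<C>" if "x \<in> \<Union>\<C>" "y \<in> \<Union>\<C>" for x y
    proof -
      obtain X Y where XY: "x \<in> X" "X \<in> \<C>" "y \<in> Y" "Y \<in> \<C>" using \<open>x \<in> \<Union>\<C>\<close> \<open>y \<in> \<Union>\<C>\<close> by blast
      then have "X \<subseteq> Y \<or> Y \<subseteq> X" using \<open>subset.chain A \<C>\<close> by (auto simp: subset_chain_def)
      then obtain Z where "Z \<in> \<C>" "x \<in> Z" "y \<in> Z" using XY by blast
      moreover from this have "x \<otimes> y \<in> Z" using sub[of Z] by (simp add: A_def)
      ultimately show ?thesis by blast
    qed
    moreover obtain C where "C \<in> \<C>" using \<open>\<C> \<noteq> {}\<close> by blast
    then have "infinitesimals \<subseteq> \<Union>\<C>" "\<one> \<in> \<Union>\<C>" using sub[of C] by (auto simp: A_def)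
    moreover have "\<Union>\<C> \<subseteq> carrier G" using sub unfolding A_def by blast
    moreover have "inv x \<notin> \<Union>\<C>" if "x \<in> infinitesimals" for x
      using sub that unfolding A_def by blast
    ultimately show ?thesis unfolding A_def by simp
  qed
  ultimately obtain C where C: "C \<in> A" and max: "\<And>X. X \<in> A \<Longrightarrow> C \<subseteq> X \<Longrightarrow> X = C"
    using subset_Zorn_nonempty[of A] by blast
  have Cc: "C \<subseteq> carrier G" and C1: "\<one> \<in> C" and Cm: "\<And>x y. x \<in> C \<Longrightarrow> y \<in> C \<Longrightarrow> x \<otimes> y \<in> C"
    and CH: "infinitesimals \<subseteq> C" and Cn: "\<And>x. x \<in> infinitesimals \<Longrightarrow> inv x \<notin> C"
    using C by (auto simp: A_def)
  have Cp: "x [^] n \<in> C" if "x \<in> C" for x and n :: nat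
    by (induction n) (use that C1 Cm in auto)
  have ext: "\<exists>c\<in>C. \<exists>n::nat. n > 0 \<and> (\<exists>h\<in>infinitesimals. c \<otimes> x [^] n = inv h)"
    if x: "x \<in> carrier G" "x \<notin> C" for x
  proof (rule ccontr)
    assume no: "\<not> ?thesis"
    define X where "X = {c \<otimes> x [^] n |c n. c \<in> C \<and> n \<in> (UNIV :: nat set)}"
    have CX: "C \<subseteq> X"
    proof
      fix c assume "c \<in> C"
      then have "c = c \<otimes> x [^] (0::nat)" using Cc by auto
      then show "c \<in> X" using \<open>c \<in> C\<close> unfolding X_def by blast
    qed
    have "x = \<one> \<otimes> x [^] (1::nat)" using x by simp
    then have xX: "x \<in> X" using C1 unfolding X_def by blast
    have "X \<in> A"
      unfolding A_def
    proof (intro CollectI conjI ballI)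
      fix a b assume "a \<in> X" "b \<in> X"
      then obtain c m d n where "c \<in> C" "d \<in> C" "a = c \<otimes> x [^] (m::nat)" "b = d \<otimes> x [^] (n::nat)"
        unfolding X_def by blast
      moreover from this have "a \<otimes> b = (c \<otimes> d) \<otimes> x [^] (m + n)"
        using x Cc by (auto simp: nat_pow_mult[symmetric] m_ac subset_iff)
      ultimately show "a \<otimes> b \<in> X" using Cm unfolding X_def by blast
    next
      fix h assume h: "h \<in> infinitesimals"
      show "inv h \<notin> X"
      proof
        assume "inv h \<in> X"
        then obtain c n where cn: "c \<in> C" "inv h = c \<otimes> x [^] (n::nat)" unfolding X_def by blast
        show False
        proof (cases "n = 0")
          case True then show False using cn Cn[OF h] Cc by auto
        next
          case False then show False using no cn h by (metis gr0I)
        qed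
      qed
    qed (use CX CH C1 x Cc in \<open>auto simp: X_def\<close>)
    then show False using max[OF _ CX] xX x by blast
  qed
  have "x \<in> C \<or> inv x \<in> C" if x: "x \<in> carrier G" for x
  proof (rule ccontr)
    assume "\<not> ?thesis"
    then obtain c n h d m k where
      1: "c \<in> C" "n > 0" "h \<in> infinitesimals" "c \<otimes> x [^] (n::nat) = inv h" and
      2: "d \<in> C" "m > 0" "k \<in> infinitesimals" "d \<otimes> (inv x) [^] (m::nat) = inv k"
      using ext[OF x] ext[of "inv x"] x by auto
    have car: "c \<in> carrier G" "d \<in> carrier G" "h \<in> carrier G" "k \<in> carrier G"
      using 1 2 Cc by (auto simp: infinitesimals_def)
    have "(c \<otimes> x [^] n) [^] m \<otimes> (d \<otimes> (inv x) [^] m) [^] n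
        = (c [^] m \<otimes> d [^] n) \<otimes> ((x \<otimes> inv x) [^] (n * m))"
      using car x by (simp add: nat_pow_distrib nat_pow_pow m_ac nat_pow_inv mult.commute)
    then have "c [^] m \<otimes> d [^] n = (inv h) [^] m \<otimes> (inv k) [^] n" using 1 2 car x by simp
    also have "\<dots> = inv (h [^] m \<otimes> k [^] n)" using car by (simp add: inv_mult nat_pow_inv)
    finally have "inv (h [^] m \<otimes> k [^] n) \<in> C" using Cm Cp 1 2 by metis
    moreover have "h [^] m \<otimes> k [^] n \<in> infinitesimals"
      using 1 2 by (intro infinitesimals_mult infinitesimals_pow)
    ultimately show False using Cn by blast
  qed
  then show ?thesis using Cc C1 Cm CH Cn by (intro exI[of _ C]) auto
qed

text \<open>With \<open>2 * pi * angle x\<close> as lift, \<open>cyc_angle\<close> gives one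
  direction of \<open>cyc_iff\<close>. For the other, if the points were in the opposite cyclic
  order, the six lifts would sum to \<open>4 * pi\<close>, whereas each of the three pairs of
  inverse elements needs at least \<open>2 * pi\<close>.\<close>

theorem ex_wound_group: "\<exists>w nn. wound_group G w nn"
proof -
  obtain C where Cc: "C \<subseteq> carrier G" and C1: "\<one> \<in> C" and Cm: "\<And>x y. x \<in> C \<Longrightarrow> y \<in> C \<Longrightarrow> x \<otimes> y \<in> C"
    and CH: "infinitesimals \<subseteq> C" and Cn: "\<And>x. x \<in> infinitesimals \<Longrightarrow> inv x \<notin> C"
    and Ct: "\<And>x. x \<in> carrier G \<Longrightarrow> x \<in> C \<or> inv x \<in> C"
    using ex_total_cone by metis
  define w where "w x = cis (2 * pi * angle x)" for x
  define ab where "ab = above G w (\<lambda>x. x \<in> C)"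
  have wm: "w (x \<otimes> y) = w x * w y" if "x \<in> carrier G" "y \<in> carrier G" for x y
  proof -
    have "2 * pi * angle x + 2 * pi * angle y = 2 * pi * angle (x \<otimes> y) + 2 * pi * of_int (carry x y)"
      using angle_mult[OF that] by (simp flip: distrib_left)
    then show ?thesis unfolding w_def cis_mult cis_eq_iff by (metis add.commute add_diff_cancel_right' diff_add_eq mult_minus_right of_int_minus uminus_add_conv_diff)
  qed
  have w1: "w \<one> = 1" by (simp add: w_def)
  have angle_ab: "ab (2 * pi * angle x) x" if "x \<in> carrier G" "x \<noteq> \<one>" for x
    using that angle_01[of x] Cn[of x] unfolding ab_def above_def w_def
    by (auto simp: infinitesimals_def zero_less_mult_iff)
  \<comment> \<open>The sum is a nonnegative multiple of \<open>2 * pi\<close>. It is not 0, because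
    totality of \<open>C\<close> forbids that \<open>x\<close> and its inverse are both strictly
    positive.\<close>
  have opp: "2 * pi \<le> d + e" if "x \<in> carrier G" "ab d x" "ab e (inv x)" for d e x
  proof -
    have "w x * w (inv x) = 1" using that w1 wm[of x "inv x"] by simp
    then have "cis (d + e) = 1"
      using that by (simp add: ab_def above_def cis_mult[symmetric])
    moreover have "0 \<le> d" "0 \<le> e" "\<not> (d = 0 \<and> e = 0)"
      using that Ct[of x] by (auto simp: ab_def above_def)
    ultimately show ?thesis using cis_eq_one_small[of "d + e"] by (smt (verit))
  qed
  have ab1: "0 < d" if "ab d \<one>" for d using that C1 by (auto simp: ab_def above_def)
  have inv2: "inv (inv x \<otimes> y) = inv y \<otimes> x" if "x \<in> carrier G" "y \<in> carrier G" for x y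
    using that by (simp add: inv_mult_group)
  have fwd: "\<exists>d1 d2 d3. d1 + d2 + d3 = 2 * pi \<and> ab d1 (inv x \<otimes> y) \<and> ab d2 (inv y \<otimes> z) \<and> ab d3 (inv z \<otimes> x)"
    if xyz: "x \<in> carrier G" "y \<in> carrier G" "z \<in> carrier G" and c: "cyc G x y z" for x y z
  proof -
    have ne: "inv x \<otimes> y \<noteq> \<one>" "inv y \<otimes> z \<noteq> \<one>" "inv z \<otimes> x \<noteq> \<one>"
      using cyc_strict[OF xyz c] xyz by (metis inv_closed inv_inv inv_unique' m_comm)+
    have "2 * pi * angle (inv x \<otimes> y) + 2 * pi * angle (inv y \<otimes> z) + 2 * pi * angle (inv z \<otimes> x) = 2 * pi"
      using cyc_angle[OF xyz c] by (simp flip: distrib_left)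
    then show ?thesis using angle_ab ne xyz by (meson inv_closed m_closed)
  qed
  have bwd: "cyc G x y z"
    if xyz: "x \<in> carrier G" "y \<in> carrier G" "z \<in> carrier G" and s: "d1 + d2 + d3 = 2 * pi"
      and a: "ab d1 (inv x \<otimes> y)" "ab d2 (inv y \<otimes> z)" "ab d3 (inv z \<otimes> x)" for x y z d1 d2 d3
  proof -
    have "x \<noteq> y" using a s xyz opp[of "inv y \<otimes> z" d2 d3] ab1[of d1] by (auto simp: inv2)
    moreover have "y \<noteq> z" using a s xyz opp[of "inv z \<otimes> x" d3 d1] ab1[of d2] by (auto simp: inv2)
    moreover have "z \<noteq> x" using a s xyz opp[of "inv x \<otimes> y" d1 d2] ab1[of d3] by (auto simp: inv2)
    moreover have "\<not> cyc G x z y"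
    proof
      assume "cyc G x z y"
      then obtain e1 e2 e3 where e: "e1 + e2 + e3 = 2 * pi" "ab e1 (inv x \<otimes> z)" "ab e2 (inv z \<otimes> y)" "ab e3 (inv y \<otimes> x)"
        using fwd[of x z y] xyz by blast
      have "2 * pi \<le> d1 + e3" "2 * pi \<le> d2 + e2" "2 * pi \<le> d3 + e1"
        using opp[of "inv x \<otimes> y" d1 e3] opp[of "inv y \<otimes> z" d2 e2] opp[of "inv z \<otimes> x" d3 e1] a e xyz
        by (simp_all add: inv2)
      then show False using e s pi_gt_zero by linarith
    qed
    ultimately show ?thesis using cyc_total xyz by blast
  qed
  have "wound_group G w (\<lambda>x. x \<in> C)"
  proof unfold_locales
    show "cmod (w x) = 1" for x by (simp add: w_def)
  next
    fix x assume x: "x \<in> carrier G" "w x = 1" "x \<in> C" "inv x \<in> C"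
    show "x = \<one>"
    proof (rule ccontr)
      assume n: "x \<noteq> \<one>"
      have "angle x = 0 \<or> angle x = 1"
        using x(2) angle_01[OF x(1)] cis_eq_one_small[of "2 * pi * angle x"] by (auto simp: w_def)
      then have "x \<in> infinitesimals \<or> inv x \<in> infinitesimals"
        using angle_inv[OF x(1) n] n x by (auto simp: infinitesimals_def)
      then show False using Cn[of x] Cn[of "inv x"] x by auto
    qed
  next
    fix x y z assume xyz: "x \<in> carrier G" "y \<in> carrier G" "z \<in> carrier G"
    show "cyc G x y z = (\<exists>d1 d2 d3. d1 + d2 + d3 = 2 * pi \<and>
       above G w (\<lambda>x. x \<in> C) d1 (inv x \<otimes> y) \<and> above G w (\<lambda>x. x \<in> C) d2 (inv y \<otimes> z) \<and>
       above G w (\<lambda>x. x \<in> C) d3 (inv z \<otimes> x))"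
      using fwd[OF xyz] bwd[OF xyz] unfolding ab_def[symmetric] by blast
  qed (use wm Cm Ct in auto)
  then show ?thesis by blast
qed

end

section \<open>Embedding into a lexicographic product\<close>

lemma (in group) inv_mult_eq_one_iff:
  assumes "x \<in> carrier G" "y \<in> carrier G"
  shows "inv x \<otimes> y = \<one> \<longleftrightarrow> x = y"
  using assms inv_solve_left[of \<one> x y] by auto

context wound_group
begin

lemma w_one [simp]: "w \<one> = 1"
  using w_mult[of \<one> \<one>] w_norm[of \<one>] by auto

lemma w_inv_mult [simp]: "x \<in> carrier G \<Longrightarrow> w (inv x) * w x = 1"
  using w_mult[of "inv x" x] by simp

lemma w_inv: "x \<in> carrier G \<Longrightarrow> w (inv x) = inverse (w x)"
  using w_inv_mult[of x] by (metis inverse_unique mult.commute)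

lemma nn_one [simp]: "nn \<one>"
  using nn_total[of \<one>] by simp

lemma w_nonzero: "x \<in> carrier G \<Longrightarrow> w x \<noteq> 0"
  using w_norm by force

lemma nn_pow: "x \<in> carrier G \<Longrightarrow> nn x \<Longrightarrow> nn (x [^] n)" for n :: nat
  by (induction n) (auto intro: nn_mult)

text \<open>The quotient of \<open>G\<close> by the elements that are both nonnegative and nonpositive. It is carried by
  representatives because the winding part asks for an ordered group over the element type of \<open>G\<close>.\<close>

definition rep :: "'a \<Rightarrow> 'a" where
  "rep x = (SOME y. y \<in> carrier G \<and> nn (inv x \<otimes> y) \<and> nn (inv y \<otimes> x))"

definition order_quotient :: "'a tog" where
  "order_quotient = \<lparr>carrier = rep ` carrier G, monoid.mult = (\<lambda>x y. rep (x \<otimes> y)), one = rep \<one>,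
     lt = (\<lambda>x y. \<not> nn (inv y \<otimes> x))\<rparr>"

lemma rep:
  assumes "x \<in> carrier G"
  shows "rep x \<in> carrier G" "nn (inv x \<otimes> rep x)" "nn (inv (rep x) \<otimes> x)"
proof -
  have "rep x \<in> carrier G \<and> nn (inv x \<otimes> rep x) \<and> nn (inv (rep x) \<otimes> x)"
    unfolding rep_def by (rule someI[of _ x]) (use assms in simp)
  then show "rep x \<in> carrier G" "nn (inv x \<otimes> rep x)" "nn (inv (rep x) \<otimes> x)" by auto
qed

lemma nn_trans:
  assumes "x \<in> carrier G" "y \<in> carrier G" "z \<in> carrier G" "nn (inv x \<otimes> y)" "nn (inv y \<otimes> z)"
  shows "nn (inv x \<otimes> z)"
proof -
  have "(inv x \<otimes> y) \<otimes> (inv y \<otimes> z) = inv x \<otimes> z"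
    using assms by (metis inv_closed inv_solve_left m_assoc m_closed)
  then show ?thesis using nn_mult[of "inv x \<otimes> y" "inv y \<otimes> z"] assms by simp
qed

lemma nn_diff_mult:
  assumes "x \<in> carrier G" "y \<in> carrier G" "u \<in> carrier G" "v \<in> carrier G"
    "nn (inv x \<otimes> y)" "nn (inv u \<otimes> v)"
  shows "nn (inv (x \<otimes> u) \<otimes> (y \<otimes> v))"
proof -
  have "(inv x \<otimes> y) \<otimes> (inv u \<otimes> v) = inv (x \<otimes> u) \<otimes> (y \<otimes> v)"
    using assms by (simp add: inv_mult m_ac)
  then show ?thesis using nn_mult[of "inv x \<otimes> y" "inv u \<otimes> v"] assms by simp
qed

lemma rep_eq_iff:
  assumes "x \<in> carrier G" "y \<in> carrier G"
  shows "rep x = rep y \<longleftrightarrow> nn (inv x \<otimes> y) \<and> nn (inv y \<otimes> x)"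
proof
  assume "rep x = rep y"
  then show "nn (inv x \<otimes> y) \<and> nn (inv y \<otimes> x)"
    using rep[OF assms(1)] rep[OF assms(2)] nn_trans assms by metis
next
  assume *: "nn (inv x \<otimes> y) \<and> nn (inv y \<otimes> x)"
  have "(z \<in> carrier G \<and> nn (inv x \<otimes> z) \<and> nn (inv z \<otimes> x)) \<longleftrightarrow>
        (z \<in> carrier G \<and> nn (inv y \<otimes> z) \<and> nn (inv z \<otimes> y))" for z
    using * assms nn_trans by blast
  then show "rep x = rep y" by (simp add: rep_def)
qed

lemma rep_mult:
  assumes "x \<in> carrier G" "y \<in> carrier G"
  shows "rep (rep x \<otimes> rep y) = rep (x \<otimes> y)"
  using assms rep[OF assms(1)] rep[OF assms(2)] rep_eq_iff[of "rep x \<otimes> rep y" "x \<otimes> y"]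
    nn_diff_mult[of "rep x" x "rep y" y] nn_diff_mult[of x "rep x" y "rep y"] by blast

lemma lt_rep:
  assumes x: "x \<in> carrier G" and y: "y \<in> carrier G"
  shows "lt order_quotient (rep x) (rep y) \<longleftrightarrow> \<not> nn (inv y \<otimes> x)"
proof -
  have "nn (inv (rep y) \<otimes> rep x) \<longleftrightarrow> nn (inv y \<otimes> x)"
  proof
    assume "nn (inv (rep y) \<otimes> rep x)"
    then have "nn (inv y \<otimes> rep x)" using nn_trans[of y "rep y" "rep x"] rep[OF x] rep[OF y] y by blast
    then show "nn (inv y \<otimes> x)" using nn_trans[of y "rep x" x] rep[OF x] x y by blast
  next
    assume "nn (inv y \<otimes> x)"
    then have "nn (inv y \<otimes> rep x)" using nn_trans[of y x "rep x"] rep[OF x] x y by blast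
    then show "nn (inv (rep y) \<otimes> rep x)" using nn_trans[of "rep y" y "rep x"] rep[OF x] rep[OF y] y by blast
  qed
  then show ?thesis by (simp add: order_quotient_def)
qed

lemma order_quotient_simps:
  "carrier order_quotient = rep ` carrier G" "\<one>\<^bsub>order_quotient\<^esub> = rep \<one>"
  "\<lbrakk>x \<in> carrier G; y \<in> carrier G\<rbrakk> \<Longrightarrow> rep x \<otimes>\<^bsub>order_quotient\<^esub> rep y = rep (x \<otimes> y)"
  using rep_mult by (simp_all add: order_quotient_def)

lemma totally_ordered_order_quotient: "totally_ordered_group order_quotient"
proof -
  have "group order_quotient"
  proof (rule groupI)
    fix x assume "x \<in> carrier order_quotient"
    then obtain a where "a \<in> carrier G" "x = rep a" by (auto simp: order_quotient_simps)
    then show "\<exists>y\<in>carrier order_quotient. y \<otimes>\<^bsub>order_quotient\<^esub> x = \<one>\<^bsub>order_quotient\<^esub>"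
      by (intro bexI[of _ "rep (inv a)"]) (auto simp: order_quotient_simps)
  next
    show "\<one>\<^bsub>order_quotient\<^esub> \<in> carrier order_quotient" by (simp add: order_quotient_simps)
  next
    fix x y assume "x \<in> carrier order_quotient" "y \<in> carrier order_quotient"
    then show "x \<otimes>\<^bsub>order_quotient\<^esub> y \<in> carrier order_quotient" by (auto simp: order_quotient_simps)
  next
    fix x y z
    assume "x \<in> carrier order_quotient" "y \<in> carrier order_quotient" "z \<in> carrier order_quotient"
    then show "x \<otimes>\<^bsub>order_quotient\<^esub> y \<otimes>\<^bsub>order_quotient\<^esub> z = x \<otimes>\<^bsub>order_quotient\<^esub> (y \<otimes>\<^bsub>order_quotient\<^esub> z)"
      by (auto simp: order_quotient_simps m_assoc)
  next
    fix x assume "x \<in> carrier order_quotient"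
    then show "\<one>\<^bsub>order_quotient\<^esub> \<otimes>\<^bsub>order_quotient\<^esub> x = x" by (auto simp: order_quotient_simps)
  qed
  moreover have "totally_ordered_group_axioms order_quotient"
  proof (unfold_locales, goal_cases)
    case (1 x) then show ?case by (auto simp: order_quotient_simps lt_rep)
  next
    case (2 x y z)
    then obtain a b c where abc: "a \<in> carrier G" "b \<in> carrier G" "c \<in> carrier G" "x = rep a" "y = rep b" "z = rep c"
      by (auto simp: order_quotient_simps)
    then have "\<not> nn (inv b \<otimes> a)" "\<not> nn (inv c \<otimes> b)" using 2 by (auto simp: lt_rep)
    then have "nn (inv b \<otimes> c)" using nn_total[of "inv b \<otimes> c"] abc by (simp add: inv_mult_group)
    then show ?case using abc nn_trans[of b c a] \<open>\<not> nn (inv b \<otimes> a)\<close> by (auto simp: lt_rep)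
  next
    case (3 x y)
    then obtain a b where ab: "a \<in> carrier G" "b \<in> carrier G" "x = rep a" "y = rep b"
      by (auto simp: order_quotient_simps)
    then show ?case using 3 by (auto simp: lt_rep rep_eq_iff)
  next
    case (4 x y u v)
    then obtain a b c d where abc: "a \<in> carrier G" "b \<in> carrier G" "c \<in> carrier G" "d \<in> carrier G"
      "x = rep a" "y = rep b" "u = rep c" "v = rep d"
      by (auto simp: order_quotient_simps)
    have "inv (c \<otimes> b \<otimes> d) \<otimes> (c \<otimes> a \<otimes> d) = inv b \<otimes> a \<otimes> (inv c \<otimes> c) \<otimes> (inv d \<otimes> d)"
      using abc(1-4) by (simp add: inv_mult m_ac del: l_inv r_inv)
    then have "inv (c \<otimes> b \<otimes> d) \<otimes> (c \<otimes> a \<otimes> d) = inv b \<otimes> a" using abc by simp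
    then show ?case using 4 abc by (simp add: order_quotient_simps lt_rep)
  qed
  ultimately show ?thesis by (simp add: totally_ordered_group_def)
qed

lemma embeds_lex_product:
  "(\<lambda>x. (w x, rep x)) \<in> cog_embeddings G (lex_product circle order_quotient)"
proof -
  note oq = totally_ordered_order_quotient
  have nn_inv_diff: "inv (inv x \<otimes> y) = inv y \<otimes> x" if "x \<in> carrier G" "y \<in> carrier G" for x y
    using that by (simp add: inv_mult_group)
  have ab: "above G w nn d (inv x \<otimes> y) \<longleftrightarrow>
      w y = w x * cis d \<and> (d > 0 \<or> d = 0 \<and> lt order_quotient (rep x) (rep y))"
    if "x \<in> carrier G" "y \<in> carrier G" for d x y
    using that w_nonzero[of x] by (auto simp: above_def nn_inv_diff lt_rep w_mult w_inv field_simps)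
  have inj: "x = y" if "x \<in> carrier G" "y \<in> carrier G" "w x = w y" "rep x = rep y" for x y
  proof -
    have "w (inv x \<otimes> y) = 1" using that w_nonzero[of y] by (simp add: w_mult w_inv)
    moreover have "nn (inv x \<otimes> y)" "nn (inv (inv x \<otimes> y))" using that by (simp_all add: rep_eq_iff nn_inv_diff)
    ultimately have "inv x \<otimes> y = \<one>" using that w_nn_inj[of "inv x \<otimes> y"] by simp
    then show ?thesis using that inv_mult_eq_one_iff by blast
  qed
  have "cyc (lex_product circle order_quotient) (w x, rep x) (w y, rep y) (w z, rep z) \<longleftrightarrow> cyc G x y z"
    if "x \<in> carrier G" "y \<in> carrier G" "z \<in> carrier G" for x y z
    using that by (subst lex_cyc_iff[OF oq]) (auto simp: w_norm cyc_iff ab order_quotient_simps(1) conj_assoc)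
  moreover have "(\<lambda>x. (w x, rep x)) \<in> hom G (lex_product circle order_quotient)"
    by (simp add: hom_def Pi_def lex_product_def DirProd_def circle_def w_norm w_mult order_quotient_simps)
  moreover have "inj_on (\<lambda>x. (w x, rep x)) (carrier G)"
    using inj unfolding inj_on_def by blast
  ultimately show ?thesis unfolding cog_embeddings_def by blast
qed

end

text \<open>The choice operator may return the image of an embedding other than the constructed one,
  which only shows that a candidate exists. The chosen embedding is itself converted into
  \<open>w\<close> and \<open>nn\<close>, so the winding part is the image of this
  \<open>w\<close>.\<close>

theorem winding_part_wound_group:
  fixes G :: "'a cog"
  assumes "cyclically_ordered_group G" "comm_group G"
  shows "\<exists>w nn. wound_group G w nn \<and> winding_part G = circle\<lparr>carrier := w ` carrier G\<rparr>"
proof -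
  interpret comm_cog G using assms by (simp add: comm_cog_def)
  define P where "P W \<longleftrightarrow> (\<exists>(L :: 'a tog) f. totally_ordered_group L
        \<and> f \<in> cog_embeddings G (lex_product circle L) \<and> W = fst ` f ` carrier G)" for W
  obtain w nn where "wound_group G w nn" using ex_wound_group by blast
  then interpret W: wound_group G w nn .
  have "P (fst ` (\<lambda>x. (w x, W.rep x)) ` carrier G)"
    unfolding P_def using W.embeds_lex_product W.totally_ordered_order_quotient by blast
  then have "P (SOME W. P W)" by (rule someI)
  then obtain L :: "'a tog" and f where L: "totally_ordered_group L" "f \<in> cog_embeddings G (lex_product circle L)"
    "(SOME W. P W) = fst ` f ` carrier G" unfolding P_def by blast
  have "winding_part G = circle\<lparr>carrier := (fst \<circ> f) ` carrier G\<rparr>"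
    using L(3) unfolding winding_part_def P_def image_comp by simp
  then show ?thesis using wound_group_of_embedding[OF L(1) assms(2) L(2)] by blast
qed

section \<open>Functionals with prescribed signs\<close>

lemma ex_between_finite:
  fixes X Y :: "'a :: {dense_linorder, no_top, no_bot} set"
  assumes "finite X" "finite Y" "\<And>x y. x \<in> X \<Longrightarrow> y \<in> Y \<Longrightarrow> x < y"
  shows "\<exists>t. (\<forall>x\<in>X. x < t) \<and> (\<forall>y\<in>Y. t < y)"
proof (cases "X = {} \<or> Y = {}")
  case False
  then have "Max X < Min Y" using assms by simp
  then obtain t where "Max X < t" "t < Min Y" using dense by blast
  then show ?thesis using assms False by (intro exI[of _ t]) auto
next
  case True
  then show ?thesis
  proof
    assume "X = {}"
    obtain t where "Y \<noteq> {} \<Longrightarrow> t < Min Y" using lt_ex by blast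
    then show ?thesis using \<open>X = {}\<close> assms by (intro exI[of _ t]) auto
  next
    assume "Y = {}"
    obtain t where "X \<noteq> {} \<Longrightarrow> Max X < t" using gt_ex by blast
    then show ?thesis using \<open>Y = {}\<close> assms by (intro exI[of _ t]) auto
  qed
qed

text \<open>Fourier--Motzkin elimination, one coordinate at a time.\<close>

lemma ex_functional_matching_cone:
  fixes P :: "('i \<Rightarrow> int) \<Rightarrow> bool"
  assumes tot: "\<And>v. P v \<or> P (\<lambda>i. - v i)"
    and add: "\<And>v w. P v \<Longrightarrow> P w \<Longrightarrow> P (\<lambda>i. v i + w i)"
    and "finite I" "finite S" "\<And>s i. s \<in> S \<Longrightarrow> i \<notin> I \<Longrightarrow> s i = 0"
  shows "\<exists>h::'i \<Rightarrow> int. \<forall>s\<in>S. P s \<longleftrightarrow> 0 \<le> (\<Sum>i\<in>I. h i * s i)"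
  using assms(3-5)
proof (induction I arbitrary: S)
  case empty
  then have "s = (\<lambda>i. 0)" if "s \<in> S" for s using that by auto
  moreover have "P (\<lambda>i. 0)" using tot[of "\<lambda>i. 0"] by simp
  ultimately have "P s" if "s \<in> S" for s using that by metis
  then show ?case by simp
next
  case (insert k I)
  have scale: "P (\<lambda>i. c * v i)" if "0 \<le> c" "P v" for c :: int and v
  proof -
    have "P (\<lambda>i. int n * v i)" for n
    proof (induction n)
      case 0 then show ?case using tot[of "\<lambda>i. 0"] by simp
    next
      case (Suc n) then show ?case using add[OF Suc.IH \<open>P v\<close>] by (simp add: algebra_simps)
    qed
    from this[of "nat c"] show ?thesis using that by simp
  qed
  have unscale: "P v" if "0 < c" "P (\<lambda>i. c * v i)" for c :: int and v
  proof (rule ccontr)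
    assume "\<not> P v"
    then have "P (\<lambda>i. (c - 1) * - v i)" using tot[of v] scale[of "c - 1" "\<lambda>i. - v i"] that by simp
    from add[OF that(2) this] show False using \<open>\<not> P v\<close> by (simp add: algebra_simps)
  qed
  define neg where "neg s = (\<lambda>i. - s i)" for s :: "'i \<Rightarrow> int"
  \<comment> \<open>Vectors are oriented to be positive at \<open>k\<close>; \<open>D s t\<close> is
    then the positive combination of \<open>s\<close> and \<open>- t\<close> that eliminates this
    coordinate.\<close>
  define Q where "Q = {s \<in> S \<union> neg ` S. s k > 0}"
  define D where "D s t = (\<lambda>i. t k * s i - s k * t i)" for s t :: "'i \<Rightarrow> int"
  have finQ: "finite Q" unfolding Q_def using insert.prems by simp
  have suppQ: "s i = 0" if "s \<in> Q" "i \<notin> insert k I" for s i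
    using that insert.prems(2) by (auto simp: Q_def neg_def)
  have "finite ({s \<in> S. s k = 0} \<union> (\<lambda>(s, t). D s t) ` (Q \<times> Q))"
    using insert.prems finQ by simp
  moreover have "s i = 0" if "s \<in> {s \<in> S. s k = 0} \<union> (\<lambda>(s, t). D s t) ` (Q \<times> Q)" "i \<notin> I" for s i
  proof -
    consider "s \<in> S" "s k = 0" | a b where "a \<in> Q" "b \<in> Q" "s = D a b" using \<open>s \<in> _\<close> by auto
    then show ?thesis
    proof cases
      case 1 then show ?thesis using insert.prems(2)[of s i] \<open>i \<notin> I\<close> by (cases "i = k") auto
    next
      case 2 then show ?thesis using suppQ[of a i] suppQ[of b i] \<open>i \<notin> I\<close>
        by (cases "i = k") (auto simp: D_def)
    qed
  qed
  ultimately obtain h where h: "\<And>s. s \<in> {s \<in> S. s k = 0} \<union> (\<lambda>(s, t). D s t) ` (Q \<times> Q) \<Longrightarrow>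
      P s \<longleftrightarrow> 0 \<le> (\<Sum>i\<in>I. h i * s i)"
    using insert.IH by meson
  define H where "H s = (\<Sum>i\<in>I. h i * s i)" for s
  \<comment> \<open>The coefficient at \<open>k\<close> for which the extended functional vanishes
    at \<open>s\<close>. Membership of \<open>s\<close> asks for a coefficient of at least
    \<open>r s\<close>, membership of \<open>- s\<close> for one of at most
    \<open>r s\<close>.\<close>
  define r where "r s = - of_int (H s) / (of_int (s k) :: rat)" for s
  have r: "P (D s t) \<longleftrightarrow> r s \<le> r t" if "s \<in> Q" "t \<in> Q" for s t
  proof -
    have pos: "s k > 0" "t k > 0" using that by (auto simp: Q_def)
    have "H (D s t) = t k * H s - s k * H t"
      by (simp add: H_def D_def sum_distrib_left sum_subtractf[symmetric] algebra_simps)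
    moreover have "P (D s t) \<longleftrightarrow> 0 \<le> H (D s t)"
      unfolding H_def by (rule h) (use that in auto)
    moreover have "r s \<le> r t \<longleftrightarrow> of_int (s k * H t) \<le> (of_int (t k * H s) :: rat)"
      unfolding r_def using pos by (simp add: field_simps)
    ultimately show ?thesis by (simp only: of_int_le_iff) auto
  qed
  have D: "P t \<and> P (neg s)" if "s \<in> Q" "t \<in> Q" "P s" "P (neg t)" "P (D t s)" for s t
  proof -
    have pos: "s k > 0" "t k > 0" using that by (auto simp: Q_def)
    have "P (\<lambda>i. s k * t i)" using add[OF that(5) scale[of "t k" s]] that pos by (simp add: D_def)
    moreover have "P (\<lambda>i. t k * neg s i)"
      using add[OF that(5) scale[of "s k" "neg t"]] that pos by (simp add: D_def neg_def)
    ultimately show ?thesis using unscale pos by blast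
  qed
  have le: "r s \<le> r t" if "s \<in> Q" "t \<in> Q" "P s" "P (neg t)" for s t
  proof -
    have "t k > 0" "s k > 0" using that by (auto simp: Q_def)
    then have "P (D s t)"
      using add[OF scale[of "t k" s] scale[of "s k" "neg t"]] that by (simp add: D_def neg_def)
    then show ?thesis using r that by simp
  qed
  have less: "r s < r t" if "s \<in> Q" "t \<in> Q" "P s" "P (neg t)" "\<not> P t \<or> \<not> P (neg s)" for s t
    using D[OF that(1-4)] r[OF that(2,1)] that(5) by auto
  have "\<exists>t. \<forall>s\<in>Q. (P s \<longleftrightarrow> r s \<le> t) \<and> (P (neg s) \<longleftrightarrow> t \<le> r s)"
  \<comment> \<open>A vector lying in the cone together with its negative forces the coefficient;
    otherwise all bounds are strict and leave an open interval.\<close>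
  proof (cases "\<exists>e\<in>Q. P e \<and> P (neg e)")
    case True
    then obtain e where e: "e \<in> Q" "P e" "P (neg e)" by blast
    have "(P s \<longleftrightarrow> r s \<le> r e) \<and> (P (neg s) \<longleftrightarrow> r e \<le> r s)" if "s \<in> Q" for s
      using le[OF that e(1)] le[OF e(1) that] less[OF that e(1)] less[OF e(1) that] e tot[of s, folded neg_def]
      by force
    then show ?thesis by blast
  next
    case False
    have "\<exists>t. (\<forall>x\<in>r ` {s \<in> Q. P s}. x < t) \<and> (\<forall>y\<in>r ` {s \<in> Q. P (neg s)}. t < y)"
      by (rule ex_between_finite) (use finQ False less in auto)
    then obtain t where t: "\<And>s. s \<in> Q \<Longrightarrow> P s \<Longrightarrow> r s < t" "\<And>s. s \<in> Q \<Longrightarrow> P (neg s) \<Longrightarrow> t < r s"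
      by auto
    then have "(P s \<longleftrightarrow> r s \<le> t) \<and> (P (neg s) \<longleftrightarrow> t \<le> r s)" if "s \<in> Q" for s
      using that tot[of s, folded neg_def] by force
    then show ?thesis by blast
  qed
  then obtain t where t: "\<And>s. s \<in> Q \<Longrightarrow> P s \<longleftrightarrow> r s \<le> t" "\<And>s. s \<in> Q \<Longrightarrow> P (neg s) \<longleftrightarrow> t \<le> r s"
    by blast
  obtain a b where ab: "quotient_of t = (a, b)" by (cases "quotient_of t")
  then have b: "b > 0" and tab: "t = of_int a / of_int b"
    using quotient_of_denom_pos quotient_of_div by auto
  \<comment> \<open>Multiplying the functional by the positive denominator of
    \<open>t = a / b\<close> keeps its signs and makes it integral.\<close>
  define h' where "h' = (\<lambda>i. if i = k then a else b * h i)"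
  have val: "(\<Sum>i\<in>insert k I. h' i * s i) = a * s k + b * H s" for s
  proof -
    have "(\<Sum>i\<in>I. h' i * s i) = (\<Sum>i\<in>I. b * (h i * s i))"
      by (rule sum.cong) (use insert.hyps in \<open>auto simp: h'_def\<close>)
    then show ?thesis using insert.hyps by (simp add: h'_def H_def sum_distrib_left)
  qed
  have rt: "r s \<le> t \<longleftrightarrow> 0 \<le> a * s k + b * H s" "t \<le> r s \<longleftrightarrow> a * s k + b * H s \<le> 0" if "s \<in> Q" for s
  proof -
    have pos: "s k > 0" using that by (auto simp: Q_def)
    have "r s \<le> t \<longleftrightarrow> (0 :: rat) \<le> of_int (a * s k + b * H s)"
      unfolding r_def tab using pos b by (simp add: field_simps) linarith
    then show "r s \<le> t \<longleftrightarrow> 0 \<le> a * s k + b * H s" by (simp only: of_int_0_le_iff)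
    have "t \<le> r s \<longleftrightarrow> of_int (a * s k + b * H s) \<le> (0 :: rat)"
      unfolding r_def tab using pos b by (simp add: field_simps) linarith
    then show "t \<le> r s \<longleftrightarrow> a * s k + b * H s \<le> 0" by (simp only: of_int_le_0_iff)
  qed
  have "P s \<longleftrightarrow> 0 \<le> (\<Sum>i\<in>insert k I. h' i * s i)" if s: "s \<in> S" for s
  proof -
    consider "s k = 0" | "s k > 0" | "s k < 0" by linarith
    then show ?thesis
    proof cases
      case 1
      then have "P s \<longleftrightarrow> 0 \<le> H s" unfolding H_def by (intro h) (use s in auto)
      then show ?thesis using 1 b by (simp add: val zero_le_mult_iff)
    next
      case 2
      then have "s \<in> Q" using s by (simp add: Q_def)
      then show ?thesis using t rt val by simp
    next
      case 3
      then have Q: "neg s \<in> Q" using s by (simp add: Q_def neg_def)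
      have "P s \<longleftrightarrow> P (neg (neg s))" by (simp add: neg_def)
      also have "\<dots> \<longleftrightarrow> a * neg s k + b * H (neg s) \<le> 0" using t(2)[OF Q] rt(2)[OF Q] by simp
      also have "\<dots> \<longleftrightarrow> 0 \<le> a * s k + b * H s" by (simp add: neg_def H_def sum_negf algebra_simps) linarith
      finally show ?thesis by (simp add: val)
    qed
  qed
  then show ?case by blast
qed

section \<open>Independent generators modulo torsion\<close>

context comm_group
begin

definition torsion :: "'a set" where
  "torsion = {x \<in> carrier G. \<exists>n::nat. n > 0 \<and> x [^] n = \<one>}"

lemma torsion_closed [simp]: "x \<in> torsion \<Longrightarrow> x \<in> carrier G"
  by (simp add: torsion_def)

lemma torsionI: "x \<in> carrier G \<Longrightarrow> n > 0 \<Longrightarrow> x [^] (n::nat) = \<one> \<Longrightarrow> x \<in> torsion"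
  unfolding torsion_def by blast

lemma torsionE:
  assumes "x \<in> torsion"
  obtains n :: nat where "x \<in> carrier G" "n > 0" "x [^] n = \<one>"
  using assms unfolding torsion_def by blast

lemma one_torsion [simp]: "\<one> \<in> torsion"
  by (rule torsionI[of _ 1]) auto

lemma torsion_mult:
  assumes "x \<in> torsion" "y \<in> torsion"
  shows "x \<otimes> y \<in> torsion"
proof -
  obtain m n where xy: "x \<in> carrier G" "m > 0" "x [^] (m::nat) = \<one>" "y \<in> carrier G" "n > 0" "y [^] (n::nat) = \<one>"
    using assms by (metis torsionE)
  have "(x \<otimes> y) [^] (m * n) = (x [^] m) [^] n \<otimes> (y [^] n) [^] m"
    using xy(1,4) by (simp add: nat_pow_distrib nat_pow_pow mult.commute)
  then show ?thesis using xy by (intro torsionI[of _ "m * n"]) simp_all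
qed

lemma torsion_inv: "x \<in> torsion \<Longrightarrow> inv x \<in> torsion"
  by (erule torsionE, rule torsionI) (simp_all add: nat_pow_inv)

lemma torsion_of_pow:
  assumes "x \<in> carrier G" "n > 0" "x [^] (n::nat) \<in> torsion"
  shows "x \<in> torsion"
proof -
  obtain m where "m > 0" "(x [^] n) [^] (m::nat) = \<one>" using assms(3) by (rule torsionE)
  then show ?thesis using assms by (intro torsionI[of _ "n * m"]) (simp_all add: nat_pow_pow)
qed

lemma torsion_of_int_pow:
  assumes "x \<in> carrier G" "c \<noteq> 0" "x [^] (c::int) \<in> torsion"
  shows "x \<in> torsion"
proof (cases "c > 0")
  case True
  then show ?thesis using assms torsion_of_pow[of x "nat c"] int_pow_int[of G x "nat c"] by auto
next
  case False
  then have "inv (x [^] nat (- c)) = x [^] c" using assms int_pow_neg_int[of x "nat (- c)"] by simp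
  then have "x [^] nat (- c) \<in> torsion" using assms torsion_inv[of "x [^] c"]
    by (metis inv_inv nat_pow_closed)
  then show ?thesis using assms torsion_of_pow[of x "nat (- c)"] False by auto
qed

definition comb :: "('i \<Rightarrow> 'a) \<Rightarrow> 'i set \<Rightarrow> ('i \<Rightarrow> int) \<Rightarrow> 'a" where
  "comb b I v = finprod G (\<lambda>i. b i [^] v i) I"

lemma comb_closed [simp]: "b \<in> I \<rightarrow> carrier G \<Longrightarrow> comb b I v \<in> carrier G"
  unfolding comb_def by (rule finprod_closed) auto

lemma comb_add:
  "b \<in> I \<rightarrow> carrier G \<Longrightarrow> comb b I (\<lambda>i. v i + w i) = comb b I v \<otimes> comb b I w"
proof -
  assume b: "b \<in> I \<rightarrow> carrier G"
  have "finprod G (\<lambda>i. b i [^] (v i + w i)) I = finprod G (\<lambda>i. b i [^] v i \<otimes> b i [^] w i) I"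
    by (rule finprod_cong') (use b in \<open>auto simp: int_pow_mult Pi_iff\<close>)
  also have "\<dots> = comb b I v \<otimes> comb b I w"
    unfolding comb_def by (rule finprod_multf) (use b in auto)
  finally show ?thesis by (simp add: comb_def)
qed

lemma comb_zero [simp]: "comb b I (\<lambda>i. 0) = \<one>"
  by (simp add: comb_def)

lemma comb_neg: "b \<in> I \<rightarrow> carrier G \<Longrightarrow> comb b I (\<lambda>i. - v i) = inv (comb b I v)"
  using comb_add[of b I "\<lambda>i. - v i" v] by (intro inv_equality[symmetric]) auto

lemma comb_pow: "b \<in> I \<rightarrow> carrier G \<Longrightarrow> comb b I (\<lambda>i. int n * v i) = comb b I v [^] n"
proof (induction n)
  case (Suc n)
  have "comb b I (\<lambda>i. int (Suc n) * v i) = comb b I (\<lambda>i. int n * v i + v i)"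
    by (simp add: algebra_simps)
  then show ?case using Suc comb_add[of b I "\<lambda>i. int n * v i" v] by simp
qed simp

lemma comb_single:
  assumes "finite I" "i \<in> I" "b \<in> I \<rightarrow> carrier G"
  shows "comb b I (\<lambda>j. if j = i then c else 0) = b i [^] c"
proof -
  have "comb b I (\<lambda>j. if j = i then c else 0) = finprod G (\<lambda>j. if i = j then b j [^] c else \<one>) I"
    unfolding comb_def by (rule finprod_cong') (use assms in \<open>auto simp: Pi_iff\<close>)
  also have "\<dots> = b i [^] c" by (rule finprod_singleton) (use assms in auto)
  finally show ?thesis .
qed

lemma comb_cong: "(\<And>i. i \<in> I \<Longrightarrow> b i = b' i) \<Longrightarrow> (\<And>i. i \<in> I \<Longrightarrow> v i = v' i) \<Longrightarrow> b' \<in> I \<rightarrow> carrier G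
  \<Longrightarrow> comb b I v = comb b' I v'"
  unfolding comb_def by (rule finprod_cong') (auto simp: Pi_iff)

lemma comb_insert:
  "finite I \<Longrightarrow> i \<notin> I \<Longrightarrow> b \<in> insert i I \<rightarrow> carrier G \<Longrightarrow> comb b (insert i I) v = b i [^] v i \<otimes> comb b I v"
  unfolding comb_def by (rule finprod_insert) (auto simp: Pi_iff)

definition indep :: "('i \<Rightarrow> 'a) \<Rightarrow> 'i set \<Rightarrow> bool" where
  "indep b I \<longleftrightarrow> (\<forall>v. comb b I v \<in> torsion \<longrightarrow> (\<forall>i\<in>I. v i = 0))"

definition tspan :: "('i \<Rightarrow> 'a) \<Rightarrow> 'i set \<Rightarrow> 'a set" where
  "tspan b I = {t \<otimes> comb b I v |t v. t \<in> torsion}"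

lemma tspanI: "t \<in> torsion \<Longrightarrow> t \<otimes> comb b I v \<in> tspan b I"
  by (auto simp: tspan_def)

lemma tspan_mult:
  assumes "b \<in> I \<rightarrow> carrier G" "x \<in> tspan b I" "y \<in> tspan b I"
  shows "x \<otimes> y \<in> tspan b I"
proof -
  obtain s v t w where "s \<in> torsion" "t \<in> torsion" "x = s \<otimes> comb b I v" "y = t \<otimes> comb b I w"
    using assms by (auto simp: tspan_def)
  moreover from this have "x \<otimes> y = (s \<otimes> t) \<otimes> comb b I (\<lambda>i. v i + w i)"
    using assms by (simp add: comb_add m_ac)
  ultimately show ?thesis using tspanI torsion_mult by metis
qed

lemma tspan_inv:
  assumes "b \<in> I \<rightarrow> carrier G" "x \<in> tspan b I"
  shows "inv x \<in> tspan b I"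
proof -
  obtain s v where "s \<in> torsion" "x = s \<otimes> comb b I v"
    using assms by (auto simp: tspan_def)
  moreover from this have "inv x = inv s \<otimes> comb b I (\<lambda>i. - v i)"
    using assms by (simp add: comb_neg inv_mult)
  ultimately show ?thesis using tspanI torsion_inv by metis
qed

lemma torsion_subset_tspan: "torsion \<subseteq> tspan b I"
  using tspanI[of _ b I "\<lambda>i. 0"] by force

lemma generator_in_tspan:
  assumes "finite I" "i \<in> I" "b \<in> I \<rightarrow> carrier G"
  shows "b i \<in> tspan b I"
  using tspanI[OF one_torsion, of b I "\<lambda>j. if j = i then 1 else 0"] comb_single[OF assms, of 1] assms
  by (simp add: Pi_iff)

text \<open>A relation between generators is shortened by the Euclidean algorithm until it involves a single
  generator, which is then torsion and can be dropped.\<close>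

lemma ex_independent_generators:
  fixes g :: "'i \<Rightarrow> 'a"
  assumes "finite I" "g \<in> I \<rightarrow> carrier G"
  shows "\<exists>b J. finite J \<and> J \<subseteq> I \<and> b \<in> J \<rightarrow> carrier G \<and> indep b J \<and> (\<forall>i\<in>I. g i \<in> tspan b J)"
  using assms
proof (induction I arbitrary: g rule: finite_psubset_induct)
  case (psubset I)
  note fin = \<open>finite I\<close>
  define goal where "goal g \<longleftrightarrow> (\<exists>(b::'i \<Rightarrow> 'a) J. finite J \<and> J \<subseteq> I \<and> b \<in> J \<rightarrow> carrier G \<and> indep b J \<and> (\<forall>i\<in>I. g i \<in> tspan b J))"
    for g
  \<comment> \<open>The inner measure is the sum of the absolute exponents of a nontrivial relation;
    the outer induction applies once a generator has turned out to be torsion.\<close>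
  have rel: "goal g" if "g \<in> I \<rightarrow> carrier G" "comb g I v \<in> torsion" "i \<in> I" "v i \<noteq> 0" for g v i
    using that
  proof (induction "\<Sum>i\<in>I. nat \<bar>v i\<bar>" arbitrary: g v i rule: less_induct)
    case less
    show ?case
    proof (cases "\<exists>j\<in>I. j \<noteq> i \<and> v j \<noteq> 0")
      case False
      have "comb g I v = comb g I (\<lambda>j. if j = i then v i else 0)"
        by (rule comb_cong) (use False less.prems in auto)
      then have "g i [^] v i \<in> torsion" using less.prems comb_single[OF fin, of i g "v i"] by simp
      then have gi: "g i \<in> torsion" using torsion_of_int_pow[of "g i" "v i"] less.prems by auto
      obtain b and J :: "'i set" where "finite J" "J \<subseteq> I - {i}" "b \<in> J \<rightarrow> carrier G" "indep b J" "\<forall>j\<in>I - {i}. g j \<in> tspan b J"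
      proof -
        have "I - {i} \<subset> I" "g \<in> I - {i} \<rightarrow> carrier G" using less.prems by auto
        then show ?thesis using that psubset.IH[of "I - {i}" g] by blast
      qed
      then show ?thesis unfolding goal_def using gi torsion_subset_tspan[of b J]
        by (intro exI[of _ b] exI[of _ J]) auto
    next
      case True
      then obtain i j where ij: "i \<in> I" "j \<in> I" "i \<noteq> j" "v i \<noteq> 0" "v j \<noteq> 0" "\<bar>v i\<bar> \<le> \<bar>v j\<bar>"
        using less.prems by (metis linorder_le_cases)
      \<comment> \<open>The sign that makes \<open>s * v i\<close> point in the direction of
        \<open>v j\<close>, so that the larger exponent drops by the absolute value of the smaller
        one. Replacing \<open>g i\<close> by \<open>g i + s * g j\<close> leaves the combination
        unchanged and can be undone, so nothing is lost from the span.\<close>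
      define s where "s = sgn (v i) * sgn (v j)"
      define g' where "g' = g(i := g i \<otimes> g j [^] s)"
      define v' where "v' = v(j := v j - s * v i)"
      define K where "K = I - {i, j}"
      have I: "I = insert i (insert j K)" "i \<notin> insert j K" "j \<notin> K" "finite K"
        using ij fin by (auto simp: K_def)
      have gc: "g i \<in> carrier G" "g j \<in> carrier G" "\<And>k. k \<in> K \<Longrightarrow> g k \<in> carrier G"
        using less.prems ij by (auto simp: K_def)
      have g'c: "g' \<in> I \<rightarrow> carrier G" using less.prems(1) ij by (simp add: g'_def Pi_iff)
      have K: "comb g' K v' = comb g K v"
        by (rule comb_cong) (use I gc in \<open>auto simp: g'_def v'_def\<close>)
      have "comb g' I v' = g' i [^] v' i \<otimes> (g' j [^] v' j \<otimes> comb g' K v')"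
        unfolding I(1) using I g'c by (simp add: comb_insert)
      also have "\<dots> = (g i \<otimes> g j [^] s) [^] v i \<otimes> (g j [^] (v j - s * v i) \<otimes> comb g K v)"
        using ij by (simp add: K) (simp add: g'_def v'_def)
      also have "\<dots> = g i [^] v i \<otimes> (g j [^] (s * v i) \<otimes> g j [^] (v j - s * v i)) \<otimes> comb g K v"
        using gc by (simp add: int_pow_distrib int_pow_pow m_assoc Pi_iff)
      also have "g j [^] (s * v i) \<otimes> g j [^] (v j - s * v i) = g j [^] v j"
        using gc by (simp add: int_pow_mult[symmetric])
      also have "g i [^] v i \<otimes> g j [^] v j \<otimes> comb g K v = comb g I v"
        unfolding I(1) using I gc by (simp add: comb_insert Pi_iff m_assoc)
      finally have c: "comb g' I v' \<in> torsion" using less.prems by simp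
      have "\<bar>v j - s * v i\<bar> < \<bar>v j\<bar>"
        using ij unfolding s_def by (auto simp: sgn_if abs_if split: if_splits)
      then have "(\<Sum>k\<in>I. nat \<bar>v' k\<bar>) < (\<Sum>k\<in>I. nat \<bar>v k\<bar>)"
        using ij by (intro sum_strict_mono_ex1 fin) (auto simp: v'_def)
      moreover have "v' i \<noteq> 0" using ij by (simp add: v'_def)
      ultimately have "goal g'" using less.hyps[OF _ g'c c ij(1)] by blast
      then obtain b and J :: "'i set" where bJ: "finite J" "J \<subseteq> I" "b \<in> J \<rightarrow> carrier G" "indep b J"
        and sp: "\<forall>k\<in>I. g' k \<in> tspan b J" unfolding goal_def by blast
      have spk: "g k \<in> tspan b J" if "k \<in> I" "k \<noteq> i" for k using sp that by (auto simp: g'_def)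
      have s: "s = 1 \<or> s = -1" using ij by (auto simp: s_def sgn_if)
      have "g j [^] (- s) \<in> tspan b J"
        using s spk[of j] ij gc tspan_inv[OF bJ(3), of "g j"] by (auto simp: int_pow_neg)
      moreover have "g i \<otimes> g j [^] s \<in> tspan b J" using sp ij by (auto simp: g'_def)
      moreover have "g i = (g i \<otimes> g j [^] s) \<otimes> g j [^] (- s)"
        using gc by (simp add: m_assoc int_pow_neg)
      ultimately have "g i \<in> tspan b J" using tspan_mult[OF bJ(3)] by metis
      then have "\<forall>k\<in>I. g k \<in> tspan b J" using spk by blast
      then show ?thesis unfolding goal_def using bJ by blast
    qed
  qed
  show ?case
  proof (cases "indep g I")
    case True
    then show ?thesis using fin psubset.prems generator_in_tspan
      by (intro exI[of _ g] exI[of _ I]) auto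
  next
    case False
    then show ?thesis using rel[OF psubset.prems] unfolding indep_def goal_def by blast
  qed
qed

end

section \<open>Lifts of differences\<close>

context wound_group
begin

text \<open>If \<open>x\<close> were not in the cone, then \<open>- (n - 1) x\<close> would be, and
  adding \<open>n x\<close> would give \<open>x\<close> back.\<close>

lemma nn_pow_iff:
  assumes x: "x \<in> carrier G" and n: "n > 0"
  shows "nn (x [^] (n::nat)) \<longleftrightarrow> nn x"
proof
  assume *: "nn (x [^] n)"
  show "nn x"
  proof (rule ccontr)
    assume "\<not> nn x"
    then have "nn (inv x [^] (n - 1))" using nn_total[OF x] nn_pow[of "inv x"] x by simp
    then have "nn (x [^] n \<otimes> inv x [^] (n - 1))" using * nn_mult x by simp
    moreover have "x [^] n = x \<otimes> x [^] (n - 1)" using n x nat_pow_Suc2[OF x, of "n - 1"] by simp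
    ultimately have "nn x" using x by (simp add: nat_pow_inv m_assoc)
    then show False using \<open>\<not> nn x\<close> by simp
  qed
qed (use nn_pow x in blast)

lemma nn_torsion: "t \<in> torsion \<Longrightarrow> nn t"
  by (erule torsionE) (metis nn_one nn_pow_iff)

lemma nn_torsion_mult:
  assumes "t \<in> torsion" "x \<in> carrier G"
  shows "nn (t \<otimes> x) \<longleftrightarrow> nn x"
proof
  assume "nn (t \<otimes> x)"
  then have "nn (inv t \<otimes> (t \<otimes> x))" using assms nn_torsion[OF torsion_inv] nn_mult by simp
  then show "nn x" using assms by (simp add: m_assoc[symmetric])
qed (use assms nn_torsion nn_mult in simp)

text \<open>Torsion elements are units of the cone, so two of them with the same angle differ by a
  unit of angle 0, that is, by the identity. Torsion is thereby reduced to sets of roots of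
  unity.\<close>

lemma torsion_inj:
  assumes "s \<in> torsion" "t \<in> torsion" "w s = w t"
  shows "s = t"
proof -
  have "inv s \<otimes> t \<in> torsion" using assms by (intro torsion_mult torsion_inv)
  moreover have "w (inv s \<otimes> t) = 1" using assms w_nonzero[of t] by (simp add: w_mult w_inv)
  ultimately have "inv s \<otimes> t = \<one>" using w_nn_inj nn_torsion torsion_inv by simp
  then show ?thesis using inv_mult_eq_one_iff[of s t] assms by simp
qed

lemma above_torsion: "t \<in> torsion \<Longrightarrow> above G w nn d t \<longleftrightarrow> cis d = w t \<and> 0 < d"
  using nn_torsion[OF torsion_inv] by (auto simp: above_def)

lemma w_pow: "x \<in> carrier G \<Longrightarrow> w (x [^] n) = w x ^ n" for n :: nat
  by (induction n) (auto simp: w_mult)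

lemma w_int_pow:
  fixes c :: int
  assumes "x \<in> carrier G" "w x = cis d"
  shows "w (x [^] c) = cis (d * of_int c)"
proof (cases "0 \<le> c")
  case True
  then show ?thesis using assms w_pow[of x "nat c"] int_pow_int[of G x "nat c"]
    by (simp add: Complex.DeMoivre mult.commute)
next
  case False
  define n where "n = nat (- c)"
  have n: "c = - int n" using False by (simp add: n_def)
  have "x [^] c = inv (x [^] n)" unfolding n using int_pow_neg_int assms by blast
  then show ?thesis using assms by (simp add: n w_inv w_pow Complex.DeMoivre mult.commute)
qed

lemma w_diff:
  assumes "x \<in> carrier G" "y \<in> carrier G" "w x = cis a" "w y = cis b"
  shows "w (inv x \<otimes> y) = cis (b - a + 2 * pi * of_int n)"
proof -
  have "cis (b - a + 2 * pi * of_int n) = cis (b - a)" by (subst cis_eq_iff) blast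
  then show ?thesis
    using assms by (simp add: w_mult w_inv cis_divide[symmetric] divide_inverse mult.commute)
qed

lemma w_comb:
  assumes "finite I" "b \<in> I \<rightarrow> carrier G" "\<And>i. i \<in> I \<Longrightarrow> w (b i) = cis (\<alpha> i)"
  shows "w (comb b I v) = cis (\<Sum>i\<in>I. \<alpha> i * of_int (v i))"
  using assms
proof (induction I)
  case empty then show ?case by (simp add: comb_def)
next
  case (insert i I)
  then show ?case by (simp add: comb_insert w_mult w_int_pow[of _ "\<alpha> i"] Pi_iff cis_mult[symmetric])
qed

text \<open>With lifts \<open>a\<close>, \<open>b\<close>, \<open>c\<close> fixed, the real lifts of
  the differences become integer numbers of turns, and the total \<open>2 * pi\<close> becomes the
  total 1.\<close>

lemma cyc_iff_lifts:
  assumes xyz: "x \<in> carrier G" "y \<in> carrier G" "z \<in> carrier G"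
    and abc: "w x = cis a" "w y = cis b" "w z = cis c"
  shows "cyc G x y z \<longleftrightarrow> (\<exists>l m n::int. l + m + n = 1 \<and> above G w nn (b - a + 2 * pi * of_int l) (inv x \<otimes> y)
    \<and> above G w nn (c - b + 2 * pi * of_int m) (inv y \<otimes> z) \<and> above G w nn (a - c + 2 * pi * of_int n) (inv z \<otimes> x))"
    (is "_ \<longleftrightarrow> ?R")
proof -
  have lift: "\<exists>n::int. d = v - u + 2 * pi * of_int n"
    if "above G w nn d (inv s \<otimes> t)" "s \<in> carrier G" "t \<in> carrier G" "w s = cis u" "w t = cis v" for d s t u v
  proof -
    have "cis d = cis (v - u)" using that by (simp add: above_def w_mult w_inv cis_divide[symmetric] divide_inverse mult.commute)
    then show ?thesis by (simp add: cis_eq_iff)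
  qed
  show ?thesis
  proof
    assume "cyc G x y z"
    then obtain d1 d2 d3 where d: "d1 + d2 + d3 = 2 * pi" "above G w nn d1 (inv x \<otimes> y)"
        "above G w nn d2 (inv y \<otimes> z)" "above G w nn d3 (inv z \<otimes> x)"
      using cyc_iff[OF xyz] by blast
    obtain l m n :: int where lmn: "d1 = b - a + 2 * pi * of_int l" "d2 = c - b + 2 * pi * of_int m"
        "d3 = a - c + 2 * pi * of_int n"
      using lift d xyz abc by meson
    have "2 * pi * of_int (l + m + n) = 2 * pi * of_int 1" using d lmn by (simp add: algebra_simps)
    then have "l + m + n = 1" by (simp only: mult_cancel_left of_int_eq_iff) simp
    then show ?R using d lmn by blast
  next
    assume ?R
    then obtain l m n :: int where lmn: "l + m + n = 1" "above G w nn (b - a + 2 * pi * of_int l) (inv x \<otimes> y)"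
        "above G w nn (c - b + 2 * pi * of_int m) (inv y \<otimes> z)" "above G w nn (a - c + 2 * pi * of_int n) (inv z \<otimes> x)"
      by blast
    have "(b - a + 2 * pi * of_int l) + (c - b + 2 * pi * of_int m) + (a - c + 2 * pi * of_int n) = 2 * pi * of_int (l + m + n)"
      by (simp add: algebra_simps)
    also have "\<dots> = 2 * pi" using lmn by simp
    finally show "cyc G x y z" using cyc_iff[OF xyz] lmn by blast
  qed
qed

text \<open>The two lifts are opposite; if neither is lexicographically positive, the lift is 0 and
  the difference is a unit of the cone. Equality thus becomes a condition on \<open>above\<close>,
  like the cyclic relation, so one transfer of signs covers both kinds of atoms.\<close>

lemma eq_iff_lifts:
  assumes xy: "x \<in> carrier G" "y \<in> carrier G" and ab: "w x = cis a" "w y = cis b"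
  shows "x = y \<longleftrightarrow> (\<exists>n::int. \<not> above G w nn (b - a + 2 * pi * of_int n) (inv x \<otimes> y)
    \<and> \<not> above G w nn (a - b + 2 * pi * of_int (- n)) (inv y \<otimes> x))" (is "_ \<longleftrightarrow> ?R")
proof
  assume e: "x = y"
  then have "cis a = cis b" using ab by simp
  then obtain n :: int where "a = b + 2 * pi * of_int n" by (auto simp: cis_eq_iff)
  then have "b - a + 2 * pi * of_int n = 0" "a - b + 2 * pi * of_int (- n) = 0" by auto
  moreover have "\<not> above G w nn 0 \<one>" by (simp add: above_def)
  ultimately show ?R using e xy by (intro exI[of _ n]) (simp only: l_inv simp_thms)
next
  assume ?R
  then obtain n :: int where n: "\<not> above G w nn (b - a + 2 * pi * of_int n) (inv x \<otimes> y)"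
      "\<not> above G w nn (a - b + 2 * pi * of_int (- n)) (inv y \<otimes> x)" by blast
  define d where "d = b - a + 2 * pi * of_int n"
  have d': "a - b + 2 * pi * of_int (- n) = - d" by (simp add: d_def)
  have w: "w (inv x \<otimes> y) = cis d" "w (inv y \<otimes> x) = cis (- d)"
    using w_diff[OF xy ab, of n] w_diff[OF xy(2,1) ab(2,1), of "- n"] by (simp_all only: d' d_def[symmetric])
  have i: "inv (inv x \<otimes> y) = inv y \<otimes> x" "inv (inv y \<otimes> x) = inv x \<otimes> y"
    using xy by (simp_all add: inv_mult_group)
  have "d = 0" "nn (inv y \<otimes> x)" "nn (inv x \<otimes> y)"
    using n unfolding d_def[symmetric] d' above_def w i by auto
  then have "inv x \<otimes> y = \<one>" using w_nn_inj[of "inv x \<otimes> y"] w i xy by simp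
  then show "x = y" using inv_mult_eq_one_iff xy by blast
qed

text \<open>By the pigeonhole principle two distinct angles are closer than \<open>\<delta>\<close>,
  so some difference has a lift \<open>e\<close> between 0 and \<open>\<delta>\<close>; its
  multiples come within \<open>e\<close> of every real number.\<close>

lemma winding_dense:
  assumes inf: "infinite (w ` carrier G)" and \<delta>: "0 < \<delta>"
  shows "\<exists>x\<in>carrier G. \<exists>\<beta>. w x = cis \<beta> \<and> \<bar>\<beta> - \<gamma>\<bar> < \<delta>"
proof -
  have "\<exists>e x. x \<in> carrier G \<and> w x = cis e \<and> 0 < e \<and> e < \<delta>"
  proof -
    define f where "f z = \<lfloor>Arg2pi z / \<delta>\<rfloor>" for z
    have "f ` (w ` carrier G) \<subseteq> {0..\<lfloor>2 * pi / \<delta>\<rfloor>}"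
    proof
      fix k assume "k \<in> f ` (w ` carrier G)"
      then obtain z where "k = f z" by blast
      moreover have "0 \<le> Arg2pi z" "Arg2pi z \<le> 2 * pi" using Arg2pi[of z] by auto
      ultimately show "k \<in> {0..\<lfloor>2 * pi / \<delta>\<rfloor>}"
        using \<delta> by (auto simp: f_def intro!: floor_mono divide_right_mono)
    qed
    then have "finite (f ` (w ` carrier G))" using finite_subset by blast
    from pigeonhole_infinite[OF inf this] obtain z0 where z0: "z0 \<in> w ` carrier G"
      "infinite {z \<in> w ` carrier G. f z = f z0}" by blast
    then have "infinite ({z \<in> w ` carrier G. f z = f z0} - {z0})" by simp
    then obtain z1 where "z1 \<in> {z \<in> w ` carrier G. f z = f z0} - {z0}" by (metis finite.emptyI ex_in_conv)
    then obtain x y where xy: "x \<in> carrier G" "y \<in> carrier G" "w x = z0" "w y = z1" "z1 \<noteq> z0" "f z1 = f z0"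
      using z0 by auto
    have cz: "z0 = cis (Arg2pi z0)" "z1 = cis (Arg2pi z1)" using xy w_norm by (metis cis_Arg2pi)+
    have close: "\<bar>Arg2pi z1 - Arg2pi z0\<bar> < \<delta>"
    proof -
      have "Arg2pi z1 / \<delta> < f z1 + 1" "f z1 \<le> Arg2pi z1 / \<delta>" "Arg2pi z0 / \<delta> < f z1 + 1" "f z1 \<le> Arg2pi z0 / \<delta>"
        using xy(6) unfolding f_def by linarith+
      then have "\<bar>Arg2pi z1 / \<delta> - Arg2pi z0 / \<delta>\<bar> < 1" by linarith
      then show ?thesis using \<delta> by (simp add: diff_divide_distrib[symmetric])
    qed
    have ne: "Arg2pi z1 \<noteq> Arg2pi z0" using cz xy by metis
    have q: "w (inv x \<otimes> y) = cis (Arg2pi z1 - Arg2pi z0)" "w (inv y \<otimes> x) = cis (Arg2pi z0 - Arg2pi z1)"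
      using xy cz by (simp_all add: w_mult w_inv cis_divide[symmetric] divide_inverse mult.commute)
    consider "Arg2pi z1 > Arg2pi z0" | "Arg2pi z1 < Arg2pi z0" using ne by linarith
    then show ?thesis
    proof cases
      case 1 then show ?thesis using q close xy by (meson abs_less_iff diff_gt_0_iff_gt inv_closed m_closed)
    next
      case 2 then show ?thesis using q close xy
        by (intro exI[of _ "Arg2pi z0 - Arg2pi z1"] exI[of _ "inv y \<otimes> x"]) auto
    qed
  qed
  then obtain e x where ex: "x \<in> carrier G" "w x = cis e" "0 < e" "e < \<delta>" by blast
  define k where "k = \<lfloor>\<gamma> / e\<rfloor>"
  have "\<gamma> / e < k + 1" "k \<le> \<gamma> / e" by (auto simp: k_def)
  then have "\<gamma> < (k + 1) * e" "k * e \<le> \<gamma>" using ex by (simp_all add: field_simps)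
  then have "\<bar>e * k - \<gamma>\<bar> < \<delta>" using ex by (simp add: algebra_simps)
  then show ?thesis using w_int_pow[OF ex(1,2), of k] ex(1) by blast
qed

end

section \<open>Transferring signs to another group\<close>

context wound_group
begin

lemma above_tcomb:
  assumes "t \<in> torsion" "x \<in> carrier G" "w (t \<otimes> x) = cis d"
  shows "above G w nn d (t \<otimes> x) \<longleftrightarrow> 0 < d \<or> d = 0 \<and> \<not> nn (inv x)"
proof -
  have "inv (t \<otimes> x) = inv t \<otimes> inv x" using assms by (simp add: inv_mult)
  then show ?thesis using assms nn_torsion_mult[OF torsion_inv, of t "inv x"] by (simp add: above_def)
qed

end

text \<open>Replacing the generators \<open>b\<close> with angles \<open>\<alpha>\<close> by the generators \<open>b'\<close> with angles \<open>\<beta>\<close>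
  preserves the signs of finitely many lifts; here \<open>(q, t, c)\<close> stands for the lift of \<open>t + \<Sum> c\<^sub>j b\<^sub>j\<close>
  that has angle \<open>q + \<Sum> c\<^sub>j \<alpha>\<^sub>j\<close>.\<close>

definition signs_match where
  "signs_match G w nn G' w' nn' \<tau> J b \<alpha> b' \<beta> D \<longleftrightarrow> (\<forall>(q, t, c)\<in>D. \<forall>n::int.
     above G w nn (q + (\<Sum>j\<in>J. \<alpha> j * of_int (c j)) + 2 * pi * of_int n) (t \<otimes>\<^bsub>G\<^esub> comm_group.comb G b J c)
     \<longleftrightarrow> above G' w' nn' (q + (\<Sum>j\<in>J. \<beta> j * of_int (c j)) + 2 * pi * of_int n)
          (\<tau> t \<otimes>\<^bsub>G'\<^esub> comm_group.comb G' b' J c))"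

text \<open>Only angles are prescribed for \<open>\<tau>\<close>. As torsion elements are determined
  by their angles, \<open>\<tau>\<close> is automatically a homomorphism.\<close>

locale wound_pair = G: wound_group G w nn + G': wound_group G' w' nn'
  for G :: "'a cog" and w nn and G' :: "'b cog" and w' nn' +
  fixes \<tau> :: "'a \<Rightarrow> 'b"
  assumes \<tau>: "t \<in> G.torsion \<Longrightarrow> \<tau> t \<in> G'.torsion" "t \<in> G.torsion \<Longrightarrow> w' (\<tau> t) = w t"
begin

lemma \<tau>_mult: "s \<in> G.torsion \<Longrightarrow> t \<in> G.torsion \<Longrightarrow> \<tau> (s \<otimes>\<^bsub>G\<^esub> t) = \<tau> s \<otimes>\<^bsub>G'\<^esub> \<tau> t"
  using \<tau> G.torsion_mult G'.torsion_mult by (intro G'.torsion_inj) (simp_all add: G.w_mult G'.w_mult)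

lemma \<tau>_one: "\<tau> \<one>\<^bsub>G\<^esub> = \<one>\<^bsub>G'\<^esub>"
  using \<tau> by (intro G'.torsion_inj) simp_all

lemma \<tau>_inv: "t \<in> G.torsion \<Longrightarrow> \<tau> (inv\<^bsub>G\<^esub> t) = inv\<^bsub>G'\<^esub> (\<tau> t)"
  using \<tau> G.torsion_inv G'.torsion_inv by (intro G'.torsion_inj) (simp_all add: G.w_inv G'.w_inv)

text \<open>Angles are kept, so the cone matters only for lifts equal to 0. Each generator goes to a
  multiple \<open>a j\<close> of \<open>g\<close>: the part \<open>k j\<close> yields its angle, the
  added multiple of \<open>n\<close> does not alter it, and the large factor \<open>M\<close> lets
  \<open>h\<close> decide the sign.\<close>

lemma ex_match_winding_finite:
  fixes J :: "'i set"
  assumes J: "finite J" and b: "b \<in> J \<rightarrow> carrier G" and ind: "G.indep b J"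
    and \<alpha>: "\<And>j. j \<in> J \<Longrightarrow> w (b j) = cis (\<alpha> j)"
    and D: "finite D" "\<And>q t c. (q, t, c) \<in> D \<Longrightarrow> t \<in> G.torsion \<and> w t = cis q"
    and n: "n > 0" and wn: "\<And>x. x \<in> carrier G \<Longrightarrow> w x ^ n = 1"
    and g: "g \<in> carrier G'" "w' g = cis (2 * pi / n)" "\<not> nn' (inv\<^bsub>G'\<^esub> g)"
  shows "\<exists>b'. b' \<in> J \<rightarrow> carrier G' \<and> (\<forall>j\<in>J. w' (b' j) = cis (\<alpha> j)) \<and>
    signs_match G w nn G' w' nn' \<tau> J b \<alpha> b' \<alpha> D"
proof -
  \<comment> \<open>\<open>ex_functional_matching_cone\<close> wants vectors supported in
    \<open>J\<close>. Negatives enter \<open>S\<close> because units of the cone must be told from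
    strictly positive elements.\<close>
  define cut where "cut c = (\<lambda>j. if j \<in> J then c j else 0)" for c :: "'i \<Rightarrow> int"
  define S where "S = (\<lambda>(q, t, c). cut c) ` D \<union> (\<lambda>(q, t, c). cut (\<lambda>j. - c j)) ` D"
  have "finite S" using D by (simp add: S_def)
  have "\<exists>h::'i \<Rightarrow> int. \<forall>s\<in>S. nn (G.comb b J s) \<longleftrightarrow> 0 \<le> (\<Sum>j\<in>J. h j * s j)"
  proof (rule ex_functional_matching_cone[OF _ _ J \<open>finite S\<close>])
    show "nn (G.comb b J v) \<or> nn (G.comb b J (\<lambda>i. - v i))" for v
      using G.nn_total b by (simp add: G.comb_neg)
    show "nn (G.comb b J (\<lambda>i. v i + u i))" if "nn (G.comb b J v)" "nn (G.comb b J u)" for v u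
      using that G.nn_mult b by (simp add: G.comb_add)
  qed (auto simp: S_def cut_def)
  then obtain h :: "'i \<Rightarrow> int" where h: "\<And>s. s \<in> S \<Longrightarrow> nn (G.comb b J s) \<longleftrightarrow> 0 \<le> (\<Sum>j\<in>J. h j * s j)" by blast
  define H where "H c = (\<Sum>j\<in>J. h j * c j)" for c
  have cut: "G.comb b J (cut c) = G.comb b J c" "(\<Sum>j\<in>J. h j * cut c j) = H c" for c
  proof -
    show "G.comb b J (cut c) = G.comb b J c"
      by (rule G.comb_cong) (use b in \<open>auto simp: cut_def\<close>)
    show "(\<Sum>j\<in>J. h j * cut c j) = H c"
      unfolding H_def by (rule sum.cong) (auto simp: cut_def)
  qed
  have h1: "nn (G.comb b J c) \<longleftrightarrow> 0 \<le> H c" "nn (inv\<^bsub>G\<^esub> (G.comb b J c)) \<longleftrightarrow> H c \<le> 0"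
    if "(q, t, c) \<in> D" for q t c
  proof -
    have "cut c \<in> S" "cut (\<lambda>j. - c j) \<in> S" using that by (force simp: S_def)+
    from this[THEN h] show "nn (G.comb b J c) \<longleftrightarrow> 0 \<le> H c" "nn (inv\<^bsub>G\<^esub> (G.comb b J c)) \<longleftrightarrow> H c \<le> 0"
      unfolding cut G.comb_neg[OF b, symmetric] by (simp_all add: H_def sum_negf)
  qed
  have "\<exists>k::int. \<alpha> j = 2 * pi * k / n" if "j \<in> J" for j
  proof -
    have "cis (real n * \<alpha> j) = 1" using wn[of "b j"] \<alpha>[OF that] b that by (auto simp: Complex.DeMoivre)
    then obtain k :: int where "real n * \<alpha> j = 2 * pi * of_int k" using cis_eq_iff[of "real n * \<alpha> j" 0] by auto
    then show ?thesis using n by (intro exI[of _ k]) (simp add: field_simps)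
  qed
  then obtain k :: "'i \<Rightarrow> int" where k: "\<And>j. j \<in> J \<Longrightarrow> \<alpha> j = 2 * pi * k j / n" by metis
  \<comment> \<open>Exceeds the \<open>k\<close>-part of every vector in \<open>D\<close>, so
    \<open>n * M\<close> times a nonzero integer \<open>H c\<close> dominates it.\<close>
  define M where "M = 1 + (\<Sum>(q, t, c)\<in>D. \<Sum>j\<in>J. \<bar>k j * c j\<bar>)"
  have M: "\<bar>\<Sum>j\<in>J. k j * c j\<bar> < M" if "(q, t, c) \<in> D" for q t c
  proof -
    have "\<bar>\<Sum>j\<in>J. k j * c j\<bar> \<le> (\<Sum>j\<in>J. \<bar>k j * c j\<bar>)" by (rule sum_abs)
    also have "\<dots> \<le> (\<Sum>(q, t, c)\<in>D. \<Sum>j\<in>J. \<bar>k j * c j\<bar>)"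
      using member_le_sum[OF that, of "\<lambda>(q, t, c). \<Sum>j\<in>J. \<bar>k j * c j\<bar>"] D(1) by (auto intro: sum_nonneg)
    finally show ?thesis by (simp add: M_def)
  qed
  define a where "a j = k j + int n * (M * h j)" for j
  define b' where "b' j = g [^]\<^bsub>G'\<^esub> a j" for j
  have b': "b' \<in> J \<rightarrow> carrier G'" using g by (auto simp: b'_def)
  have wb': "w' (b' j) = cis (\<alpha> j)" if "j \<in> J" for j
  proof -
    have "w' (b' j) = cis (2 * pi / n * of_int (a j))" unfolding b'_def using g G'.w_int_pow by blast
    also have "2 * pi / n * of_int (a j) = \<alpha> j + 2 * pi * of_int (M * h j)"
      using n by (simp add: a_def k[OF that] field_simps)
    also have "cis \<dots> = cis (\<alpha> j)" by (subst cis_eq_iff) blast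
    finally show ?thesis .
  qed
  have comb': "G'.comb b' J c = g [^]\<^bsub>G'\<^esub> (\<Sum>j\<in>J. a j * c j)" for c
    using J
  proof (induction J)
    case empty then show ?case by (simp add: G'.comb_def)
  next
    case (insert i I)
    have "b' \<in> insert i I \<rightarrow> carrier G'" using g by (auto simp: b'_def)
    then show ?case using insert g by (simp add: G'.comb_insert b'_def G'.int_pow_pow G'.int_pow_mult)
  qed
  have gpow: "nn' (inv\<^bsub>G'\<^esub> (g [^]\<^bsub>G'\<^esub> e)) \<longleftrightarrow> e \<le> 0" for e :: int
  proof (cases "e \<le> 0")
    case True
    define m where "m = nat (- e)"
    have e: "e = - int m" using True by (simp add: m_def)
    have "nn' g" using G'.nn_total g by blast
    moreover have "inv\<^bsub>G'\<^esub> (g [^]\<^bsub>G'\<^esub> e) = g [^]\<^bsub>G'\<^esub> m"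
      unfolding e using g by (simp add: G'.int_pow_neg_int)
    ultimately show ?thesis using True G'.nn_pow[OF g(1)] by simp
  next
    case False
    define m where "m = nat e"
    have e: "e = int m" "m > 0" using False by (simp_all add: m_def)
    have "inv\<^bsub>G'\<^esub> (g [^]\<^bsub>G'\<^esub> e) = (inv\<^bsub>G'\<^esub> g) [^]\<^bsub>G'\<^esub> m"
      unfolding e using g by (simp add: int_pow_int G'.nat_pow_inv)
    then show ?thesis using False e g G'.nn_pow_iff[of "inv\<^bsub>G'\<^esub> g" m] by simp
  qed
  have "above G w nn (q + (\<Sum>j\<in>J. \<alpha> j * of_int (c j)) + 2 * pi * of_int m) (t \<otimes>\<^bsub>G\<^esub> G.comb b J c)
     \<longleftrightarrow> above G' w' nn' (q + (\<Sum>j\<in>J. \<alpha> j * of_int (c j)) + 2 * pi * of_int m) (\<tau> t \<otimes>\<^bsub>G'\<^esub> G'.comb b' J c)"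
    if d: "(q, t, c) \<in> D" for q t c and m :: int
  proof -
    define A where "A = q + (\<Sum>j\<in>J. \<alpha> j * of_int (c j)) + 2 * pi * of_int m"
    have t: "t \<in> G.torsion" "w t = cis q" using D(2)[OF d] by auto
    have cA: "cis A = cis q * cis (\<Sum>j\<in>J. \<alpha> j * of_int (c j))" unfolding A_def cis_mult by (subst cis_eq_iff) blast
    have wA: "w (t \<otimes>\<^bsub>G\<^esub> G.comb b J c) = cis A" "w' (\<tau> t \<otimes>\<^bsub>G'\<^esub> G'.comb b' J c) = cis A"
      using t b b' \<tau>[OF t(1)] G.w_comb[OF J b \<alpha>] G'.w_comb[OF J b' wb'] by (simp_all add: G.w_mult G'.w_mult cA)
    have "nn (inv\<^bsub>G\<^esub> (G.comb b J c)) \<longleftrightarrow> nn' (inv\<^bsub>G'\<^esub> (G'.comb b' J c))" if "A = 0"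
    proof -
      have ac: "(\<Sum>j\<in>J. a j * c j) = (\<Sum>j\<in>J. k j * c j) + int n * M * H c"
        by (simp add: a_def H_def sum.distrib sum_distrib_left algebra_simps)
      have big: "M * \<bar>H c\<bar> \<le> int n * M * \<bar>H c\<bar>"
        using n M[OF d] mult_right_mono[of 1 "int n" M] by (intro mult_right_mono) auto
      consider "H c = 0" | "H c > 0" | "H c < 0" by linarith
      then have "(\<Sum>j\<in>J. a j * c j) \<le> 0 \<longleftrightarrow> H c \<le> 0"
      proof cases
        \<comment> \<open>Here \<open>c\<close> gives a unit of the cone and the whole element has
          angle 0, so it is the identity and its free part is torsion; independence kills
          \<open>c\<close>, and with it the \<open>k\<close>-part.\<close>
        case 1
        then have "nn (inv\<^bsub>G\<^esub> (G.comb b J c))" "nn (G.comb b J c)" using h1[OF d] by auto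
        then have "t \<otimes>\<^bsub>G\<^esub> G.comb b J c = \<one>\<^bsub>G\<^esub>"
          using t b wA(1) \<open>A = 0\<close> G.nn_torsion_mult[OF t(1)] G.nn_torsion_mult[OF G.torsion_inv[OF t(1)]]
          by (intro G.w_nn_inj) (simp_all add: G.inv_mult)
        then have "G.comb b J c = inv\<^bsub>G\<^esub> t" using t b G.inv_unique' by (metis G.comb_closed G.inv_equality G.m_comm G.torsion_closed G.inv_inv)
        then have "\<forall>j\<in>J. c j = 0" using ind G.torsion_inv[OF t(1)] unfolding G.indep_def by metis
        then show ?thesis using 1 by simp
      next
        case 2
        then have "M \<le> M * \<bar>H c\<bar>"
          using M[OF d] mult_left_mono[of 1 "\<bar>H c\<bar>" M] by simp
        then show ?thesis using 2 M[OF d] big ac by auto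
      next
        case 3
        then have "M \<le> M * \<bar>H c\<bar>"
          using M[OF d] mult_left_mono[of 1 "\<bar>H c\<bar>" M] by simp
        then show ?thesis using 3 M[OF d] big ac by auto
      qed
      then show ?thesis unfolding h1[OF d] comb' gpow by simp
    qed
    then show ?thesis unfolding A_def[symmetric]
      using G.above_tcomb[OF t(1) _ wA(1)] G'.above_tcomb[OF \<tau>(1)[OF t(1)] _ wA(2)] b b' by auto
  qed
  then show ?thesis unfolding signs_match_def using b' wb' by (intro exI[of _ b']) auto
qed

end

lemma ex_lower_bound_nonzero:
  fixes f :: "'a \<Rightarrow> real"
  assumes "finite A"
  shows "\<exists>\<epsilon>>0. \<forall>x\<in>A. f x \<noteq> 0 \<longrightarrow> \<epsilon> \<le> \<bar>f x\<bar>"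
proof -
  define B where "B = insert 1 ((\<lambda>x. \<bar>f x\<bar>) ` {x \<in> A. f x \<noteq> 0})"
  have "finite B" "B \<noteq> {}" using assms by (auto simp: B_def)
  then show ?thesis by (intro exI[of _ "Min B"]) (auto simp: B_def)
qed

text \<open>A single cone \<open>P\<close> on integer vectors combines angle and cone
  lexicographically; the coordinate \<open>None\<close> counts full turns. An integer functional
  with the same signs, normalised to \<open>2 * pi\<close> at \<open>None\<close>, replaces the pair
  by angles \<open>\<gamma>\<close> alone. Independence keeps lifts with a nonzero free part away
  from 0, so angles \<open>\<beta>\<close> of \<open>G'\<close> close to \<open>\<gamma>\<close>
  have the same signs.\<close>

lemma (in wound_pair) ex_match_winding_infinite:
  fixes J :: "'i set"
  assumes J: "finite J" and b: "b \<in> J \<rightarrow> carrier G" and ind: "G.indep b J"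
    and \<alpha>: "\<And>j. j \<in> J \<Longrightarrow> w (b j) = cis (\<alpha> j)"
    and D: "finite D" "\<And>q t c. (q, t, c) \<in> D \<Longrightarrow> t \<in> G.torsion \<and> w t = cis q"
    and inf: "infinite (w' ` carrier G')"
  shows "\<exists>b' \<beta>. b' \<in> J \<rightarrow> carrier G' \<and> (\<forall>j\<in>J. w' (b' j) = cis (\<beta> j)) \<and>
    signs_match G w nn G' w' nn' \<tau> J b \<alpha> b' \<beta> D"
proof -
  define L where "L \<gamma> d = (case d of (q, t, c) \<Rightarrow> q + (\<Sum>j\<in>J. \<gamma> j * of_int (c j)))"
    for \<gamma> :: "'i \<Rightarrow> real" and d :: "real \<times> 'a \<times> ('i \<Rightarrow> int)"
  \<comment> \<open>Beyond \<open>N\<close> turns the sign of every lift is that of the number of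
    turns, so only finitely many shifts have to be matched.\<close>
  define N where "N = \<lceil>\<Sum>d\<in>D. \<bar>L \<alpha> d\<bar>\<rceil> + 1"
  have N: "\<bar>L \<alpha> d\<bar> < 2 * pi * N" if "d \<in> D" for d
  proof -
    have "\<bar>L \<alpha> d\<bar> \<le> (\<Sum>d\<in>D. \<bar>L \<alpha> d\<bar>)" using member_le_sum[OF that, of "\<lambda>d. \<bar>L \<alpha> d\<bar>"] D by auto
    also have "\<dots> < of_int N" by (simp add: N_def) linarith
    finally have "\<bar>L \<alpha> d\<bar> < N" .
    moreover have "real_of_int N \<le> 2 * pi * N" using calculation pi_gt3 by (simp add: mult_le_cancel_right1)
    ultimately show ?thesis by linarith
  qed
  \<comment> \<open>A torsion angle \<open>q\<close> is not an integer combination, but an exponent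
    \<open>m\<close> annihilating \<open>t\<close> makes \<open>m * q\<close> a whole number
    \<open>k\<close> of turns. Multiplying a lift by \<open>m\<close> preserves its sign, and so
    does the cone.\<close>
  have "\<exists>m k. \<forall>d\<in>D. 0 < m d \<and> (case d of (q, t, c) \<Rightarrow> t [^]\<^bsub>G\<^esub> m d = \<one>\<^bsub>G\<^esub> \<and> real (m d) * q = 2 * pi * of_int (k d))"
  proof -
    have "\<exists>m k. 0 < m \<and> (case d of (q, t, c) \<Rightarrow> t [^]\<^bsub>G\<^esub> (m::nat) = \<one>\<^bsub>G\<^esub> \<and> real m * q = 2 * pi * of_int k)" if "d \<in> D" for d
    proof -
      obtain q t c where d: "d = (q, t, c)" by (cases d)
      then have t: "t \<in> G.torsion" "w t = cis q" using D(2) that by auto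
      then obtain m :: nat where m: "m > 0" "t [^]\<^bsub>G\<^esub> m = \<one>\<^bsub>G\<^esub>" by (metis G.torsionE)
      then have "cis (real m * q) = cis 0" using G.w_pow[of t m] t by (simp add: Complex.DeMoivre)
      then obtain k :: int where "real m * q = 2 * pi * of_int k" unfolding cis_eq_iff by auto
      then show ?thesis using m d by auto
    qed
    then show ?thesis by metis
  qed
  then obtain m :: "_ \<Rightarrow> nat" and k :: "_ \<Rightarrow> int"
    where mk': "\<forall>d\<in>D. 0 < m d \<and> (case d of (q, t, c) \<Rightarrow> t [^]\<^bsub>G\<^esub> m d = \<one>\<^bsub>G\<^esub> \<and> real (m d) * q = 2 * pi * of_int (k d))"
    by blast
  have mk: "0 < m (q, t, c)" "t [^]\<^bsub>G\<^esub> m (q, t, c) = \<one>\<^bsub>G\<^esub>" "real (m (q, t, c)) * q = 2 * pi * of_int (k (q, t, c))"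
    if "(q, t, c) \<in> D" for q t c
    using bspec[OF mk' that] by auto
  define I where "I = insert None (Some ` J)"
  define vec where "vec d n = (\<lambda>i. case i of None \<Rightarrow> k d + int (m d) * n
      | Some j \<Rightarrow> if j \<in> J then int (m d) * snd (snd d) j else 0)" for d n
  define unit where "unit = (\<lambda>i::'i option. if i = None then 1 else (0::int))"
  define neg where "neg v = (\<lambda>i. - v i)" for v :: "'i option \<Rightarrow> int"
  \<comment> \<open>\<open>unit\<close> is one full turn; its presence in \<open>S\<close> forces
    the functional to be positive at \<open>None\<close>, so that it can be normalised.\<close>
  define S where "S = insert unit ((\<lambda>(d, n). vec d n) ` (D \<times> {- N..N}))"
  define ang where "ang v = (\<Sum>j\<in>J. \<alpha> j * of_int (v (Some j))) + 2 * pi * of_int (v None)" for v :: "'i option \<Rightarrow> int"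
  define cmb where "cmb v = G.comb b J (\<lambda>j. v (Some j))" for v
  define P where "P v \<longleftrightarrow> 0 < ang v \<or> ang v = 0 \<and> nn (cmb v)" for v
  have ang_neg: "ang (neg v) = - ang v" for v by (simp add: ang_def neg_def sum_negf)
  have cmb_neg: "cmb (neg v) = inv\<^bsub>G\<^esub> (cmb v)" for v unfolding cmb_def neg_def by (rule G.comb_neg[OF b])
  have cmbc: "cmb v \<in> carrier G" for v using b by (simp add: cmb_def)
  have tot: "P v \<or> P (neg v)" for v
    using G.nn_total[OF cmbc, of v] by (auto simp: P_def ang_neg cmb_neg)
  have "\<exists>h::'i option \<Rightarrow> int. \<forall>s\<in>S \<union> neg ` S. P s \<longleftrightarrow> 0 \<le> (\<Sum>i\<in>I. h i * s i)"
  proof (rule ex_functional_matching_cone)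
    show "P v \<or> P (\<lambda>i. - v i)" for v using tot[of v] by (simp add: neg_def)
    show "P (\<lambda>i. v i + u i)" if "P v" "P u" for v u
    proof -
      have "ang (\<lambda>i. v i + u i) = ang v + ang u" by (simp add: ang_def sum.distrib algebra_simps)
      moreover have "cmb (\<lambda>i. v i + u i) = cmb v \<otimes>\<^bsub>G\<^esub> cmb u" unfolding cmb_def by (rule G.comb_add[OF b])
      ultimately show ?thesis using that G.nn_mult[OF cmbc cmbc] unfolding P_def by auto
    qed
    show "finite I" "finite (S \<union> neg ` S)" using J D by (auto simp: I_def S_def)
    show "s i = 0" if "s \<in> S \<union> neg ` S" "i \<notin> I" for s i
      using that by (auto simp: S_def I_def neg_def unit_def vec_def split: option.splits)
  qed
  then obtain h :: "'i option \<Rightarrow> int" where h: "\<And>s. s \<in> S \<union> neg ` S \<Longrightarrow> P s \<longleftrightarrow> 0 \<le> (\<Sum>i\<in>I. h i * s i)" by blast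
  define H where "H s = (\<Sum>i\<in>I. h i * s i)" for s
  have hP: "P s \<longleftrightarrow> 0 \<le> H s" "P (neg s) \<longleftrightarrow> H s \<le> 0" if "s \<in> S" for s
    using h[of s] h[of "neg s"] that by (auto simp: H_def neg_def sum_negf)
  have H_split: "H s = h None * s None + (\<Sum>j\<in>J. h (Some j) * s (Some j))" for s
    using J by (simp add: H_def I_def sum.reindex)
  have "\<not> P (neg unit)" by (simp add: P_def ang_def neg_def unit_def)
  then have h0: "0 < h None" using hP[of unit] by (simp add: S_def H_split unit_def)
  define \<gamma> where "\<gamma> j = 2 * pi * h (Some j) / h None" for j
  have H_vec: "of_int (H (vec d n)) * (2 * pi) = of_int (h None) * (real (m d) * (L \<gamma> d + 2 * pi * of_int n))"
    if "d \<in> D" for d n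
  proof -
    obtain q t c where d: "d = (q, t, c)" by (cases d)
    have "(\<Sum>j\<in>J. h (Some j) * vec d n (Some j)) = (\<Sum>j\<in>J. h (Some j) * (int (m d) * c j))"
      by (rule sum.cong) (auto simp: vec_def d)
    then have "H (vec d n) = h None * (k d + int (m d) * n) + (\<Sum>j\<in>J. h (Some j) * (int (m d) * c j))"
      by (simp add: H_split vec_def)
    moreover have "of_int (h None) * (\<Sum>j\<in>J. \<gamma> j * of_int (c j)) = 2 * pi * (\<Sum>j\<in>J. of_int (h (Some j)) * of_int (c j))"
      using h0 by (simp add: \<gamma>_def sum_distrib_left field_simps)
    moreover have "real (m d) * q = 2 * pi * of_int (k d)" using mk(3) that d by simp
    moreover have "(\<Sum>j\<in>J. real_of_int (h (Some j)) * (real (m d) * of_int (c j))) = real (m d) * (\<Sum>j\<in>J. of_int (h (Some j)) * of_int (c j))"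
      by (simp add: sum_distrib_left algebra_simps)
    ultimately show ?thesis by (simp add: L_def d algebra_simps)
  qed
  have sgnH: "0 \<le> H (vec d n) \<longleftrightarrow> 0 \<le> L \<gamma> d + 2 * pi * of_int n" "H (vec d n) \<le> 0 \<longleftrightarrow> L \<gamma> d + 2 * pi * of_int n \<le> 0"
    if "d \<in> D" for d n
  proof -
    have "0 < m d" using that mk(1) by (cases d) auto
    then have "\<exists>K>0. of_int (H (vec d n)) * (2 * pi) = K * (L \<gamma> d + 2 * pi * of_int n)"
      using H_vec[OF that, of n] h0 by (intro exI[of _ "real_of_int (h None) * real (m d)"]) (simp add: mult.assoc)
    then obtain K where p: "0 < K" and e: "of_int (H (vec d n)) * (2 * pi) = K * (L \<gamma> d + 2 * pi * of_int n)"
      by blast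
    have "0 \<le> H (vec d n) \<longleftrightarrow> 0 \<le> of_int (H (vec d n)) * (2 * pi)"
      using pi_gt_zero by (auto simp: zero_le_mult_iff simp del: pi_gt_zero)
    also have "\<dots> \<longleftrightarrow> 0 \<le> L \<gamma> d + 2 * pi * of_int n" unfolding e using p by (simp only: zero_le_mult_iff) auto
    finally show "0 \<le> H (vec d n) \<longleftrightarrow> 0 \<le> L \<gamma> d + 2 * pi * of_int n" .
    have "H (vec d n) \<le> 0 \<longleftrightarrow> of_int (H (vec d n)) * (2 * pi) \<le> 0"
      using pi_gt_zero by (auto simp: mult_le_0_iff simp del: pi_gt_zero)
    also have "\<dots> \<longleftrightarrow> L \<gamma> d + 2 * pi * of_int n \<le> 0" unfolding e using p by (simp only: mult_le_0_iff) auto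
    finally show "H (vec d n) \<le> 0 \<longleftrightarrow> L \<gamma> d + 2 * pi * of_int n \<le> 0" .
  qed
  have Pvec: "P (vec d n) \<longleftrightarrow> 0 \<le> L \<gamma> d + 2 * pi * of_int n" "P (neg (vec d n)) \<longleftrightarrow> L \<gamma> d + 2 * pi * of_int n \<le> 0"
    if "d \<in> D" "n \<in> {- N..N}" for d n
  proof -
    have "vec d n \<in> S" using that by (auto simp: S_def)
    then show "P (vec d n) \<longleftrightarrow> 0 \<le> L \<gamma> d + 2 * pi * of_int n" "P (neg (vec d n)) \<longleftrightarrow> L \<gamma> d + 2 * pi * of_int n \<le> 0"
      using hP sgnH that by simp_all
  qed
  have cmb_vec: "cmb (vec (q, t, c) n) = G.comb b J c [^]\<^bsub>G\<^esub> m (q, t, c)" for q t c n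
    unfolding cmb_def G.comb_pow[OF b, symmetric] by (rule G.comb_cong) (use b in \<open>auto simp: vec_def\<close>)
  have ang_vec: "ang (vec d n) = real (m d) * (L \<alpha> d + 2 * pi * of_int n)" if "d \<in> D" for d n
  proof -
    obtain q t c where d: "d = (q, t, c)" by (cases d)
    have "(\<Sum>j\<in>J. \<alpha> j * of_int (vec d n (Some j))) = (\<Sum>j\<in>J. real (m d) * (\<alpha> j * of_int (c j)))"
      by (rule sum.cong) (auto simp: vec_def d)
    moreover have "real (m d) * q = 2 * pi * of_int (k d)" using mk(3) that d by simp
    ultimately show ?thesis by (simp add: ang_def L_def d sum_distrib_left vec_def algebra_simps)
  qed
  obtain \<epsilon> where \<epsilon>: "\<epsilon> > 0" "\<And>d n. d \<in> D \<Longrightarrow> n \<in> {- N..N} \<Longrightarrow> L \<gamma> d + 2 * pi * of_int n \<noteq> 0 \<Longrightarrow> \<epsilon> \<le> \<bar>L \<gamma> d + 2 * pi * of_int n\<bar>"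
    using ex_lower_bound_nonzero[of "D \<times> {- N..N}" "\<lambda>(d, n). L \<gamma> d + 2 * pi * of_int n"] D by auto
  \<comment> \<open>Bounds all coefficient sums, so an error below \<open>\<epsilon> / C\<close> in
    each generator changes a lift by less than \<open>\<epsilon>\<close>, a lower bound for the
    nonzero lifts in the window. The added 1 makes the bound strict and \<open>C\<close>
    positive.\<close>
  define C where "C = 1 + (\<Sum>(q, t, c)\<in>D. \<Sum>j\<in>J. \<bar>real_of_int (c j)\<bar>)"
  have C: "(\<Sum>j\<in>J. \<bar>real_of_int (c j)\<bar>) < C" if "(q, t, c) \<in> D" for q t c
    using member_le_sum[OF that, of "\<lambda>(q, t, c). \<Sum>j\<in>J. \<bar>real_of_int (c j)\<bar>"] D(1) by (auto simp: C_def intro: sum_nonneg)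
  have C1: "C \<ge> 1" unfolding C_def by (auto intro!: sum_nonneg)
  have "\<exists>x \<beta>. x \<in> carrier G' \<and> w' x = cis \<beta> \<and> \<bar>\<beta> - \<gamma> j\<bar> < \<epsilon> / C" for j
    using G'.winding_dense[OF inf, of "\<epsilon> / C" "\<gamma> j"] \<epsilon>(1) C1 by fastforce
  then obtain b' \<beta> where b'\<beta>: "\<And>j. b' j \<in> carrier G'" "\<And>j. w' (b' j) = cis (\<beta> j)" "\<And>j. \<bar>\<beta> j - \<gamma> j\<bar> < \<epsilon> / C"
    by metis
  have b': "b' \<in> J \<rightarrow> carrier G'" using b'\<beta> by auto
  have near: "\<bar>L \<beta> d - L \<gamma> d\<bar> < \<epsilon>" if "d \<in> D" for d
  proof -
    obtain q t c where d: "d = (q, t, c)" by (cases d)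
    have "L \<beta> d - L \<gamma> d = (\<Sum>j\<in>J. (\<beta> j - \<gamma> j) * of_int (c j))"
      by (simp add: L_def d sum_subtractf[symmetric] algebra_simps)
    also have "\<bar>\<dots>\<bar> \<le> (\<Sum>j\<in>J. \<bar>(\<beta> j - \<gamma> j) * of_int (c j)\<bar>)" by (rule sum_abs)
    also have "\<dots> \<le> (\<Sum>j\<in>J. \<epsilon> / C * \<bar>real_of_int (c j)\<bar>)"
      unfolding abs_mult by (intro sum_mono mult_right_mono b'\<beta>(3)[THEN less_imp_le]) auto
    also have "\<dots> = \<epsilon> / C * (\<Sum>j\<in>J. \<bar>real_of_int (c j)\<bar>)" by (simp add: sum_distrib_left)
    also have "\<dots> < \<epsilon> / C * C" using C[of q t c] that d \<epsilon>(1) C1 by (intro mult_strict_left_mono) auto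
    finally show ?thesis using C1 by simp
  qed
  have main: "above G w nn (L \<alpha> (q, t, c) + 2 * pi * of_int n) (t \<otimes>\<^bsub>G\<^esub> G.comb b J c)
     \<longleftrightarrow> above G' w' nn' (L \<beta> (q, t, c) + 2 * pi * of_int n) (\<tau> t \<otimes>\<^bsub>G'\<^esub> G'.comb b' J c)"
    if d: "(q, t, c) \<in> D" for q t c and n :: int
  proof -
    let ?d = "(q, t, c)"
    have t: "t \<in> G.torsion" "w t = cis q" using D(2)[OF d] by auto
    have per: "cis (L \<gamma> ?d + 2 * pi * of_int n) = cis q * cis (\<Sum>j\<in>J. \<gamma> j * of_int (c j))" for \<gamma>
      unfolding cis_mult L_def by (subst cis_eq_iff) auto
    have wA: "w (t \<otimes>\<^bsub>G\<^esub> G.comb b J c) = cis (L \<alpha> ?d + 2 * pi * of_int n)"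
      "w' (\<tau> t \<otimes>\<^bsub>G'\<^esub> G'.comb b' J c) = cis (L \<beta> ?d + 2 * pi * of_int n)"
      using t b b' \<tau>[OF t(1)] G.w_comb[OF J b \<alpha>] G'.w_comb[OF J b' b'\<beta>(2)] by (simp_all add: G.w_mult G'.w_mult per)
    note ab = G.above_tcomb[OF t(1) G.comb_closed[OF b] wA(1)]
      G'.above_tcomb[OF \<tau>(1)[OF t(1)] G'.comb_closed[OF b'] wA(2)]
    have "0 < 2 * pi * real_of_int N" using N[OF d] by linarith
    then have N0: "N \<ge> 0" by (simp add: zero_less_mult_iff)
    show ?thesis
    \<comment> \<open>If \<open>c\<close> vanishes on \<open>J\<close>, both lifts are the torsion
      part alone and agree even at 0; independence excludes 0 only in the other case.\<close>
    proof (cases "\<forall>j\<in>J. c j = 0")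
      case True
      have "G.comb b J c = \<one>\<^bsub>G\<^esub>" using G.comb_cong[of J b b c "\<lambda>j. 0"] b True by simp
      moreover have "G'.comb b' J c = \<one>\<^bsub>G'\<^esub>" using G'.comb_cong[of J b' b' c "\<lambda>j. 0"] b' True by simp
      moreover have "L \<alpha> ?d = L \<beta> ?d" using True by (simp add: L_def)
      ultimately show ?thesis unfolding ab by simp
    next
      case False
      have nz: "L \<gamma> ?d + 2 * pi * of_int i \<noteq> 0" if i: "i \<in> {- N..N}" for i :: int
      proof
        assume "L \<gamma> ?d + 2 * pi * of_int i = 0"
        then have "P (vec ?d i)" "P (neg (vec ?d i))" using Pvec[OF d i] by auto
        then have 0: "ang (vec ?d i) = 0" "nn (cmb (vec ?d i))" "nn (inv\<^bsub>G\<^esub> (cmb (vec ?d i)))"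
          by (auto simp: P_def ang_neg cmb_neg)
        have "w (cmb (vec ?d i)) = cis (\<Sum>j\<in>J. \<alpha> j * of_int (vec ?d i (Some j)))"
          unfolding cmb_def using G.w_comb[OF J b \<alpha>] by simp
        also have "\<dots> = cis (ang (vec ?d i))" unfolding ang_def by (subst cis_eq_iff) (rule exI[of _ "- vec ?d i None"], simp)
        finally have "cmb (vec ?d i) = \<one>\<^bsub>G\<^esub>" using 0 by (intro G.w_nn_inj[OF cmbc]) auto
        then have "G.comb b J c \<in> G.torsion"
          using mk(1)[OF d] b unfolding cmb_vec by (intro G.torsionI) auto
        then show False using ind False unfolding G.indep_def by blast
      qed
      have pos: "0 < L \<beta> ?d + 2 * pi * of_int i \<longleftrightarrow> 0 < L \<gamma> ?d + 2 * pi * of_int i" "L \<beta> ?d + 2 * pi * of_int i \<noteq> 0"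
        if i: "i \<in> {- N..N}" for i :: int
        using near[OF d] \<epsilon>(2)[OF d i nz[OF i]] by linarith+
      have tn: "nn (inv\<^bsub>G\<^esub> (G.comb b J c)) \<longleftrightarrow> nn (cmb (neg (vec ?d i)))" for i
        unfolding cmb_neg cmb_vec using b mk(1)[OF d] G.nn_pow_iff[of "inv\<^bsub>G\<^esub> (G.comb b J c)" "m ?d"] by (simp add: G.nat_pow_inv)
      have inrange: "(0 < L \<alpha> ?d + 2 * pi * of_int i \<or> L \<alpha> ?d + 2 * pi * of_int i = 0 \<and> \<not> nn (inv\<^bsub>G\<^esub> (G.comb b J c)))
          \<longleftrightarrow> 0 < L \<beta> ?d + 2 * pi * of_int i" if i: "i \<in> {- N..N}" for i :: int
      proof -
        have "\<not> P (neg (vec ?d i)) \<longleftrightarrow> 0 < L \<beta> ?d + 2 * pi * of_int i" using Pvec(2)[OF d i] pos[OF i] by auto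
        then show ?thesis unfolding P_def ang_neg ang_vec[OF d] tn[of i] using mk(1)[OF d]
          by (auto simp: zero_less_mult_iff mult_less_0_iff)
      qed
      \<comment> \<open>Outside the window, further turns only move a lift away from 0, starting
        from the ends \<open>N\<close> and \<open>- N\<close>, where its sign is known.\<close>
      consider "n \<in> {- N..N}" | "n > N" | "n < - N" by fastforce
      then show ?thesis
      proof cases
        case 1 then show ?thesis unfolding ab using inrange pos(2) by auto
      next
        case 2
        have "0 < L \<alpha> ?d + 2 * pi * of_int N" using N[OF d] by linarith
        then have "0 < L \<beta> ?d + 2 * pi * of_int N" using inrange[of N] N0 by auto
        moreover have "2 * pi * of_int N < 2 * pi * of_int n" using 2 by simp
        ultimately show ?thesis unfolding ab using \<open>0 < L \<alpha> ?d + 2 * pi * of_int N\<close> by linarith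
      next
        case 3
        have *: "L \<alpha> ?d + 2 * pi * of_int (- N) < 0" using N[OF d] by simp
        then have "L \<beta> ?d + 2 * pi * of_int (- N) < 0" using inrange[of "- N"] pos(2)[of "- N"] N0 by auto
        moreover have "2 * pi * of_int n < 2 * pi * of_int (- N)" using 3 by (intro mult_strict_left_mono) auto
        ultimately show ?thesis unfolding ab using * by linarith
      qed
    qed
  qed
  have "signs_match G w nn G' w' nn' \<tau> J b \<alpha> b' \<beta> D"
    unfolding signs_match_def using main by (auto simp: L_def)
  then show ?thesis using b' b'\<beta> by blast
qed

section \<open>Transferring quantifier-free formulas\<close>

lemma finite_trm_vars: "finite (trm_vars t)"
  by (induction t) auto

fun terms_of :: "fm \<Rightarrow> trm set" where
  "terms_of (Eq s t) = {s, t}"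
| "terms_of (Rel s t u) = {s, t, u}"
| "terms_of (Not p) = terms_of p"
| "terms_of (And p q) = terms_of p \<union> terms_of q"
| "terms_of (Or p q) = terms_of p \<union> terms_of q"
| "terms_of (All n p) = terms_of p"
| "terms_of (Ex n p) = terms_of p"

lemma finite_terms_of: "finite (terms_of p)"
  by (induction p) auto

definition atoms_agree :: "'a cog \<Rightarrow> (nat \<Rightarrow> 'a) \<Rightarrow> 'b cog \<Rightarrow> (nat \<Rightarrow> 'b) \<Rightarrow> trm set \<Rightarrow> bool" where
  "atoms_agree G e H e' T \<longleftrightarrow>
    (\<forall>s\<in>T. \<forall>t\<in>T. eval_trm G e s = eval_trm G e t \<longleftrightarrow> eval_trm H e' s = eval_trm H e' t) \<and>
    (\<forall>s\<in>T. \<forall>t\<in>T. \<forall>u\<in>T. cyc G (eval_trm G e s) (eval_trm G e t) (eval_trm G e u)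
       \<longleftrightarrow> cyc H (eval_trm H e' s) (eval_trm H e' t) (eval_trm H e' u))"

lemma sat_cong_atoms:
  "quantifier_free p \<Longrightarrow> atoms_agree G e H e' (terms_of p) \<Longrightarrow> sat G e p \<longleftrightarrow> sat H e' p"
proof (induction p)
  case (And p q)
  then have "atoms_agree G e H e' (terms_of p)" "atoms_agree G e H e' (terms_of q)"
    by (auto simp: atoms_agree_def)
  then show ?case using And by simp
next
  case (Or p q)
  then have "atoms_agree G e H e' (terms_of p)" "atoms_agree G e H e' (terms_of q)"
    by (auto simp: atoms_agree_def)
  then show ?case using Or by simp
qed (auto simp: atoms_agree_def)

lemma (in wound_group) eval_trm_closed: "range e \<subseteq> carrier G \<Longrightarrow> eval_trm G e t \<in> carrier G"
  by (induction t) auto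

context wound_pair
begin

lemma \<tau>_closed: "t \<in> G.torsion \<Longrightarrow> \<tau> t \<in> carrier G'"
  using \<tau>(1) G'.torsion_closed by blast

text \<open>The coordinates \<open>r\<close>, \<open>v\<close> are fixed ahead of the quantifiers
  over \<open>b'\<close> and \<open>e'\<close>: a term keeps its torsion part and exponents whatever
  generators are substituted later.\<close>

lemma eval_trm_rep:
  assumes b: "b \<in> J \<rightarrow> carrier G"
    and e: "\<And>i. i \<in> V \<Longrightarrow> t i \<in> G.torsion \<and> e i = t i \<otimes>\<^bsub>G\<^esub> G.comb b J (c i)"
    and "trm_vars s \<subseteq> V"
  shows "\<exists>r v. r \<in> G.torsion \<and> eval_trm G e s = r \<otimes>\<^bsub>G\<^esub> G.comb b J v \<and>
    (\<forall>b' e'. b' \<in> J \<rightarrow> carrier G' \<longrightarrow> (\<forall>i\<in>V. e' i = \<tau> (t i) \<otimes>\<^bsub>G'\<^esub> G'.comb b' J (c i)) \<longrightarrow>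
       eval_trm G' e' s = \<tau> r \<otimes>\<^bsub>G'\<^esub> G'.comb b' J v)"
  using assms(3)
proof (induction s)
  case (Var i)
  then show ?case using e[of i] by (intro exI[of _ "t i"] exI[of _ "c i"]) simp
next
  case Zero
  then show ?case by (intro exI[of _ "\<one>\<^bsub>G\<^esub>"] exI[of _ "\<lambda>_. 0"]) (simp add: \<tau>_one)
next
  case (Add s u)
  then obtain r v r' v' where r: "r \<in> G.torsion" "eval_trm G e s = r \<otimes>\<^bsub>G\<^esub> G.comb b J v"
     "\<And>b' e'. b' \<in> J \<rightarrow> carrier G' \<Longrightarrow> (\<forall>i\<in>V. e' i = \<tau> (t i) \<otimes>\<^bsub>G'\<^esub> G'.comb b' J (c i)) \<Longrightarrow>
       eval_trm G' e' s = \<tau> r \<otimes>\<^bsub>G'\<^esub> G'.comb b' J v"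
    and r': "r' \<in> G.torsion" "eval_trm G e u = r' \<otimes>\<^bsub>G\<^esub> G.comb b J v'"
     "\<And>b' e'. b' \<in> J \<rightarrow> carrier G' \<Longrightarrow> (\<forall>i\<in>V. e' i = \<tau> (t i) \<otimes>\<^bsub>G'\<^esub> G'.comb b' J (c i)) \<Longrightarrow>
       eval_trm G' e' u = \<tau> r' \<otimes>\<^bsub>G'\<^esub> G'.comb b' J v'"
    by auto
  show ?case
    using r r' b \<tau>_closed
    by (intro exI[of _ "r \<otimes>\<^bsub>G\<^esub> r'"] exI[of _ "\<lambda>j. v j + v' j"])
      (simp add: G.torsion_mult \<tau>_mult G.comb_add G'.comb_add G.m_ac G'.m_ac)
next
  case (Minus s)
  then obtain r v where r: "r \<in> G.torsion" "eval_trm G e s = r \<otimes>\<^bsub>G\<^esub> G.comb b J v"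
     "\<And>b' e'. b' \<in> J \<rightarrow> carrier G' \<Longrightarrow> (\<forall>i\<in>V. e' i = \<tau> (t i) \<otimes>\<^bsub>G'\<^esub> G'.comb b' J (c i)) \<Longrightarrow>
       eval_trm G' e' s = \<tau> r \<otimes>\<^bsub>G'\<^esub> G'.comb b' J v"
    by auto
  show ?case
    using r b \<tau>_closed
    by (intro exI[of _ "inv\<^bsub>G\<^esub> r"] exI[of _ "\<lambda>j. - v j"])
      (simp add: G.torsion_inv \<tau>_inv G.comb_neg G'.comb_neg G.inv_mult G'.inv_mult)
qed

text \<open>\<open>eq_iff_lifts\<close> and \<open>cyc_iff_lifts\<close> see only differences of
  term values, so matching signs on these finitely many differences decides every atom. The second
  alternative serves finite winding parts.\<close>

lemma ex_agreeing_assignment: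
  assumes e: "range e \<subseteq> carrier G" and T: "finite T"
    and alt: "infinite (w' ` carrier G') \<or> (\<exists>n::nat. n > 0 \<and> (\<forall>x\<in>carrier G. w x ^ n = 1) \<and>
      (\<exists>g\<in>carrier G'. w' g = cis (2 * pi / n) \<and> \<not> nn' (inv\<^bsub>G'\<^esub> g)))"
  shows "\<exists>e'. range e' \<subseteq> carrier G' \<and> atoms_agree G e G' e' T"
proof -
  define V where "V = (\<Union>s\<in>T. trm_vars s)"
  have "finite V" using T finite_trm_vars by (auto simp: V_def)
  moreover have "e \<in> V \<rightarrow> carrier G" using e by auto
  ultimately obtain b and J :: "nat set" where J: "finite J" and b: "b \<in> J \<rightarrow> carrier G" and ind: "G.indep b J"
    and sp: "\<forall>i\<in>V. e i \<in> G.tspan b J"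
    using G.ex_independent_generators[of V e] by blast
  have "\<forall>i\<in>V. \<exists>t c. t \<in> G.torsion \<and> e i = t \<otimes>\<^bsub>G\<^esub> G.comb b J c"
    using sp unfolding G.tspan_def by blast
  then obtain t c where tc: "\<And>i. i \<in> V \<Longrightarrow> t i \<in> G.torsion \<and> e i = t i \<otimes>\<^bsub>G\<^esub> G.comb b J (c i)"
    by metis
  define Q where "Q s r v \<longleftrightarrow> r \<in> G.torsion \<and> eval_trm G e s = r \<otimes>\<^bsub>G\<^esub> G.comb b J v \<and>
    (\<forall>b' e'. b' \<in> J \<rightarrow> carrier G' \<longrightarrow> (\<forall>i\<in>V. e' i = \<tau> (t i) \<otimes>\<^bsub>G'\<^esub> G'.comb b' J (c i)) \<longrightarrow>
       eval_trm G' e' s = \<tau> r \<otimes>\<^bsub>G'\<^esub> G'.comb b' J v)" for s r v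
  have "\<exists>r v. Q s r v" if "s \<in> T" for s
    unfolding Q_def by (rule eval_trm_rep[OF b tc]) (use that in \<open>auto simp: V_def\<close>)
  then obtain r v where "\<And>s. s \<in> T \<Longrightarrow> Q s (r s) (v s)" by metis
  then have rv: "\<And>s. s \<in> T \<Longrightarrow> r s \<in> G.torsion"
    "\<And>s. s \<in> T \<Longrightarrow> eval_trm G e s = r s \<otimes>\<^bsub>G\<^esub> G.comb b J (v s)"
    "\<And>s b' e'. s \<in> T \<Longrightarrow> b' \<in> J \<rightarrow> carrier G' \<Longrightarrow> (\<forall>i\<in>V. e' i = \<tau> (t i) \<otimes>\<^bsub>G'\<^esub> G'.comb b' J (c i)) \<Longrightarrow>
       eval_trm G' e' s = \<tau> (r s) \<otimes>\<^bsub>G'\<^esub> G'.comb b' J (v s)"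
    by (simp_all add: Q_def)
  define \<alpha> where "\<alpha> j = Arg2pi (w (b j))" for j
  have \<alpha>: "w (b j) = cis (\<alpha> j)" if "j \<in> J" for j
    using that b G.w_norm[of "b j"] by (simp add: \<alpha>_def cis_Arg2pi Pi_iff)
  define q where "q s = Arg2pi (w (r s))" for s
  have q: "w (r s) = cis (q s)" if "s \<in> T" for s
    using rv(1)[OF that] G.w_norm[of "r s"] by (simp add: q_def cis_Arg2pi)
  define d where "d s u = (q u - q s, inv\<^bsub>G\<^esub> (r s) \<otimes>\<^bsub>G\<^esub> r u, \<lambda>j. v u j - v s j)" for s u
  define D where "D = (\<lambda>(s, u). d s u) ` (T \<times> T)"
  have D: "t \<in> G.torsion \<and> w t = cis q" if "(q, t, c) \<in> D" for q t c
    using that rv(1) q T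
    by (auto simp: D_def d_def G.torsion_mult G.torsion_inv G.w_mult G.w_inv cis_divide[symmetric] divide_inverse)
  have finD: "finite D" using T by (simp add: D_def)
  have "\<exists>b' \<beta>. b' \<in> J \<rightarrow> carrier G' \<and> (\<forall>j\<in>J. w' (b' j) = cis (\<beta> j)) \<and>
    signs_match G w nn G' w' nn' \<tau> J b \<alpha> b' \<beta> D"
    using alt
  proof (elim disjE exE conjE bexE)
    assume inf: "infinite (w' ` carrier G')"
    show ?thesis by (rule ex_match_winding_infinite[OF J b ind]) (fact \<alpha> finD D inf)+
  next
    fix n :: nat and g
    assume n: "n > 0" "\<forall>x\<in>carrier G. w x ^ n = 1" and g: "g \<in> carrier G'" "w' g = cis (2 * pi / n)" "\<not> nn' (inv\<^bsub>G'\<^esub> g)"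
    have wn: "w x ^ n = 1" if "x \<in> carrier G" for x using n that by blast
    have "\<exists>b'. b' \<in> J \<rightarrow> carrier G' \<and> (\<forall>j\<in>J. w' (b' j) = cis (\<alpha> j)) \<and>
        signs_match G w nn G' w' nn' \<tau> J b \<alpha> b' \<alpha> D"
      by (rule ex_match_winding_finite[OF J b ind]) (fact \<alpha> finD D n(1) wn g)+
    then show ?thesis by blast
  qed
  then obtain b' \<beta> where b': "b' \<in> J \<rightarrow> carrier G'" and \<beta>: "\<And>j. j \<in> J \<Longrightarrow> w' (b' j) = cis (\<beta> j)"
    and match: "signs_match G w nn G' w' nn' \<tau> J b \<alpha> b' \<beta> D" by blast
  define e' where "e' i = (if i \<in> V then \<tau> (t i) \<otimes>\<^bsub>G'\<^esub> G'.comb b' J (c i) else \<one>\<^bsub>G'\<^esub>)" for i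
  have e': "range e' \<subseteq> carrier G'" using tc b' \<tau>_closed by (auto simp: e'_def)
  define x where "x s = eval_trm G e s" for s
  define x' where "x' s = eval_trm G' e' s" for s
  have xc: "x s \<in> carrier G" "x' s \<in> carrier G'" for s
    using G.eval_trm_closed[OF e] G'.eval_trm_closed[OF e'] by (simp_all add: x_def x'_def)
  have x: "x s = r s \<otimes>\<^bsub>G\<^esub> G.comb b J (v s)" "x' s = \<tau> (r s) \<otimes>\<^bsub>G'\<^esub> G'.comb b' J (v s)" if "s \<in> T" for s
    using rv(2)[OF that] rv(3)[OF that b', of e'] by (simp_all add: x_def x'_def e'_def)
  define a where "a s = q s + (\<Sum>j\<in>J. \<alpha> j * of_int (v s j))" for s
  define a' where "a' s = q s + (\<Sum>j\<in>J. \<beta> j * of_int (v s j))" for s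
  have wx: "w (x s) = cis (a s)" "w' (x' s) = cis (a' s)" if "s \<in> T" for s
    using x[OF that] q[OF that] rv(1)[OF that] \<tau>[OF rv(1)[OF that]] b b' G.w_comb[OF J b \<alpha>] G'.w_comb[OF J b' \<beta>]
    by (simp_all add: G.w_mult G'.w_mult a_def a'_def cis_mult[symmetric])
  have ab: "above G w nn (a u - a s + 2 * pi * of_int n) (inv\<^bsub>G\<^esub> (x s) \<otimes>\<^bsub>G\<^esub> x u) \<longleftrightarrow>
      above G' w' nn' (a' u - a' s + 2 * pi * of_int n) (inv\<^bsub>G'\<^esub> (x' s) \<otimes>\<^bsub>G'\<^esub> x' u)"
    if s: "s \<in> T" and u: "u \<in> T" for s u and n :: int
  proof -
    have "d s u \<in> D" using s u by (auto simp: D_def)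
    then have "above G w nn (q u - q s + (\<Sum>j\<in>J. \<alpha> j * of_int (v u j - v s j)) + 2 * pi * of_int n)
        ((inv\<^bsub>G\<^esub> (r s) \<otimes>\<^bsub>G\<^esub> r u) \<otimes>\<^bsub>G\<^esub> G.comb b J (\<lambda>j. v u j - v s j)) \<longleftrightarrow>
      above G' w' nn' (q u - q s + (\<Sum>j\<in>J. \<beta> j * of_int (v u j - v s j)) + 2 * pi * of_int n)
        (\<tau> (inv\<^bsub>G\<^esub> (r s) \<otimes>\<^bsub>G\<^esub> r u) \<otimes>\<^bsub>G'\<^esub> G'.comb b' J (\<lambda>j. v u j - v s j))"
      using match unfolding signs_match_def d_def by fast
    moreover have "q u - q s + (\<Sum>j\<in>J. \<delta> j * of_int (v u j - v s j))
        = (q u + (\<Sum>j\<in>J. \<delta> j * of_int (v u j))) - (q s + (\<Sum>j\<in>J. \<delta> j * of_int (v s j)))" for \<delta> :: "nat \<Rightarrow> real"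
      by (simp add: sum_subtractf algebra_simps)
    moreover have "(inv\<^bsub>G\<^esub> (r s) \<otimes>\<^bsub>G\<^esub> r u) \<otimes>\<^bsub>G\<^esub> G.comb b J (\<lambda>j. v u j - v s j) = inv\<^bsub>G\<^esub> (x s) \<otimes>\<^bsub>G\<^esub> x u"
      using rv(1) s u b G.comb_add[OF b, of "v u" "\<lambda>j. - v s j"] G.comb_neg[OF b, of "v s"]
      by (simp add: x G.inv_mult G.m_ac)
    moreover have "\<tau> (inv\<^bsub>G\<^esub> (r s) \<otimes>\<^bsub>G\<^esub> r u) \<otimes>\<^bsub>G'\<^esub> G'.comb b' J (\<lambda>j. v u j - v s j) = inv\<^bsub>G'\<^esub> (x' s) \<otimes>\<^bsub>G'\<^esub> x' u"
      using rv(1) s u b' \<tau>_closed G'.comb_add[OF b', of "v u" "\<lambda>j. - v s j"] G'.comb_neg[OF b', of "v s"]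
      by (simp add: x G'.inv_mult G'.m_ac \<tau>_mult \<tau>_inv G.torsion_inv)
    ultimately show ?thesis by (simp only: a_def a'_def)
  qed
  have "x s = x u \<longleftrightarrow> x' s = x' u" if "s \<in> T" "u \<in> T" for s u
    using that by (simp add: G.eq_iff_lifts[OF xc(1) xc(1) wx(1) wx(1)] G'.eq_iff_lifts[OF xc(2) xc(2) wx(2) wx(2)] ab
        del: of_int_minus)
  moreover have "cyc G (x s) (x u) (x y) \<longleftrightarrow> cyc G' (x' s) (x' u) (x' y)" if "s \<in> T" "u \<in> T" "y \<in> T" for s u y
    using that by (simp add: G.cyc_iff_lifts[OF xc(1) xc(1) xc(1) wx(1) wx(1) wx(1)]
        G'.cyc_iff_lifts[OF xc(2) xc(2) xc(2) wx(2) wx(2) wx(2)] ab)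
  ultimately have "atoms_agree G e G' e' T" by (simp add: atoms_agree_def x_def x'_def)
  then show ?thesis using e' by blast
qed

end

section \<open>Universal sentences about torsion and winding\<close>

fun matrix_of :: "fm \<Rightarrow> fm" where
  "matrix_of (All n p) = matrix_of p"
| "matrix_of p = p"

lemma matrix_of_quantifier_free: "quantifier_free p \<Longrightarrow> matrix_of p = p"
  by (cases p) auto

text \<open>\<open>models\<close> already ranges over all assignments into the carrier, so leading
  universal quantifiers can be stripped or added freely.\<close>

lemma models_All: "models G (All n p) \<longleftrightarrow> models G p"
proof
  assume *: "models G (All n p)"
  have "sat G e p" if e: "range e \<subseteq> carrier G" for e
  proof -
    have "e n \<in> carrier G" using e by auto
    moreover have "sat G e (All n p)" using *[unfolded models_def] e by blast
    ultimately have "sat G (e(n := e n)) p" unfolding sat.simps by (rule bspec[rotated])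
    then show ?thesis by simp
  qed
  then show "models G p" by (simp add: models_def)
next
  assume *: "models G p"
  have "range (e(n := a)) \<subseteq> carrier G" if "range e \<subseteq> carrier G" "a \<in> carrier G" for e a
    using that by auto
  then show "models G (All n p)" using * by (simp add: models_def)
qed

lemma universal_fm_matrix:
  "universal_fm p \<Longrightarrow> quantifier_free (matrix_of p) \<and> (models G p \<longleftrightarrow> models G (matrix_of p))"
  by (induction rule: universal_fm.induct) (auto simp: matrix_of_quantifier_free models_All)

lemma finite_free_vars: "finite (free_vars p)"
  by (induction p) (auto simp: finite_trm_vars)

lemma free_vars_closure: "free_vars (foldr All xs p) = free_vars p - set xs"
  by (induction xs) auto

lemma universal_fm_closure: "quantifier_free p \<Longrightarrow> universal_fm (foldr All xs p)"
  by (induction xs) (simp_all add: universal_fm.intros)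

lemma models_closure: "models G (foldr All xs p) \<longleftrightarrow> models G p"
  by (induction xs) (simp_all add: models_All)

definition satisfiable :: "'a cog \<Rightarrow> fm \<Rightarrow> bool" where
  "satisfiable G p \<longleftrightarrow> (\<exists>e. range e \<subseteq> carrier G \<and> sat G e p)"

text \<open>A universal sentence fails exactly when the negation of its matrix is satisfiable;
  conversely, a quantifier-free formula is satisfiable exactly when the universal closure of its
  negation fails.\<close>

lemma same_universal_sentences_iff:
  "same_universal_sentences (G :: 'a cog) (H :: 'b cog) \<longleftrightarrow>
    (\<forall>p. quantifier_free p \<longrightarrow> satisfiable G p \<longleftrightarrow> satisfiable H p)"
proof
  assume same: "same_universal_sentences G H"
  show "\<forall>p. quantifier_free p \<longrightarrow> satisfiable G p \<longleftrightarrow> satisfiable H p"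
  proof (intro allI impI)
    fix p assume "quantifier_free p"
    then have qf: "quantifier_free (Not p)" by simp
    obtain xs where xs: "set xs = free_vars (Not p)" using finite_list[OF finite_free_vars] by blast
    have "universal_sentence (foldr All xs (Not p))"
      unfolding universal_sentence_def free_vars_closure xs using universal_fm_closure[OF qf] by simp
    then have "models G (foldr All xs (Not p)) \<longleftrightarrow> models H (foldr All xs (Not p))"
      using same unfolding same_universal_sentences_def by blast
    then have "models G (Not p) \<longleftrightarrow> models H (Not p)" unfolding models_closure .
    then show "satisfiable G p \<longleftrightarrow> satisfiable H p" by (simp add: models_def satisfiable_def) blast
  qed
next
  assume *: "\<forall>p. quantifier_free p \<longrightarrow> satisfiable G p \<longleftrightarrow> satisfiable H p"
  have "models G p \<longleftrightarrow> models H p" if "universal_sentence p" for p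
  proof -
    have u: "universal_fm p" using that by (simp add: universal_sentence_def)
    then have "satisfiable G (Not (matrix_of p)) \<longleftrightarrow> satisfiable H (Not (matrix_of p))"
      using *[rule_format, of "Not (matrix_of p)"] universal_fm_matrix[OF u, of G] by simp
    then have "models G (matrix_of p) \<longleftrightarrow> models H (matrix_of p)"
      by (simp add: models_def satisfiable_def) blast
    then show ?thesis using universal_fm_matrix[OF u, of G] universal_fm_matrix[OF u, of H] by blast
  qed
  then show "same_universal_sentences G H" by (simp add: same_universal_sentences_def)
qed

section \<open>Formulas for orders of elements and for winding\<close>

fun multiple :: "nat \<Rightarrow> trm" where
  "multiple 0 = Zero"
| "multiple (Suc n) = Add (multiple n) (Var 0)"

definition conj_list :: "fm list \<Rightarrow> fm" where
  "conj_list ps = foldr And ps (Eq Zero Zero)"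

lemma sat_conj_list [simp]: "sat G e (conj_list ps) \<longleftrightarrow> (\<forall>p\<in>set ps. sat G e p)"
  by (induction ps) (auto simp: conj_list_def)

lemma quantifier_free_conj_list: "(\<And>p. p \<in> set ps \<Longrightarrow> quantifier_free p) \<Longrightarrow> quantifier_free (conj_list ps)"
  by (induction ps) (auto simp: conj_list_def)

definition order_fm :: "nat \<Rightarrow> fm" where
  "order_fm n = conj_list (Eq (multiple n) Zero # map (\<lambda>j. Not (Eq (multiple j) Zero)) [1..<n])"

text \<open>Staying in the same turn is expressed by \<open>Rel\<close> between zero and two
  consecutive multiples. The positive range stops before \<open>N\<close>, where the relation has to
  fail; for \<open>N = 1\<close> the nonzero clause is what excludes the identity.\<close>

definition once_around_fm :: "nat \<Rightarrow> fm" where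
  "once_around_fm N = conj_list (Not (Eq (Var 0) Zero) # Not (Rel Zero (multiple N) (multiple (Suc N)))
     # map (\<lambda>j. Rel Zero (multiple j) (multiple (Suc j))) [1..<N])"

lemma quantifier_free_order_fm: "quantifier_free (order_fm n)"
  unfolding order_fm_def by (rule quantifier_free_conj_list) auto

lemma quantifier_free_once_around_fm: "quantifier_free (once_around_fm n)"
  unfolding once_around_fm_def by (rule quantifier_free_conj_list) auto

context wound_group
begin

lemma eval_multiple: "eval_trm G e (multiple n) = e 0 [^] n"
  by (induction n) auto

definition has_order :: "nat \<Rightarrow> bool" where
  "has_order n \<longleftrightarrow> (\<exists>x\<in>carrier G. x [^] n = \<one> \<and> (\<forall>j\<in>{1..<n}. x [^] j \<noteq> \<one>))"

definition once_around :: "nat \<Rightarrow> 'a \<Rightarrow> bool" where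
  "once_around N x \<longleftrightarrow> x \<in> carrier G \<and> x \<noteq> \<one> \<and> \<not> cyc G \<one> (x [^] N) (x [^] Suc N)
    \<and> (\<forall>j\<in>{1..<N}. cyc G \<one> (x [^] j) (x [^] Suc j))"

lemma satisfiable_order_fm: "satisfiable G (order_fm n) \<longleftrightarrow> has_order n"
proof
  assume "satisfiable G (order_fm n)"
  then obtain e where "range e \<subseteq> carrier G" "sat G e (order_fm n)" by (auto simp: satisfiable_def)
  then show "has_order n" unfolding has_order_def
    by (intro bexI[of _ "e 0"]) (auto simp: order_fm_def eval_multiple)
next
  assume "has_order n"
  then obtain x where "x \<in> carrier G" "x [^] n = \<one>" "\<forall>j\<in>{1..<n}. x [^] j \<noteq> \<one>" by (auto simp: has_order_def)
  then show "satisfiable G (order_fm n)" unfolding satisfiable_def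
    by (intro exI[of _ "\<lambda>_. x"]) (auto simp: order_fm_def eval_multiple)
qed

lemma satisfiable_once_around_fm: "satisfiable G (once_around_fm N) \<longleftrightarrow> (\<exists>x. once_around N x)"
proof
  assume "satisfiable G (once_around_fm N)"
  then obtain e where "range e \<subseteq> carrier G" "sat G e (once_around_fm N)" by (auto simp: satisfiable_def)
  then show "\<exists>x. once_around N x" unfolding once_around_def
    by (intro exI[of _ "e 0"]) (auto simp: once_around_fm_def eval_multiple)
next
  assume "\<exists>x. once_around N x"
  then obtain x where "once_around N x" by blast
  then show "satisfiable G (once_around_fm N)" unfolding satisfiable_def once_around_def
    by (intro exI[of _ "\<lambda>_. x"]) (auto simp: once_around_fm_def eval_multiple)
qed

text \<open>An element of order \<open>n\<close> has \<open>n\<close> distinct torsion powers, so by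
  injectivity of \<open>w\<close> on torsion their angles exhaust the \<open>n\<close>-th roots of
  unity. The image is thus computed from the orders that occur, which formulas can express.\<close>

lemma w_torsion: "w ` torsion = {z. \<exists>n>0. has_order n \<and> z ^ n = 1}"
proof (rule equalityI; rule subsetI)
  fix z assume "z \<in> w ` torsion"
  then obtain x where x: "x \<in> torsion" "z = w x" by blast
  define n where "n = (LEAST n::nat. n > 0 \<and> x [^] n = \<one>)"
  have "\<exists>n::nat. n > 0 \<and> x [^] n = \<one>" using x torsionE by metis
  then have n: "n > 0 \<and> x [^] n = \<one>" unfolding n_def by (rule LeastI_ex)
  moreover have "x [^] j \<noteq> \<one>" if "j \<in> {1..<n}" for j
    using not_less_Least[of j "\<lambda>n::nat. n > 0 \<and> x [^] n = \<one>"] that unfolding n_def[symmetric] by auto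
  ultimately have "has_order n" using x unfolding has_order_def by (intro bexI[of _ x]) auto
  moreover have "z ^ n = 1" using n x w_pow[of x n] by simp
  ultimately show "z \<in> {z. \<exists>n>0. has_order n \<and> z ^ n = 1}" using n by blast
next
  fix z :: complex assume "z \<in> {z. \<exists>n>0. has_order n \<and> z ^ n = 1}"
  then obtain n x where n: "n > 0" "z ^ n = 1" and x: "x \<in> carrier G" "x [^] n = \<one>" "\<forall>j\<in>{1..<n}. x [^] j \<noteq> \<one>"
    by (auto simp: has_order_def)
  have tor: "x [^] j \<in> torsion" for j :: nat
  proof -
    have "(x [^] j) [^] n = (x [^] n) [^] j" using x(1) by (simp add: nat_pow_pow mult.commute)
    then show ?thesis using x n by (intro torsionI[of _ n]) simp_all
  qed
  have ne: "w (x [^] i) \<noteq> w (x [^] j)" if "i < j" "j < n" for i j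
  proof
    assume "w (x [^] i) = w (x [^] j)"
    then have "x [^] i = x [^] j" using tor torsion_inj by blast
    also have "\<dots> = x [^] i \<otimes> x [^] (j - i)" using x that by (simp add: nat_pow_mult)
    finally have "x [^] (j - i) = \<one>" using x by simp
    moreover have "j - i \<in> {1..<n}" using that by auto
    ultimately show False using x by blast
  qed
  have "inj_on (\<lambda>j. w (x [^] j)) {..<n}"
  proof (rule inj_onI)
    fix i j assume "i \<in> {..<n}" "j \<in> {..<n}" "w (x [^] i) = w (x [^] j)"
    then show "i = j" using ne[of i j] ne[of j i] by (cases i j rule: linorder_cases) auto
  qed
  then have "card ((\<lambda>j. w (x [^] j)) ` {..<n}) = n" by (simp add: card_image)
  moreover have sub: "(\<lambda>j. w (x [^] j)) ` {..<n} \<subseteq> {z. z ^ n = 1}"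
  proof safe
    fix j :: nat
    have "(x [^] j) [^] n = (x [^] n) [^] j" using x(1) by (simp add: nat_pow_pow mult.commute)
    then have "(x [^] j) [^] n = \<one>" using x by simp
    then show "w (x [^] j) ^ n = 1" using w_pow[of "x [^] j" n] x by simp
  qed
  ultimately have "(\<lambda>j. w (x [^] j)) ` {..<n} = {z. z ^ n = 1}"
    using n by (intro card_subset_eq finite_roots_unity) (auto simp: card_roots_unity_eq)
  then have "z \<in> (\<lambda>j. w (x [^] j)) ` {..<n}" using n by simp
  then obtain j :: nat where "z = w (x [^] j)" by blast
  then show "z \<in> w ` torsion" using tor by blast
qed

text \<open>Multiplication by \<open>z\<close> permutes the finite set \<open>W\<close>, so
  comparing the products over \<open>W\<close> gives \<open>z ^ n = 1\<close>; \<open>n\<close> such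
  roots are all of them. A finite winding part is therefore determined by its cardinality.\<close>

lemma winding_finite:
  assumes fin: "finite (w ` carrier G)"
  shows "w ` carrier G = {z. z ^ card (w ` carrier G) = 1}" "card (w ` carrier G) > 0"
proof -
  define W where "W = w ` carrier G"
  define n where "n = card W"
  show n: "card (w ` carrier G) > 0" using fin one_closed by (auto simp: card_gt_0_iff)
  have "z ^ n = 1" if z: "z \<in> W" for z
  proof -
    obtain x where x: "x \<in> carrier G" "z = w x" using z by (auto simp: W_def)
    have z0: "z \<noteq> 0" using x w_nonzero[of x] by simp
    have "z * w y \<in> W" if "y \<in> carrier G" for y
      using x that unfolding W_def by (intro image_eqI[of _ _ "x \<otimes> y"]) (simp_all add: w_mult)
    then have "(*) z ` W \<subseteq> W" by (auto simp: W_def)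
    moreover have inj: "inj_on ((*) z) W" using z0 by (auto simp: inj_on_def)
    ultimately have "(*) z ` W = W" using fin by (intro card_subset_eq) (auto simp: W_def card_image)
    then have "prod id W = prod id ((*) z ` W)" by simp
    also have "\<dots> = (\<Prod>v\<in>W. z * v)" using inj by (simp add: prod.reindex)
    also have "\<dots> = z ^ n * prod id W" by (simp add: prod.distrib n_def)
    finally have "prod id W = z ^ n * prod id W" .
    moreover have "prod id W \<noteq> 0" using fin w_nonzero by (auto simp: W_def)
    ultimately show ?thesis by simp
  qed
  then have "W \<subseteq> {z. z ^ n = 1}" by blast
  moreover have "n > 0" using n by (simp add: n_def W_def)
  ultimately have "W = {z. z ^ n = 1}"
    by (intro card_subset_eq finite_roots_unity) (auto simp: card_roots_unity_eq n_def)
  then show "w ` carrier G = {z. z ^ card (w ` carrier G) = 1}" by (simp add: W_def n_def)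
qed

text \<open>Infinitely many elements over finitely many angles give a nontrivial element of angle 0,
  and it or its inverse is strictly positive. An element over the angle \<open>2 * pi / n\<close>
  may still be negative or a unit of the cone; both are corrected without changing the
  angle.\<close>

lemma ex_positive_generator:
  assumes inf: "infinite (carrier G)" and fin: "finite (w ` carrier G)"
  shows "\<exists>g\<in>carrier G. w g = cis (2 * pi / card (w ` carrier G)) \<and> \<not> nn (inv g)"
proof -
  define n where "n = card (w ` carrier G)"
  have n: "n > 0" and W: "w ` carrier G = {z. z ^ n = 1}" using winding_finite[OF fin] by (simp_all add: n_def)
  have wn: "w x ^ n = 1" if "x \<in> carrier G" for x using W that by blast
  have "cis (2 * pi / n) ^ n = 1" using n by (simp add: Complex.DeMoivre)
  then obtain x where x: "x \<in> carrier G" "w x = cis (2 * pi / n)" using W by (metis (mono_tags, lifting) imageE mem_Collect_eq)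
  obtain y where y: "y \<in> carrier G" "infinite {a \<in> carrier G. w a = w y}" using pigeonhole_infinite[OF inf fin] by blast
  then have "infinite ({a \<in> carrier G. w a = w y} - {y})" by simp
  then obtain z where "z \<in> {a \<in> carrier G. w a = w y} - {y}" by (metis finite.emptyI ex_in_conv)
  then have z: "z \<in> carrier G" "w z = w y" "z \<noteq> y" by auto
  define c where "c = inv y \<otimes> z"
  have c: "c \<in> carrier G" "w c = 1" "c \<noteq> \<one>"
    using y z w_nonzero[of y] inv_mult_eq_one_iff[of y z] by (auto simp: c_def w_mult w_inv)
  have "\<exists>c\<in>carrier G. w c = 1 \<and> \<not> nn (inv c)"
  proof (cases "nn (inv c)")
    case True
    then have "\<not> nn (inv (inv c))" using w_nn_inj[of c] c by auto
    then show ?thesis using c w_inv[of c] by (intro bexI[of _ "inv c"]) auto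
  qed (use c in blast)
  then obtain c where c: "c \<in> carrier G" "w c = 1" "\<not> nn (inv c)" by blast
  consider "\<not> nn (inv x)" | "\<not> nn x" | "nn x" "nn (inv x)" by blast
  then have "\<exists>g\<in>carrier G. w g = cis (2 * pi / n) \<and> \<not> nn (inv g)"
  proof cases
    case 1 then show ?thesis using x by blast
  next
    case 2
    \<comment> \<open>\<open>- (2 n - 1) x\<close> has the angle of \<open>x\<close>, since
      \<open>2 n x\<close> has angle 0, and the opposite cone sign. Taking \<open>2 n\<close> rather
      than \<open>n\<close> keeps the exponent positive for \<open>n = 1\<close>.\<close>
    have "x [^] (2 * n) = x [^] (2 * n - 1) \<otimes> x" using n x nat_pow_Suc[of x "2 * n - 1"] by simp
    moreover have "w (x [^] (2 * n)) = 1" using wn[OF x(1)] x by (simp add: w_pow mult.commute power_mult)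
    ultimately have "w (x [^] (2 * n - 1)) * w x = 1" using x by (simp add: w_mult)
    then have "w (inv (x [^] (2 * n - 1))) = w x" using x w_inv[of "x [^] (2 * n - 1)"] by (simp add: inverse_unique)
    moreover have "\<not> nn (x [^] (2 * n - 1))" using 2 nn_pow_iff[of x "2 * n - 1"] x n by simp
    ultimately show ?thesis using x by (intro bexI[of _ "inv (x [^] (2 * n - 1))"]) auto
  next
    case 3
    have "\<not> nn (inv (x \<otimes> c))"
    proof
      assume "nn (inv (x \<otimes> c))"
      then have "nn (x \<otimes> inv (x \<otimes> c))" using 3 x c by (intro nn_mult) auto
      moreover have "x \<otimes> inv (x \<otimes> c) = inv c" using x c by (simp add: inv_mult m_assoc[symmetric])
      ultimately show False using c by simp
    qed
    then show ?thesis using x c by (intro bexI[of _ "x \<otimes> c"]) (auto simp: w_mult)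
  qed
  then show ?thesis by (simp add: n_def)
qed

text \<open>\<open>d\<close> is a lift of \<open>x\<close> within one turn, ends included: 0 belongs
  to strictly positive elements of angle 0, \<open>2 * pi\<close> to strictly negative ones. The
  identity has no such lift, matching the strictness of the relation.\<close>

definition principal :: "real \<Rightarrow> 'a \<Rightarrow> bool" where
  "principal d x \<longleftrightarrow> above G w nn d x \<and> above G w nn (2 * pi - d) (inv x)"

lemma above_mult:
  assumes x: "x \<in> carrier G" and y: "y \<in> carrier G" and "above G w nn d x" "above G w nn e y"
  shows "above G w nn (d + e) (x \<otimes> y)"
proof -
  have "\<not> nn (inv (x \<otimes> y))" if n: "\<not> nn (inv x)" "\<not> nn (inv y)"
  proof
    assume "nn (inv (x \<otimes> y))"
    moreover have "nn x" using nn_total[OF x] n by blast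
    ultimately have "nn (x \<otimes> inv (x \<otimes> y))" using x y by (intro nn_mult) auto
    moreover have "x \<otimes> inv (x \<otimes> y) = inv y" using x y by (simp add: inv_mult m_assoc[symmetric])
    ultimately show False using n by simp
  qed
  then show ?thesis using assms by (auto simp: above_def w_mult cis_mult[symmetric])
qed

lemma principal_bounds: "principal d x \<Longrightarrow> 0 \<le> d" "principal d x \<Longrightarrow> d \<le> 2 * pi"
  by (auto simp: principal_def above_def)

lemma principal_unique:
  assumes x: "x \<in> carrier G" and "principal d x" "principal e x"
  shows "d = e"
proof (rule ccontr)
  assume ne: "d \<noteq> e"
  have "cis (d - e) = 1" using assms w_nonzero[OF x] by (auto simp: principal_def above_def cis_divide[symmetric])
  then have "\<not> \<bar>d - e\<bar> < 2 * pi" using cis_eq_one_small ne by force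
  then have "d = 0 \<and> e = 2 * pi \<or> d = 2 * pi \<and> e = 0"
    using principal_bounds assms by (smt (verit))
  then show False using assms nn_total[OF x] x by (auto simp: principal_def above_def)
qed

text \<open>Each of the three lifts completes the sum of the other two to a full turn; all being
  positive means that the lifts of \<open>y\<close> and of the difference add up without leaving the
  turn.\<close>

lemma cyc_one_iff:
  assumes y: "y \<in> carrier G" and z: "z \<in> carrier G"
  shows "cyc G \<one> y z \<longleftrightarrow> (\<exists>d e. principal d y \<and> principal e (inv y \<otimes> z) \<and> principal (d + e) z)"
proof
  assume "cyc G \<one> y z"
  then obtain d1 d2 d3 where s: "d1 + d2 + d3 = 2 * pi" and d: "above G w nn d1 y"
     "above G w nn d2 (inv y \<otimes> z)" "above G w nn d3 (inv z)"
    using cyc_iff[of \<one> y z] y z by auto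
  have e: "2 * pi - d1 = d2 + d3" "2 * pi - d2 = d3 + d1" "2 * pi - (d1 + d2) = d3" using s by linarith+
  have i: "(inv y \<otimes> z) \<otimes> inv z = inv y" "inv z \<otimes> y = inv (inv y \<otimes> z)" "y \<otimes> (inv y \<otimes> z) = z"
    using y z by (simp_all add: m_assoc inv_mult_group) (simp add: m_assoc[symmetric])
  have "principal d1 y" unfolding principal_def e
    using d above_mult[OF _ _ d(2,3)] y z by (simp add: i)
  moreover have "principal d2 (inv y \<otimes> z)" unfolding principal_def e
    using d above_mult[OF _ _ d(3,1)] y z by (simp add: i)
  moreover have "principal (d1 + d2) z" unfolding principal_def e
    using d above_mult[OF _ _ d(1,2)] y z by (simp add: i)
  ultimately show "\<exists>d e. principal d y \<and> principal e (inv y \<otimes> z) \<and> principal (d + e) z" by blast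
next
  assume "\<exists>d e. principal d y \<and> principal e (inv y \<otimes> z) \<and> principal (d + e) z"
  then obtain d e where "principal d y" "principal e (inv y \<otimes> z)" "principal (d + e) z" by blast
  then have "d + e + (2 * pi - (d + e)) = 2 * pi \<and> above G w nn d (inv \<one> \<otimes> y) \<and> above G w nn e (inv y \<otimes> z)
      \<and> above G w nn (2 * pi - (d + e)) (inv z \<otimes> \<one>)"
    using y z by (simp add: principal_def)
  then show "cyc G \<one> y z" using cyc_iff[of \<one> y z] y z by blast
qed

lemma cyc_one_pow_iff:
  assumes x: "x \<in> carrier G" and d: "principal d x" and e: "principal e (x [^] (j::nat))"
  shows "cyc G \<one> (x [^] j) (x [^] Suc j) \<longleftrightarrow> principal (e + d) (x [^] Suc j)"
proof -
  have i: "inv (x [^] j) \<otimes> x [^] Suc j = x" using x by (simp add: m_assoc[symmetric])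
  show ?thesis
    using cyc_one_iff[of "x [^] j" "x [^] Suc j"] x d e principal_unique[OF x, of _ d] principal_unique[of "x [^] j" _ e]
    unfolding i by (metis nat_pow_closed)
qed

lemma w_inv_cis: "x \<in> carrier G \<Longrightarrow> w x = cis a \<Longrightarrow> w (inv x) = cis (2 * pi - a)"
  by (simp add: w_inv cis_divide[symmetric] divide_inverse)

lemma once_aroundI:
  assumes x: "x \<in> carrier G" "x \<noteq> \<one>" and N: "N > 0"
    and p: "\<And>j::nat. 1 \<le> j \<Longrightarrow> j \<le> N \<Longrightarrow> principal (real j * d) (x [^] j)"
    and big: "2 * pi < real (Suc N) * d"
  shows "once_around N x"
proof -
  have d: "principal d x" using p[of 1] N x by simp
  have "\<not> cyc G \<one> (x [^] N) (x [^] Suc N)"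
    using cyc_one_pow_iff[OF x(1) d p[of N]] principal_bounds(2)[of "real N * d + d" "x [^] Suc N"] N big
    by (auto simp: algebra_simps)
  moreover have "cyc G \<one> (x [^] j) (x [^] Suc j)" if "j \<in> {1..<N}" for j
    using cyc_one_pow_iff[OF x(1) d p[of j]] p[of "Suc j"] that by (simp add: algebra_simps)
  ultimately show ?thesis using x by (simp add: once_around_def)
qed

text \<open>Density supplies an angle strictly between \<open>2 * pi / (N + 1)\<close> and
  \<open>2 * pi / N\<close>.\<close>

lemma once_around_winding_infinite:
  assumes inf: "infinite (w ` carrier G)" and N: "N > 0"
  shows "\<exists>x. once_around N x"
proof -
  define l where "l = 2 * pi / real (Suc N)"
  define u where "u = 2 * pi / real N"
  have lu: "l < u" unfolding l_def u_def using N by (intro divide_strict_left_mono) auto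
  then obtain x \<beta> where x: "x \<in> carrier G" "w x = cis \<beta>" "\<bar>\<beta> - (l + u) / 2\<bar> < (u - l) / 2"
    using winding_dense[OF inf, of "(u - l) / 2" "(l + u) / 2"] by auto
  then have \<beta>: "l < \<beta>" "\<beta> < u" by (auto simp: abs_if field_simps split: if_splits)
  have l0: "0 < l" by (simp add: l_def)
  have up: "real j * \<beta> < 2 * pi" if "j \<le> N" for j
  proof -
    have "real j * \<beta> \<le> real N * \<beta>" using that \<beta> l0 by (intro mult_right_mono) auto
    also have "\<dots> < real N * u" using \<beta> N by simp
    finally show ?thesis using N by (simp add: u_def)
  qed
  have p: "principal (real j * \<beta>) (x [^] j)" if "1 \<le> j" "j \<le> N" for j
  proof -
    have "0 < real j * \<beta>" using that \<beta> l0 by simp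
    moreover have "w (x [^] j) = cis (real j * \<beta>)" using x by (simp add: w_pow Complex.DeMoivre)
    moreover from this have "w (inv (x [^] j)) = cis (2 * pi - real j * \<beta>)"
      by (rule w_inv_cis[rotated]) (use x in simp)
    ultimately show ?thesis using up[OF that(2)] by (simp add: principal_def above_def)
  qed
  have "x \<noteq> \<one>" using x(2) cis_eq_one_small[of \<beta>] \<beta> l0 up[of 1] N by auto
  moreover have "2 * pi < real (Suc N) * \<beta>" using \<beta>(1) by (simp add: l_def field_simps)
  ultimately show ?thesis using once_aroundI[OF x(1) _ N p] by blast
qed

text \<open>The element has angle \<open>2 * pi / n\<close> but negative class: \<open>n x\<close>
  then has lift exactly \<open>2 * pi\<close> and still lies just before the end of the turn, which
  a positive class would overshoot.\<close>

lemma once_around_winding_finite: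
  assumes inf: "infinite (carrier G)" and fin: "finite (w ` carrier G)"
  shows "\<exists>x. once_around (card (w ` carrier G)) x"
proof -
  define n where "n = card (w ` carrier G)"
  have n: "n > 0" using winding_finite[OF fin] by (simp add: n_def)
  obtain g where g: "g \<in> carrier G" "w g = cis (2 * pi / n)" "\<not> nn (inv g)"
    using ex_positive_generator[OF inf fin] by (auto simp: n_def)
  define x where "x = inv (g [^] (2 * n - 1))"
  have x: "x \<in> carrier G" using g by (simp add: x_def)
  have "g [^] (2 * n) = g [^] (2 * n - 1) \<otimes> g" using n g nat_pow_Suc[of g "2 * n - 1"] by simp
  moreover have "w g ^ n = 1" using g n by (simp add: Complex.DeMoivre)
  then have "w (g [^] (2 * n)) = 1" using g(1) by (simp add: w_pow mult.commute[of 2 n] power_mult)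
  ultimately have "w (g [^] (2 * n - 1)) * w g = 1" using g by (simp add: w_mult)
  then have wx: "w x = cis (2 * pi / n)" using g w_inv[of "g [^] (2 * n - 1)"] by (simp add: inverse_unique x_def)
  have nx: "\<not> nn x" using g n nn_pow_iff[of "inv g" "2 * n - 1"] by (simp add: x_def nat_pow_inv)
  have p: "principal (real j * (2 * pi / n)) (x [^] j)" if j: "1 \<le> j" "j \<le> n" for j
  proof -
    have "w (x [^] j) = cis (real j * (2 * pi / n))" using x wx by (simp add: w_pow Complex.DeMoivre)
    moreover from this have "w (inv (x [^] j)) = cis (2 * pi - real j * (2 * pi / n))"
      by (rule w_inv_cis[rotated]) (use x in simp)
    moreover have "0 < real j * (2 * pi / n)" using j n by simp
    moreover have "real j * (2 * pi / n) \<le> 2 * pi" using j n by (simp add: field_simps)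
    moreover have "\<not> nn (x [^] j)" using nx nn_pow_iff[of x j] x j by simp
    ultimately show ?thesis using x by (auto simp: principal_def above_def)
  qed
  have "x \<noteq> \<one>" using nx by auto
  moreover have "2 * pi < real (Suc n) * (2 * pi / n)" using n by (simp add: field_simps)
  ultimately show ?thesis using once_aroundI[OF x _ n p] by (auto simp: n_def)
qed

text \<open>Fitting \<open>n + 1\<close> multiples into a turn gives
  \<open>(n + 1) d \<le> 2 * pi\<close>, while \<open>n d\<close> is a multiple of
  \<open>2 * pi\<close>; hence \<open>d = 0\<close>, and then no multiple ever leaves the turn. In
  an infinite group with finite winding part, the order of that part is thus the largest
  \<open>N\<close> admitting a once-around element.\<close>

lemma not_once_around_winding_finite:
  assumes fin: "finite (w ` carrier G)" and N: "card (w ` carrier G) < N"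
  shows "\<not> once_around N x"
proof
  assume a: "once_around N x"
  define n where "n = card (w ` carrier G)"
  have n: "0 < n" "n < N" and W: "w ` carrier G = {z. z ^ n = 1}" using winding_finite[OF fin] N by (simp_all add: n_def)
  have x: "x \<in> carrier G" and c: "\<And>j. 1 \<le> j \<Longrightarrow> j < N \<Longrightarrow> cyc G \<one> (x [^] j) (x [^] Suc j)"
    and nc: "\<not> cyc G \<one> (x [^] N) (x [^] Suc N)" using a by (auto simp: once_around_def)
  obtain d where d: "principal d x"
    using c[of 1] n cyc_one_iff[of "x [^] (1::nat)" "x [^] Suc 1"] x by auto
  have p: "principal (real j * d) (x [^] j)" if "1 \<le> j" "j \<le> N" for j
    using that
  proof (induction j rule: dec_induct)
    case base then show ?case using d x by simp
  next
    case (step j)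
    then have "principal (real j * d + d) (x [^] Suc j)"
      using cyc_one_pow_iff[OF x d] c[of j] by auto
    then show ?case by (simp add: algebra_simps)
  qed
  have "real (Suc n) * d \<le> 2 * pi" using p[of "Suc n"] n principal_bounds(2) by auto
  moreover have d0: "0 \<le> d" using d principal_bounds(1) by blast
  moreover have "cis (real n * d) = 1"
  proof -
    have "w x ^ n = 1" using W x by blast
    moreover have "w x = cis d" using d by (simp add: principal_def above_def)
    ultimately show ?thesis by (simp add: Complex.DeMoivre)
  qed
  ultimately have "d = 0"
    using cis_eq_one_small[of "real n * d"] n by (cases "d = 0") (auto simp: algebra_simps)
  then have ab: "w x = 1" "\<not> nn (inv x)" using d by (auto simp: principal_def above_def)
  have "principal 0 (x [^] j)" if "j > 0" for j :: nat
  proof -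
    have "w (x [^] j) = 1" using ab x by (simp add: w_pow)
    moreover have "\<not> nn (inv (x [^] j))" using nn_pow_iff[of "inv x" j] ab x that by (simp add: nat_pow_inv)
    ultimately show ?thesis using x by (simp add: principal_def above_def w_inv)
  qed
  from this[of N] this[of "Suc N"] have "cyc G \<one> (x [^] N) (x [^] Suc N)"
    using cyc_one_pow_iff[OF x d, of 0 N] \<open>d = 0\<close> n by simp
  then show False using nc by blast
qed

end

section \<open>The classification\<close>

lemma ex_wound_pair:
  assumes G: "wound_group G w nn" and G': "wound_group G' w' nn'"
    and sub: "w ` comm_group.torsion G \<subseteq> w' ` comm_group.torsion G'"
  shows "\<exists>\<tau>. wound_pair G w nn G' w' nn' \<tau>"
proof -
  interpret G: wound_group G w nn by fact
  interpret G': wound_group G' w' nn' by fact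
  have "\<exists>t'. t' \<in> G'.torsion \<and> w' t' = w t" if "t \<in> G.torsion" for t
    using sub that by (metis image_eqI image_iff subsetD)
  then obtain \<tau> where "\<And>t. t \<in> G.torsion \<Longrightarrow> \<tau> t \<in> G'.torsion \<and> w' (\<tau> t) = w t" by metis
  then have "wound_pair G w nn G' w' nn' \<tau>" by unfold_locales auto
  then show ?thesis by blast
qed

context wound_pair
begin

lemma \<tau>_inj_on: "inj_on \<tau> G.torsion"
proof (rule inj_onI)
  fix x y assume "x \<in> G.torsion" "y \<in> G.torsion" "\<tau> x = \<tau> y"
  then show "x = y" using \<tau>(2)[of x] \<tau>(2)[of y] G.torsion_inj[of x y] by simp
qed

lemma cyc_\<tau>:
  assumes "x \<in> G.torsion" "y \<in> G.torsion" "z \<in> G.torsion"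
  shows "cyc G' (\<tau> x) (\<tau> y) (\<tau> z) \<longleftrightarrow> cyc G x y z"
proof -
  have ab: "above G' w' nn' d (inv\<^bsub>G'\<^esub> (\<tau> x) \<otimes>\<^bsub>G'\<^esub> \<tau> y) \<longleftrightarrow> above G w nn d (inv\<^bsub>G\<^esub> x \<otimes>\<^bsub>G\<^esub> y)"
    if "x \<in> G.torsion" "y \<in> G.torsion" for d x y
  proof -
    have t: "inv\<^bsub>G\<^esub> x \<otimes>\<^bsub>G\<^esub> y \<in> G.torsion" using that by (intro G.torsion_mult G.torsion_inv)
    have "inv\<^bsub>G'\<^esub> (\<tau> x) \<otimes>\<^bsub>G'\<^esub> \<tau> y = \<tau> (inv\<^bsub>G\<^esub> x \<otimes>\<^bsub>G\<^esub> y)"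
      using that by (simp add: \<tau>_mult \<tau>_inv G.torsion_inv)
    then show ?thesis using t \<tau>[OF t] by (simp add: G.above_torsion G'.above_torsion)
  qed
  show ?thesis
    using assms \<tau>_closed by (simp add: G.cyc_iff G'.cyc_iff ab)
qed

lemma satisfiable_transfer:
  assumes p: "quantifier_free p" "satisfiable G p"
    and alt: "infinite (w' ` carrier G') \<or> finite (w' ` carrier G') \<and> w ` carrier G = w' ` carrier G'"
    and inf: "infinite (carrier G')"
  shows "satisfiable G' p"
proof -
  obtain e where e: "range e \<subseteq> carrier G" "sat G e p" using p by (auto simp: satisfiable_def)
  have "infinite (w' ` carrier G') \<or> (\<exists>n::nat. n > 0 \<and> (\<forall>x\<in>carrier G. w x ^ n = 1) \<and>
      (\<exists>g\<in>carrier G'. w' g = cis (2 * pi / n) \<and> \<not> nn' (inv\<^bsub>G'\<^esub> g)))"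
    using alt
  proof
    assume *: "finite (w' ` carrier G') \<and> w ` carrier G = w' ` carrier G'"
    then have "\<forall>x\<in>carrier G. w x ^ card (w' ` carrier G') = 1" using G'.winding_finite(1) by blast
    then show ?thesis using * G'.winding_finite(2) G'.ex_positive_generator[OF inf] by blast
  qed blast
  then obtain e' where "range e' \<subseteq> carrier G'" "atoms_agree G e G' e' (terms_of p)"
    using ex_agreeing_assignment[OF e(1) finite_terms_of] by blast
  then show ?thesis using sat_cong_atoms[OF p(1)] e(2) unfolding satisfiable_def by blast
qed

text \<open>On a torsion group \<open>\<tau>\<close> is itself an embedding, so assignments are
  composed with it. This serves finite groups, which have no strictly positive element.\<close>

lemma satisfiable_transfer_torsion:
  assumes p: "quantifier_free p" "satisfiable G p" and tor: "carrier G = G.torsion"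
  shows "satisfiable G' p"
proof -
  obtain e where e: "range e \<subseteq> carrier G" "sat G e p" using p by (auto simp: satisfiable_def)
  have ec: "eval_trm G e t \<in> G.torsion" for t using G.eval_trm_closed[OF e(1)] tor by simp
  have ev: "eval_trm G' (\<tau> \<circ> e) t = \<tau> (eval_trm G e t)" for t
    by (induction t) (simp_all add: \<tau>_one \<tau>_mult \<tau>_inv ec)
  have "atoms_agree G e G' (\<tau> \<circ> e) (terms_of p)"
    unfolding atoms_agree_def ev using cyc_\<tau>[OF ec ec ec] inj_on_eq_iff[OF \<tau>_inj_on ec ec] by blast
  moreover have "range (\<tau> \<circ> e) \<subseteq> carrier G'" using e(1) tor \<tau>_closed by auto
  ultimately show ?thesis using sat_cong_atoms[OF p(1)] e(2) unfolding satisfiable_def by blast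
qed

end

lemma (in comm_group) finite_torsion: "finite (carrier G) \<Longrightarrow> carrier G = torsion"
proof -
  assume fin: "finite (carrier G)"
  then have "card (carrier G) > 0" using one_closed by (auto simp: card_gt_0_iff)
  then have "x \<in> torsion" if "x \<in> carrier G" for x
    using that power_order_eq_one[OF fin that] torsionI by blast
  then show ?thesis using torsion_closed by blast
qed

lemma torsion_part_carrier: "comm_group G \<Longrightarrow> torsion_part G = G\<lparr>carrier := comm_group.torsion G\<rparr>"
  by (simp add: torsion_part_def comm_group.torsion_def)

text \<open>An isomorphism preserves orders of elements, which determine the image under
  \<open>w\<close> by \<open>w_torsion\<close>. Conversely, equal images make \<open>\<tau>\<close>
  bijective, and on torsion the cyclic relation depends on angles only.\<close>

lemma torsion_parts_isomorphic_iff: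
  assumes G: "wound_group G w nn" and G': "wound_group G' w' nn'"
  shows "cog_isomorphic (torsion_part G) (torsion_part G') \<longleftrightarrow>
    w ` comm_group.torsion G = w' ` comm_group.torsion G'"
proof -
  interpret G: wound_group G w nn by fact
  interpret G': wound_group G' w' nn' by fact
  have T: "torsion_part G = G\<lparr>carrier := G.torsion\<rparr>" "torsion_part G' = G'\<lparr>carrier := G'.torsion\<rparr>"
    using torsion_part_carrier G.comm_group_axioms G'.comm_group_axioms by blast+
  show ?thesis
  proof
    assume "cog_isomorphic (torsion_part G) (torsion_part G')"
    then obtain f where f: "f \<in> cog_embeddings (torsion_part G) (torsion_part G')" "f ` G.torsion = G'.torsion"
      unfolding cog_isomorphic_def by (auto simp: T)
    then have fm: "f (x \<otimes>\<^bsub>G\<^esub> y) = f x \<otimes>\<^bsub>G'\<^esub> f y" if "x \<in> G.torsion" "y \<in> G.torsion" for x y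
      using that by (auto simp: cog_embeddings_def hom_def T)
    have finj: "inj_on f G.torsion" using f by (simp add: cog_embeddings_def T)
    have fc: "f x \<in> G'.torsion" if "x \<in> G.torsion" for x using f(2) that by blast
    have f1: "f \<one>\<^bsub>G\<^esub> = \<one>\<^bsub>G'\<^esub>"
    proof -
      have "f \<one>\<^bsub>G\<^esub> \<otimes>\<^bsub>G'\<^esub> f \<one>\<^bsub>G\<^esub> = f \<one>\<^bsub>G\<^esub>" using fm[of "\<one>\<^bsub>G\<^esub>" "\<one>\<^bsub>G\<^esub>"] by simp
      then show ?thesis using fc[of "\<one>\<^bsub>G\<^esub>"] by (simp add: G'.l_cancel_one)
    qed
    have tp: "x [^]\<^bsub>G\<^esub> n \<in> G.torsion" if "x \<in> G.torsion" for x and n :: nat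
      by (induction n) (use that G.torsion_mult in auto)
    have fp: "f (x [^]\<^bsub>G\<^esub> n) = f x [^]\<^bsub>G'\<^esub> n" if "x \<in> G.torsion" for x and n :: nat
      by (induction n) (use that tp fm f1 in auto)
    have fp1: "x [^]\<^bsub>G\<^esub> n = \<one>\<^bsub>G\<^esub> \<longleftrightarrow> f x [^]\<^bsub>G'\<^esub> n = \<one>\<^bsub>G'\<^esub>" if "x \<in> G.torsion" for x and n :: nat
      using fp[OF that, of n] f1 inj_on_eq_iff[OF finj tp[OF that, of n] G.one_torsion] by simp
    have "G.has_order n \<longleftrightarrow> G'.has_order n" if "n > 0" for n
    proof
      assume "G.has_order n"
      then obtain x where x: "x \<in> carrier G" "x [^]\<^bsub>G\<^esub> n = \<one>\<^bsub>G\<^esub>" "\<forall>j\<in>{1..<n}. x [^]\<^bsub>G\<^esub> j \<noteq> \<one>\<^bsub>G\<^esub>"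
        by (auto simp: G.has_order_def)
      then have xt: "x \<in> G.torsion" using \<open>n > 0\<close> G.torsionI by blast
      show "G'.has_order n" unfolding G'.has_order_def
        using x fc[OF xt] fp1[OF xt] by (intro bexI[of _ "f x"]) auto
    next
      assume "G'.has_order n"
      then obtain y where y: "y \<in> carrier G'" "y [^]\<^bsub>G'\<^esub> n = \<one>\<^bsub>G'\<^esub>" "\<forall>j\<in>{1..<n}. y [^]\<^bsub>G'\<^esub> j \<noteq> \<one>\<^bsub>G'\<^esub>"
        by (auto simp: G'.has_order_def)
      then have "y \<in> G'.torsion" using \<open>n > 0\<close> G'.torsionI by blast
      then obtain x where xt: "x \<in> G.torsion" "y = f x" using f(2) by blast
      show "G.has_order n" unfolding G.has_order_def
        using y xt fp1[OF xt(1)] by (intro bexI[of _ x]) auto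
    qed
    then show "w ` G.torsion = w' ` G'.torsion" unfolding G.w_torsion G'.w_torsion by blast
  next
    assume eq: "w ` G.torsion = w' ` G'.torsion"
    then obtain \<tau> where "wound_pair G w nn G' w' nn' \<tau>" using ex_wound_pair[OF G G'] by blast
    then interpret wound_pair G w nn G' w' nn' \<tau> .
    have "\<tau> \<in> cog_embeddings (torsion_part G) (torsion_part G')"
      using \<tau>(1) \<tau>_mult \<tau>_inj_on cyc_\<tau> by (simp add: cog_embeddings_def hom_def T)
    moreover have "G'.torsion \<subseteq> \<tau> ` G.torsion"
    proof
      fix y assume y: "y \<in> G'.torsion"
      then obtain x where "x \<in> G.torsion" "w x = w' y" using eq by (metis imageE image_eqI)
      then show "y \<in> \<tau> ` G.torsion" using \<tau>[of x] G'.torsion_inj y by (metis image_eqI)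
    qed
    ultimately show "cog_isomorphic (torsion_part G) (torsion_part G')"
      using \<tau>(1) unfolding cog_isomorphic_def by (intro bexI[of _ \<tau>]) (auto simp: T)
  qed
qed

lemma circle_subgroups_isomorphic:
  "cog_isomorphic (circle\<lparr>carrier := W\<rparr>) (circle\<lparr>carrier := W\<rparr>)"
  unfolding cog_isomorphic_def cog_embeddings_def
  by (intro bexI[of _ id]) (auto simp: hom_def circle_def)

lemma cog_isomorphic_card:
  assumes "cog_isomorphic G H"
  shows "card (carrier G) = card (carrier H)"
proof -
  obtain f where "inj_on f (carrier G)" "f ` carrier G = carrier H"
    using assms unfolding cog_isomorphic_def cog_embeddings_def by blast
  then show ?thesis using card_image by fastforce
qed

text \<open>In infinite groups the winding part is read off \<open>once_around\<close>: every
  positive \<open>N\<close> occurs if it is infinite, none above its order if it is finite. Finite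
  groups consist of torsion, so there the first conclusion already gives the second.\<close>

lemma same_sentences_imp:
  assumes G: "wound_group G w nn" and G': "wound_group G' w' nn'"
    and fin: "finite (carrier G) \<longleftrightarrow> finite (carrier G')"
    and same: "same_universal_sentences G G'"
  shows "w ` comm_group.torsion G = w' ` comm_group.torsion G'"
    and "finite (w ` carrier G) \<or> finite (w' ` carrier G') \<Longrightarrow> w ` carrier G = w' ` carrier G'"
proof -
  interpret G: wound_group G w nn by fact
  interpret G': wound_group G' w' nn' by fact
  have "G.has_order n \<longleftrightarrow> G'.has_order n" for n
    using same quantifier_free_order_fm[of n]
    unfolding same_universal_sentences_iff G.satisfiable_order_fm[symmetric] G'.satisfiable_order_fm[symmetric] by blast
  then show tor: "w ` G.torsion = w' ` G'.torsion" unfolding G.w_torsion G'.w_torsion by simp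
  have around: "(\<exists>x. G.once_around n x) \<longleftrightarrow> (\<exists>x. G'.once_around n x)" for n
    using same quantifier_free_once_around_fm[of n]
    unfolding same_universal_sentences_iff G.satisfiable_once_around_fm[symmetric] G'.satisfiable_once_around_fm[symmetric] by blast
  show "w ` carrier G = w' ` carrier G'" if "finite (w ` carrier G) \<or> finite (w' ` carrier G')"
  proof (cases "finite (carrier G)")
    case True
    then have "carrier G = G.torsion" "carrier G' = G'.torsion"
      using fin G.finite_torsion G'.finite_torsion by blast+
    then show ?thesis using tor by simp
  next
    case False
    then have inf: "infinite (carrier G)" "infinite (carrier G')" using fin by auto
    have f: "finite (w ` carrier G)"
    proof (rule ccontr)
      assume i: "infinite (w ` carrier G)"
      then have f: "finite (w' ` carrier G')" using that by blast
      show False using G.once_around_winding_infinite[OF i, of "Suc (card (w' ` carrier G'))"]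
        G'.not_once_around_winding_finite[OF f, of "Suc (card (w' ` carrier G'))"] around by auto
    qed
    have f': "finite (w' ` carrier G')"
    proof (rule ccontr)
      assume i: "infinite (w' ` carrier G')"
      show False using G'.once_around_winding_infinite[OF i, of "Suc (card (w ` carrier G))"]
        G.not_once_around_winding_finite[OF f, of "Suc (card (w ` carrier G))"] around by auto
    qed
    have "card (w ` carrier G) = card (w' ` carrier G')"
      using G.once_around_winding_finite[OF inf(1) f] G'.once_around_winding_finite[OF inf(2) f']
        G.not_once_around_winding_finite[OF f] G'.not_once_around_winding_finite[OF f'] around
      by (metis linorder_neqE_nat)
    then show ?thesis using G.winding_finite(1)[OF f] G'.winding_finite(1)[OF f'] by simp
  qed
qed

lemma same_sentences_if:
  assumes G: "wound_group G w nn" and G': "wound_group G' w' nn'"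
    and fin: "finite (carrier G) \<longleftrightarrow> finite (carrier G')"
    and tor: "w ` comm_group.torsion G = w' ` comm_group.torsion G'"
    and wind: "finite (w ` carrier G) \<and> w ` carrier G = w' ` carrier G'
      \<or> infinite (w ` carrier G) \<and> infinite (w' ` carrier G')"
  shows "same_universal_sentences G G'"
proof -
  interpret G: wound_group G w nn by fact
  interpret G': wound_group G' w' nn' by fact
  obtain \<tau> where "wound_pair G w nn G' w' nn' \<tau>" using ex_wound_pair[OF G G'] tor by blast
  then interpret A: wound_pair G w nn G' w' nn' \<tau> .
  obtain \<sigma> where "wound_pair G' w' nn' G w nn \<sigma>" using ex_wound_pair[OF G' G] tor by blast
  then interpret B: wound_pair G' w' nn' G w nn \<sigma> .
  have "satisfiable G p \<longleftrightarrow> satisfiable G' p" if p: "quantifier_free p" for p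
  proof (cases "finite (carrier G)")
    case True
    then have "carrier G = G.torsion" "carrier G' = G'.torsion"
      using fin G.finite_torsion G'.finite_torsion by blast+
    then show ?thesis using A.satisfiable_transfer_torsion[OF p] B.satisfiable_transfer_torsion[OF p] by blast
  next
    case False
    then show ?thesis using fin A.satisfiable_transfer[OF p] B.satisfiable_transfer[OF p] wind by metis
  qed
  then show ?thesis by (simp add: same_universal_sentences_iff)
qed

theorem theorem6p2:
  fixes G :: "'a cog" and G' :: "'b cog"
  assumes "cyclically_ordered_group G" and "comm_group G"
    and "cyclically_ordered_group G'" and "comm_group G'"
    and "finite (carrier G) \<longleftrightarrow> finite (carrier G')"
  shows "same_universal_sentences G G' \<longleftrightarrow>
    cog_isomorphic (torsion_part G) (torsion_part G') \<and>
    ((finite (carrier (winding_part G)) \<and> finite (carrier (winding_part G')) \<and>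
        cog_isomorphic (winding_part G) (winding_part G'))
     \<or> (infinite (carrier (winding_part G)) \<and> infinite (carrier (winding_part G'))))"
proof -
  obtain w nn where G: "wound_group G w nn" and K: "winding_part G = circle\<lparr>carrier := w ` carrier G\<rparr>"
    using winding_part_wound_group[OF assms(1,2)] by blast
  obtain w' nn' where G': "wound_group G' w' nn'" and K': "winding_part G' = circle\<lparr>carrier := w' ` carrier G'\<rparr>"
    using winding_part_wound_group[OF assms(3,4)] by blast
  \<comment> \<open>An abstract isomorphism of finite winding parts yields equality as subsets of
    the circle: both consist of all \<open>n\<close>-th roots of unity for their common cardinality
    \<open>n\<close>.\<close>
  have "w ` carrier G = w' ` carrier G'"
    if "cog_isomorphic (winding_part G) (winding_part G')" "finite (w ` carrier G)" "finite (w' ` carrier G')"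
    using cog_isomorphic_card[OF that(1)] wound_group.winding_finite(1)[OF G that(2)]
      wound_group.winding_finite(1)[OF G' that(3)] by (simp add: K K')
  moreover have "cog_isomorphic (winding_part G) (winding_part G')" if "w ` carrier G = w' ` carrier G'"
    using that circle_subgroups_isomorphic by (simp add: K K')
  moreover have "carrier (winding_part G) = w ` carrier G" "carrier (winding_part G') = w' ` carrier G'"
    by (simp_all add: K K')
  ultimately show ?thesis
    unfolding torsion_parts_isomorphic_iff[OF G G']
    using same_sentences_imp[OF G G' assms(5)] same_sentences_if[OF G G' assms(5)] by metis
qed

end
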